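(* Let $\underline{L}=(L,B)$ be a positive definite even integral lattice of rank $n\ge1$, $Q(x)=\frac12B(x,x)$, $N$ its level and $D=|L^\sharp/L|$. Let $A=\begin{pmatrix}a&b\\c&d\end{pmatrix}\in\mathrm{SL}_2(\mathbb{Z})$ with $c>0$, $a\neq0$ and $\gcd(N,c)=1$. Then for $w,v\in L^\sharp/L$, $$\rho_{\underline L}(A,1)_{w,v}=\frac{1}{\sqrt D}(-i)^{n/2}\left(\frac{|a|}{c}\right)_K^n\left(\frac{D}{c}\right)_K e\!\left(\frac{n\,\mathrm{sgn}(a)(1-c_0)}{8}\right)e\!\left(\frac{b+c'}{a}Q(v)-c'B(w,v)+ac'Q(w)\right),$$ where $c_0$ is the odd part of $c$ and $c'$ is any integer with $cc'\equiv1\pmod{aN}$ (the last factor is computed on representatives in $L^\sharp$ and is independent of the choices).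
   Context: $e(z)=\exp(2\pi i z)$; fractional powers are principal branches. A lattice $\underline L=(L,B)$ is a free $\mathbb{Z}$-module of finite rank with a nondegenerate symmetric bilinear form $B$ (extended to $\mathbb{Q}\otimes L$); it is positive definite even integral if $Q(x)=\frac12B(x,x)\in\mathbb{Z}_{>0}$ for $0\ne x\in L$. $L^\sharp=\{x: B(x,L)\subseteq\mathbb{Z}\}$ is the dual lattice; the level $N$ is the least positive integer with $NQ(x)\in\mathbb{Z}$ for all $x\in L^\sharp$. $\mathrm{Mp}_2(\mathbb{Z})$ is the set of pairs $(A,\varepsilon)$, $A\in\mathrm{SL}_2(\mathbb{Z})$, $\varepsilon=\pm1$, with product $(A_1,\varepsilon_1)(A_2,\varepsilon_2)=(A_1A_2,\varepsilon_1\varepsilon_2\delta)$, where for $A_j=\begin{pmatrix}a_j&b_j\\c_j&d_j\end{pmatrix}$, $\delta=\frac{\sqrt{c_1(a_2\tau+b_2)/(c_2\tau+d_2)+d_1}\sqrt{c_2\tau+d_2}}{\sqrt{c_1(a_2\tau+b_2)+d_1(c_2\tau+d_2)}}$ for any $\tau$ with $\mathrm{Im}\,\tau>0$ (independent of $\tau$). It is generated by $\widetilde T=(\begin{pmatrix}1&1\\0&1\end{pmatrix},1)$ and $\widetilde S=(\begin{pmatrix}0&-1\\1&0\end{pmatrix},1)$. Let $\mathbb{C}[L^\sharp/L]$ have basis $\delta_x$, $x\in L^\sharp/L$. The Weil representation $\rho_{\underline L}:\mathrm{Mp}_2(\mathbb{Z})\to\mathrm{GL}(\mathbb{C}[L^\sharp/L])$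 is the unique representation with $\rho_{\underline L}(\widetilde T)\delta_x=e(Q(x))\delta_x$ and $\rho_{\underline L}(\widetilde S)\delta_x=\frac{(-i)^{n/2}}{\sqrt{|L^\sharp/L|}}\sum_{y\in L^\sharp/L}e(-B(x,y))\delta_y$. Coefficients are defined by $\rho_{\underline L}(\gamma)\delta_x=\sum_y\delta_y\,\rho_{\underline L}(\gamma)_{y,x}$. $(\frac{\cdot}{\cdot})_K$ is the Kronecker–Jacobi symbol; $c=2^ec_0$ with $c_0$ odd. *)

theory Defs
  imports
    "HOL-Analysis.Analysis"
    "HOL-Number_Theory.Euler_Criterion"
    "HOL-Algebra.Bij"
begin

definition ee :: "complex \<Rightarrow> complex"
  where "ee z = exp (2 * of_real pi * \<i> * z)"

subsection \<open>Lattices\<close>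

text \<open>
  A free \<open>\<int>\<close>-module of finite rank is given inside its rational span \<open>\<rat> \<otimes> L\<close>, which is the
  whole ambient \<open>\<rat>\<close>-vector space; \<open>L\<close> consists of the integral combinations of some
  \<open>\<rat>\<close>-basis of that space. Hence the rank of \<open>L\<close> is \<open>vector_space.dim scl L\<close>.
\<close>

locale Z_lattice = vector_space scl
  for scl :: "rat \<Rightarrow> 'v::ab_group_add \<Rightarrow> 'v" +
  fixes L :: "'v set" and B :: "'v \<Rightarrow> 'v \<Rightarrow> rat"
  assumes free: "\<exists>E. finite E \<and> independent E \<and> span E = UNIV \<and>
      L = range (\<lambda>k :: 'v \<Rightarrow> int. \<Sum>x\<in>E. scl (of_int (k x)) x)"
    and symmetric: "B x y = B y x"
    and bilinear: "Vector_Spaces.linear scl (*) (B x)"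
    and nondegenerate: "(\<And>y. B x y = 0) \<Longrightarrow> x = 0"

definition qform :: "('v \<Rightarrow> 'v \<Rightarrow> rat) \<Rightarrow> 'v \<Rightarrow> rat"
  where "qform B x = B x x / 2"

locale pos_def_even_lattice = Z_lattice scl L B
  for scl :: "rat \<Rightarrow> 'v::ab_group_add \<Rightarrow> 'v" and L :: "'v set" and B :: "'v \<Rightarrow> 'v \<Rightarrow> rat" +
  assumes even: "x \<in> L \<Longrightarrow> qform B x \<in> \<int>"
    and pos_def: "x \<in> L \<Longrightarrow> x \<noteq> 0 \<Longrightarrow> qform B x > 0"

definition dual_lattice :: "'v set \<Rightarrow> ('v \<Rightarrow> 'v \<Rightarrow> rat) \<Rightarrow> 'v set"
  where "dual_lattice L B = {x. \<forall>y\<in>L. B x y \<in> \<int>}"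

definition lattice_level :: "'v set \<Rightarrow> ('v \<Rightarrow> 'v \<Rightarrow> rat) \<Rightarrow> nat"
  where "lattice_level L B =
    (LEAST N. N > 0 \<and> (\<forall>x \<in> dual_lattice L B. of_nat N * qform B x \<in> \<int>))"

definition lcoset :: "'v::ab_group_add set \<Rightarrow> 'v \<Rightarrow> 'v set"
  where "lcoset L x = (+) x ` L"

definition disc_module :: "'v::ab_group_add set \<Rightarrow> ('v \<Rightarrow> 'v \<Rightarrow> rat) \<Rightarrow> 'v set set"
  where "disc_module L B = lcoset L ` dual_lattice L B"

subsection \<open>The metaplectic group\<close>

definition mat22 :: "int \<Rightarrow> int \<Rightarrow> int \<Rightarrow> int \<Rightarrow> int^2^2"
  where "mat22 a b c d = vector [vector [a, b], vector [c, d]]"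

definition SL2Z :: "(int^2^2) set"
  where "SL2Z = {A. det A = 1}"

definition mp2_cocycle :: "int^2^2 \<Rightarrow> int^2^2 \<Rightarrow> complex \<Rightarrow> complex"
  where "mp2_cocycle A1 A2 \<tau> =
    (let c1 = of_int (A1$2$1); d1 = of_int (A1$2$2);
         a2 = of_int (A2$1$1); b2 = of_int (A2$1$2);
         c2 = of_int (A2$2$1); d2 = of_int (A2$2$2)
     in csqrt (c1 * (a2 * \<tau> + b2) / (c2 * \<tau> + d2) + d1) * csqrt (c2 * \<tau> + d2)
        / csqrt (c1 * (a2 * \<tau> + b2) + d1 * (c2 * \<tau> + d2)))"

text \<open>
  The value of \<open>mp2_cocycle A1 A2\<close> does not depend on the point of the upper half plane (see
  \<open>mp2_cocycle_indep\<close> below), so the product may be computed at \<open>\<i>\<close>. The sign \<open>\<epsilon>\<close> is kept as a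
  complex number.
\<close>

definition Mp2Z :: "((int^2^2) \<times> complex) monoid"
  where "Mp2Z =
    \<lparr>carrier = SL2Z \<times> {1, -1},
     mult = (\<lambda>(A1, \<epsilon>1) (A2, \<epsilon>2). (A1 ** A2, \<epsilon>1 * \<epsilon>2 * mp2_cocycle A1 A2 \<i>)),
     one = (mat 1, 1)\<rparr>"

definition T_mp :: "(int^2^2) \<times> complex"
  where "T_mp = (mat22 1 1 0 1, 1)"

definition S_mp :: "(int^2^2) \<times> complex"
  where "S_mp = (mat22 0 (-1) 1 0, 1)"

subsection \<open>The Weil representation\<close>

text \<open>The complex vector space with basis \<open>X\<close>, for a finite set \<open>X\<close>.\<close>

definition free_space :: "'x set \<Rightarrow> ('x \<Rightarrow> complex) set"
  where "free_space X = {f. \<forall>x. x \<notin> X \<longrightarrow> f x = 0}"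

definition basis_fun :: "'x \<Rightarrow> 'x \<Rightarrow> complex"
  where "basis_fun x = (\<lambda>y. if y = x then 1 else 0)"

definition linear_on_free_space :: "'x set \<Rightarrow> (('x \<Rightarrow> complex) \<Rightarrow> ('x \<Rightarrow> complex)) \<Rightarrow> bool"
  where "linear_on_free_space X \<phi> \<longleftrightarrow>
    (\<forall>f\<in>free_space X. \<forall>g\<in>free_space X. \<phi> (\<lambda>x. f x + g x) = (\<lambda>x. \<phi> f x + \<phi> g x)) \<and>
    (\<forall>f\<in>free_space X. \<forall>r. \<phi> (\<lambda>x. r * f x) = (\<lambda>x. r * \<phi> f x))"

definition GL_free :: "'x set \<Rightarrow> (('x \<Rightarrow> complex) \<Rightarrow> ('x \<Rightarrow> complex)) monoid"
  where "GL_free X = BijGroup (free_space X)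
    \<lparr>carrier := {\<phi> \<in> Bij (free_space X). linear_on_free_space X \<phi>}\<rparr>"

text \<open>
  \<open>is_weil_rep scl L B \<rho>\<close>: \<open>\<rho>\<close> is the Weil representation of \<open>(L, B)\<close>. Elements of \<open>L\<^sup>\<sharp>/L\<close> are
  cosets; in the sum over \<open>Y\<close> the summand does not depend on the representative of \<open>Y\<close>.
\<close>

definition is_weil_rep ::
    "(rat \<Rightarrow> 'v::ab_group_add \<Rightarrow> 'v) \<Rightarrow> 'v set \<Rightarrow> ('v \<Rightarrow> 'v \<Rightarrow> rat) \<Rightarrow>
      ((int^2^2) \<times> complex \<Rightarrow> ('v set \<Rightarrow> complex) \<Rightarrow> ('v set \<Rightarrow> complex)) \<Rightarrow> bool"
  where "is_weil_rep scl L B \<rho> \<longleftrightarrow>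
    \<rho> \<in> hom Mp2Z (GL_free (disc_module L B)) \<and>
    (\<forall>x \<in> dual_lattice L B.
      \<rho> T_mp (basis_fun (lcoset L x)) =
        (\<lambda>Z. ee (of_rat (qform B x)) * basis_fun (lcoset L x) Z)) \<and>
    (\<forall>x \<in> dual_lattice L B.
      \<rho> S_mp (basis_fun (lcoset L x)) =
        (\<lambda>Z. (- \<i>) powr (of_nat (vector_space.dim scl L) / 2)
             / of_real (sqrt (real (card (disc_module L B))))
             * (\<Sum>Y \<in> disc_module L B.
                  ee (of_rat (- B x (SOME y. y \<in> Y))) * basis_fun Y Z)))"

text \<open>The coefficient \<open>\<rho>(\<gamma>)\<^bsub>y,x\<^esub>\<close> is the \<open>\<delta>\<^sub>y\<close>-coordinate of \<open>\<rho>(\<gamma>) \<delta>\<^sub>x\<close>.\<close>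

definition rep_coeff :: "('g \<Rightarrow> ('x \<Rightarrow> complex) \<Rightarrow> ('x \<Rightarrow> complex)) \<Rightarrow> 'g \<Rightarrow> 'x \<Rightarrow> 'x \<Rightarrow> complex"
  where "rep_coeff \<rho> \<gamma> y x = \<rho> \<gamma> (basis_fun x) y"

subsection \<open>The Kronecker--Jacobi symbol\<close>

definition kronecker_two :: "int \<Rightarrow> int"
  where "kronecker_two a =
    (if even a then 0 else if a mod 8 = 1 \<or> a mod 8 = 7 then 1 else -1)"

definition kronecker :: "int \<Rightarrow> int \<Rightarrow> int"
  where "kronecker a m =
    (if m = 0 then (if \<bar>a\<bar> = 1 then 1 else 0)
     else (if m < 0 \<and> a < 0 then -1 else 1) *
       (\<Prod>p \<in># prime_factorization (nat \<bar>m\<bar>).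
          if p = 2 then kronecker_two a else Legendre a (int p)))"

subsection \<open>The metaplectic group is well defined\<close>

definition autj :: "int^2^2 \<Rightarrow> complex \<Rightarrow> complex"
  where "autj A \<tau> = of_int (A$2$1) * \<tau> + of_int (A$2$2)"

definition moebius :: "int^2^2 \<Rightarrow> complex \<Rightarrow> complex"
  where "moebius A \<tau> = (of_int (A$1$1) * \<tau> + of_int (A$1$2)) / autj A \<tau>"

lemma mult_22_entries:
  fixes A C :: "int^2^2"
  shows "(A ** C)$i$j = A$i$1 * C$1$j + A$i$2 * C$2$j"
  by (simp add: matrix_matrix_mult_def sum_2)

lemma SL2Z_mult: "A \<in> SL2Z \<Longrightarrow> C \<in> SL2Z \<Longrightarrow> A ** C \<in> SL2Z"
  by (simp add: SL2Z_def det_mul)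

lemma autj_nonzero:
  assumes "A \<in> SL2Z" "Im \<tau> > 0" shows "autj A \<tau> \<noteq> 0"
proof
  assume *: "autj A \<tau> = 0"
  then have "Im (autj A \<tau>) = 0" by simp
  then have c: "A$2$1 = 0" using assms by (simp add: autj_def)
  with * have "A$2$2 = 0" by (simp add: autj_def)
  with c assms show False by (simp add: SL2Z_def det_2)
qed

lemma Im_moebius:
  assumes "A \<in> SL2Z" "Im \<tau> > 0" shows "Im (moebius A \<tau>) > 0"
proof -
  have nz: "(cmod (autj A \<tau>))\<^sup>2 > 0" using autj_nonzero[OF assms] by simp
  have det: "real_of_int (A$1$1) * real_of_int (A$2$2) - real_of_int (A$1$2) * real_of_int (A$2$1) = 1"
    using assms(1) unfolding SL2Z_def det_2 mem_Collect_eq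
    by (metis of_int_1 of_int_diff of_int_mult)
  have "Im (moebius A \<tau>) = (Im ((of_int (A$1$1) * \<tau> + of_int (A$1$2)) * cnj (autj A \<tau>)))
      / (cmod (autj A \<tau>))\<^sup>2"
    unfolding moebius_def by (simp add: Im_divide cmod_power2 algebra_simps)
  also have "Im ((of_int (A$1$1) * \<tau> + of_int (A$1$2)) * cnj (autj A \<tau>)) =
     (real_of_int (A$1$1) * real_of_int (A$2$2) - real_of_int (A$1$2) * real_of_int (A$2$1)) * Im \<tau>"
    by (simp add: autj_def algebra_simps)
  finally show ?thesis using nz det assms(2) by simp
qed

lemma autj_mult:
  assumes "C \<in> SL2Z" "Im \<tau> > 0"
  shows "autj (A ** C) \<tau> = autj A (moebius C \<tau>) * autj C \<tau>"
proof -
  have "autj A (moebius C \<tau>) * autj C \<tau> =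
     of_int (A$2$1) * (of_int (C$1$1) * \<tau> + of_int (C$1$2)) + of_int (A$2$2) * autj C \<tau>"
    using autj_nonzero[OF assms] by (simp add: autj_def[of A] moebius_def field_simps)
  then show ?thesis by (simp add: autj_def mult_22_entries algebra_simps)
qed

lemma moebius_mult:
  assumes "A \<in> SL2Z" "C \<in> SL2Z" "Im \<tau> > 0"
  shows "moebius (A ** C) \<tau> = moebius A (moebius C \<tau>)"
proof -
  have "(of_int (A$1$1) * moebius C \<tau> + of_int (A$1$2)) * autj C \<tau> =
     of_int (A$1$1) * (of_int (C$1$1) * \<tau> + of_int (C$1$2)) + of_int (A$1$2) * autj C \<tau>"
    using autj_nonzero[OF assms(2,3)] by (simp add: moebius_def field_simps)
  then have num: "of_int ((A ** C)$1$1) * \<tau> + of_int ((A ** C)$1$2) =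
      (of_int (A$1$1) * moebius C \<tau> + of_int (A$1$2)) * autj C \<tau>"
    by (simp add: autj_def mult_22_entries algebra_simps)
  show ?thesis
    unfolding moebius_def[of "A ** C"] num autj_mult[OF assms(2,3)]
    using autj_nonzero[OF assms(2,3)] by (simp add: moebius_def[of A])
qed

lemma mp2_cocycle_eq:
  assumes "C \<in> SL2Z" "Im \<tau> > 0"
  shows "mp2_cocycle A C \<tau> =
    csqrt (autj A (moebius C \<tau>)) * csqrt (autj C \<tau>) / csqrt (autj (A ** C) \<tau>)"
proof -
  have "autj (A ** C) \<tau> =
      of_int (A$2$1) * (of_int (C$1$1) * \<tau> + of_int (C$1$2)) + of_int (A$2$2) * autj C \<tau>"
    by (simp add: autj_def mult_22_entries algebra_simps)
  then show ?thesis
    by (simp add: mp2_cocycle_def Let_def autj_def moebius_def)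
qed

lemma mp2_cocycle_square:
  assumes "A \<in> SL2Z" "C \<in> SL2Z" "Im \<tau> > 0"
  shows "mp2_cocycle A C \<tau> * mp2_cocycle A C \<tau> = 1"
proof -
  have sq: "csqrt z * csqrt z = z" for z by (metis power2_csqrt power2_eq_square)
  have "mp2_cocycle A C \<tau> * mp2_cocycle A C \<tau> =
    (csqrt (autj A (moebius C \<tau>)) * csqrt (autj A (moebius C \<tau>))) *
    (csqrt (autj C \<tau>) * csqrt (autj C \<tau>)) /
    (csqrt (autj (A ** C) \<tau>) * csqrt (autj (A ** C) \<tau>))"
    by (simp add: mp2_cocycle_eq[OF assms(2,3)])
  also have "\<dots> = 1"
    unfolding sq using autj_mult[OF assms(2,3)] autj_nonzero[OF SL2Z_mult[OF assms(1,2)] assms(3)]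
    by simp
  finally show ?thesis .
qed

lemma mp2_cocycle_sign:
  assumes "A \<in> SL2Z" "C \<in> SL2Z" "Im \<tau> > 0"
  shows "mp2_cocycle A C \<tau> \<in> {1, -1}"
  using mp2_cocycle_square[OF assms] square_eq_1_iff by blast

lemma continuous_csqrt_autj:
  assumes "A \<in> SL2Z"
  shows "continuous_on {\<tau>. Im \<tau> > 0} (\<lambda>\<tau>. csqrt (autj A \<tau>))"
proof (cases "A$2$1 = 0")
  case True
  then show ?thesis by (simp add: autj_def)
next
  case False
  have "autj A \<tau> \<notin> \<real>\<^sub>\<le>\<^sub>0" if "Im \<tau> > 0" for \<tau>
  proof
    assume "autj A \<tau> \<in> \<real>\<^sub>\<le>\<^sub>0"
    then have "Im (autj A \<tau>) = 0" using complex_nonpos_Reals_iff by blast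
    then show False using that False by (simp add: autj_def)
  qed
  moreover have "isCont (autj A) \<tau>" for \<tau> unfolding autj_def by (intro continuous_intros)
  ultimately show ?thesis
    by (intro continuous_at_imp_continuous_on ballI isCont_csqrt') auto
qed

lemma continuous_moebius:
  assumes "A \<in> SL2Z"
  shows "continuous_on {\<tau>. Im \<tau> > 0} (moebius A)"
proof -
  have "continuous_on {\<tau>. Im \<tau> > 0} (autj A)" unfolding autj_def by (intro continuous_intros)
  then show ?thesis unfolding moebius_def
    using autj_nonzero[OF assms] by (intro continuous_intros) auto
qed

lemma mp2_cocycle_indep:
  assumes "A \<in> SL2Z" "C \<in> SL2Z" "Im \<tau> > 0"
  shows "mp2_cocycle A C \<tau> = mp2_cocycle A C \<i>"
proof -
  let ?H = "{\<tau>. Im \<tau> > 0}"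
  have "continuous_on ?H (\<lambda>\<tau>. csqrt (autj A (moebius C \<tau>)))"
    by (rule continuous_on_compose2[OF continuous_csqrt_autj[OF assms(1)]
          continuous_moebius[OF assms(2)]]) (use Im_moebius[OF assms(2)] in auto)
  then have "continuous_on ?H (\<lambda>\<tau>. csqrt (autj A (moebius C \<tau>)) * csqrt (autj C \<tau>)
      / csqrt (autj (A ** C) \<tau>))"
    using autj_nonzero[OF SL2Z_mult[OF assms(1,2)]]
    by (intro continuous_on_divide continuous_on_mult continuous_csqrt_autj SL2Z_mult assms) auto
  then have cont: "continuous_on ?H (mp2_cocycle A C)"
    by (rule continuous_on_cong[THEN iffD1, rotated -1]) (auto simp: mp2_cocycle_eq[OF assms(2)])
  have conn: "connected ?H"
    by (intro convex_connected convex_halfspace_Im_gt)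
  have "mp2_cocycle A C ` ?H \<subseteq> {1, -1}"
    using mp2_cocycle_sign[OF assms(1,2)] by blast
  then have "finite (mp2_cocycle A C ` ?H)"
    using finite_subset by blast
  then have "mp2_cocycle A C constant_on ?H"
    using continuous_finite_range_constant[OF conn cont] by blast
  then show ?thesis using assms(3) by (auto simp: constant_on_def)
qed

lemma mp2_cocycle_assoc:
  assumes "A \<in> SL2Z" "C \<in> SL2Z" "E \<in> SL2Z"
  shows "mp2_cocycle (A ** C) E \<i> * mp2_cocycle A C \<i> =
    mp2_cocycle A (C ** E) \<i> * mp2_cocycle C E \<i>"
proof -
  let ?u = "moebius E \<i>"
  have i: "Im \<i> > 0" by simp
  have u: "Im ?u > 0" using Im_moebius[OF assms(3) i] .
  have nz: "csqrt (autj (A ** C) ?u) \<noteq> 0" "csqrt (autj (C ** E) \<i>) \<noteq> 0"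
    using autj_nonzero[OF SL2Z_mult[OF assms(1,2)] u]
      autj_nonzero[OF SL2Z_mult[OF assms(2,3)] i] by auto
  have "mp2_cocycle A C \<i> = mp2_cocycle A C ?u"
    using mp2_cocycle_indep[OF assms(1,2) u] by simp
  then show ?thesis
    using nz
    by (simp add: mp2_cocycle_eq[OF assms(3) i] mp2_cocycle_eq[OF assms(2) u]
        mp2_cocycle_eq[OF SL2Z_mult[OF assms(2,3)] i] moebius_mult[OF assms(2,3) i]
        matrix_mul_assoc field_simps)
qed

lemma SL2Z_left_inverse:
  assumes "A \<in> SL2Z"
  shows "\<exists>C \<in> SL2Z. C ** A = mat 1"
proof
  let ?C = "mat22 (A$2$2) (- A$1$2) (- A$2$1) (A$1$1)"
  have "A$1$1 * A$2$2 - A$1$2 * A$2$1 = 1" using assms by (simp add: SL2Z_def det_2)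
  then show "?C ** A = mat 1" and "?C \<in> SL2Z"
    by (simp_all add: SL2Z_def det_2 mat22_def vec_eq_iff forall_2 mult_22_entries mat_def
        algebra_simps)
qed

lemma group_Mp2Z: "group Mp2Z"
proof (rule groupI)
  have autj_1: "autj (mat 1) \<tau> = 1" "moebius (mat 1) \<tau> = \<tau>" for \<tau>
    by (simp_all add: autj_def moebius_def mat_def)
  have I: "mat 1 \<in> SL2Z" by (simp add: SL2Z_def)
  show "\<one>\<^bsub>Mp2Z\<^esub> \<in> carrier Mp2Z" by (simp add: Mp2Z_def I)
  fix x assume x: "x \<in> carrier Mp2Z"
  then obtain A \<epsilon> where A: "x = (A, \<epsilon>)" "A \<in> SL2Z" "\<epsilon> \<in> {1, -1}"
    by (auto simp: Mp2Z_def)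
  have "csqrt (autj A \<i>) \<noteq> 0" using autj_nonzero[OF A(2), of \<i>] by simp
  then show "\<one>\<^bsub>Mp2Z\<^esub> \<otimes>\<^bsub>Mp2Z\<^esub> x = x"
    using A mp2_cocycle_eq[OF A(2), of \<i> "mat 1"] by (simp add: Mp2Z_def autj_1)
  obtain C where C: "C \<in> SL2Z" "C ** A = mat 1" using SL2Z_left_inverse[OF A(2)] by blast
  let ?y = "(C, \<epsilon> * mp2_cocycle C A \<i>)"
  have "?y \<in> carrier Mp2Z" "?y \<otimes>\<^bsub>Mp2Z\<^esub> x = \<one>\<^bsub>Mp2Z\<^esub>"
    using A C mp2_cocycle_sign[OF C(1) A(2), of \<i>] by (auto simp: Mp2Z_def)
  then show "\<exists>y \<in> carrier Mp2Z. y \<otimes>\<^bsub>Mp2Z\<^esub> x = \<one>\<^bsub>Mp2Z\<^esub>" by blast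
  fix y assume "y \<in> carrier Mp2Z"
  then obtain C \<eta> where C: "y = (C, \<eta>)" "C \<in> SL2Z" "\<eta> \<in> {1, -1}"
    by (auto simp: Mp2Z_def)
  show "x \<otimes>\<^bsub>Mp2Z\<^esub> y \<in> carrier Mp2Z"
    using A C mp2_cocycle_sign[OF A(2) C(2), of \<i>] SL2Z_mult[OF A(2) C(2)]
    by (auto simp: Mp2Z_def)
  fix z assume "z \<in> carrier Mp2Z"
  then obtain E \<zeta> where E: "z = (E, \<zeta>)" "E \<in> SL2Z" "\<zeta> \<in> {1, -1}"
    by (auto simp: Mp2Z_def)
  show "x \<otimes>\<^bsub>Mp2Z\<^esub> y \<otimes>\<^bsub>Mp2Z\<^esub> z = x \<otimes>\<^bsub>Mp2Z\<^esub> (y \<otimes>\<^bsub>Mp2Z\<^esub> z)"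
    using mp2_cocycle_assoc[OF A(2) C(2) E(2)]
    by (simp add: Mp2Z_def A(1) C(1) E(1) matrix_mul_assoc mult_ac)
qed

end

theory Submission
  imports Defs
begin

text \<open>
  For \<open>c > 0\<close> the coefficient of the Weil representation at \<open>(A, 1)\<close> is, up to an elementary factor,
  the average of \<open>e ((a Q y - B (y, v) + d Q v) / c)\<close> over \<open>y \<in> w + L\<close>. This follows by Euclidean descent
  on \<open>c\<close>: left multiplication by \<open>T\<close> shifts \<open>a\<close> by multiples of \<open>c\<close>, and left multiplication by \<open>S\<close> is
  the reciprocity law of Gauss sums. Reciprocity in turn is Milgram's formula for the lattices
  \<open>(m L, B / m)\<close>, and Milgram's formula reduces to the one-dimensional Gauss sum by comparing \<open>L\<close> with an
  orthogonal sublattice.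

  When \<open>c\<close> is prime to the level, completing the square leaves the Gauss sum of \<open>Q / c\<close> on \<open>L\<close>, which by
  Milgram's formula is governed by \<open>G c\<close>, the average of \<open>e (c Q u)\<close> over \<open>L\<^sup>\<sharp>/L\<close>. The value of
  \<open>D (G c)\<close> is an eighth root of unity times \<open>\<surd>D\<close>. For an odd prime \<open>p\<close> the congruence
  \<open>(D (G t)) ^ p \<equiv> D (G (p t))\<close> modulo \<open>p\<close> in a cyclotomic ring, together with Euler's criterion for \<open>D\<close>,
  determines the root of unity; the prime \<open>2\<close> is treated by pairing opposite cosets.
\<close>

section \<open>Averages of periodic functions on abelian groups\<close>

text \<open>Averages replace sums over finite quotients, so that lattices which are shifted,
  rescaled or mapped onto one another can be compared without counting fibres. The descent
  multiplies by \<open>S\<close> only when both entries of the first column are positive; there the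
  cocycle is 1, and no metaplectic sign has to be tracked. The congruence modulo \<open>p\<close>
  would be of no use if only the absolute value of \<open>G c\<close> were known: first
  \<open>\<surd>D (G c)\<close> has to be a root of unity. For odd \<open>c\<close> this comes from
  solving \<open>\<alpha>\<^sup>2 + \<beta>\<^sup>2 \<equiv> - 1\<close> modulo \<open>c\<close>,
  which makes two copies of \<open>Q / c\<close> isometric to two copies of \<open>- Q / c\<close>.
  Modulo 2 signs are invisible; pairing cosets allows the congruence to be applied to half of the
  Gauss sum, which recovers the lost factor and separates the classes of \<open>D\<close> modulo 8.
  An even \<open>c\<close> prime to the level makes the level odd, and then the rank is even, so
  that the square of the Gauss sum \<open>D (G t)\<close> is an integer there.\<close>

definition add_subgroup :: "'a::ab_group_add set \<Rightarrow> bool"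
  where "add_subgroup A \<longleftrightarrow> 0 \<in> A \<and> (\<forall>x\<in>A. \<forall>y\<in>A. x - y \<in> A)"

definition transversal :: "'a::ab_group_add set \<Rightarrow> 'a set \<Rightarrow> 'a set \<Rightarrow> bool"
  where "transversal H A T \<longleftrightarrow> finite T \<and> T \<subseteq> A \<and> (\<forall>x\<in>A. \<exists>!t. t \<in> T \<and> x - t \<in> H)"

definition finite_index :: "'a::ab_group_add set \<Rightarrow> 'a set \<Rightarrow> bool"
  where "finite_index H A \<longleftrightarrow>
    add_subgroup H \<and> add_subgroup A \<and> H \<subseteq> A \<and> finite (lcoset H ` A)"

definition index :: "'a::ab_group_add set \<Rightarrow> 'a set \<Rightarrow> nat"
  where "index H A = card (lcoset H ` A)"

definition periodic_mod :: "'a::ab_group_add set \<Rightarrow> 'a set \<Rightarrow> ('a \<Rightarrow> 'b) \<Rightarrow> bool"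
  where "periodic_mod H A f \<longleftrightarrow> finite_index H A \<and> (\<forall>x\<in>A. \<forall>h\<in>H. f (x + h) = f x)"

definition periodic_on :: "'a::ab_group_add set \<Rightarrow> ('a \<Rightarrow> 'b) \<Rightarrow> bool"
  where "periodic_on A f \<longleftrightarrow> (\<exists>H. periodic_mod H A f)"

text \<open>The value does not depend on the chosen period (\<open>mean_eq\<close>). On functions
  that factor through a finite quotient this is the translation-invariant probability integral, and
  no quotient group has to be formed.\<close>

definition mean :: "'a::ab_group_add set \<Rightarrow> ('a \<Rightarrow> complex) \<Rightarrow> complex"
  where "mean A f = (let H = SOME H. periodic_mod H A f in
    (\<Sum>Y\<in>lcoset H ` A. f (SOME y. y \<in> Y)) / of_nat (index H A))"

lemma add_subgroup_zero: "add_subgroup A \<Longrightarrow> 0 \<in> A"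
  by (simp add: add_subgroup_def)

lemma add_subgroup_diff: "add_subgroup A \<Longrightarrow> x \<in> A \<Longrightarrow> y \<in> A \<Longrightarrow> x - y \<in> A"
  by (simp add: add_subgroup_def)

lemma add_subgroup_minus: "add_subgroup A \<Longrightarrow> x \<in> A \<Longrightarrow> - x \<in> A"
  using add_subgroup_diff[of A 0 x] add_subgroup_zero[of A] by simp

lemma add_subgroup_add: "add_subgroup A \<Longrightarrow> x \<in> A \<Longrightarrow> y \<in> A \<Longrightarrow> x + y \<in> A"
  using add_subgroup_diff[of A x "- y"] add_subgroup_minus[of A y] by simp

lemma add_subgroup_add_iff:
  "add_subgroup A \<Longrightarrow> y \<in> A \<Longrightarrow> x + y \<in> A \<longleftrightarrow> x \<in> A"
  using add_subgroup_diff[of A "x + y" y] add_subgroup_add[of A x y] by auto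

lemma add_subgroup_sum:
  "add_subgroup A \<Longrightarrow> (\<And>i. i \<in> I \<Longrightarrow> f i \<in> A) \<Longrightarrow> sum f I \<in> A"
  by (induction I rule: infinite_finite_induct) (auto simp: add_subgroup_zero add_subgroup_add)

lemma add_subgroup_Int: "add_subgroup A \<Longrightarrow> add_subgroup C \<Longrightarrow> add_subgroup (A \<inter> C)"
  by (auto simp: add_subgroup_def)

lemma add_subgroup_Times: "add_subgroup A \<Longrightarrow> add_subgroup C \<Longrightarrow> add_subgroup (A \<times> C)"
  unfolding add_subgroup_def zero_prod_def by auto

lemma add_subgroup_UNIV: "add_subgroup UNIV"
  by (simp add: add_subgroup_def)

lemma mem_lcoset_iff: "y \<in> lcoset H x \<longleftrightarrow> y - x \<in> H"
proof
  assume "y - x \<in> H"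
  then have "x + (y - x) \<in> lcoset H x" unfolding lcoset_def by blast
  then show "y \<in> lcoset H x" by simp
qed (auto simp: lcoset_def)

lemma lcoset_eq_iff:
  assumes "add_subgroup H"
  shows "lcoset H x = lcoset H y \<longleftrightarrow> x - y \<in> H"
proof
  assume "lcoset H x = lcoset H y"
  moreover have "x \<in> lcoset H x" by (simp add: mem_lcoset_iff add_subgroup_zero assms)
  ultimately show "x - y \<in> H" by (simp add: mem_lcoset_iff)
next
  assume xy: "x - y \<in> H"
  have "z - x \<in> H \<longleftrightarrow> z - y \<in> H" for z
    using add_subgroup_add_iff[OF assms xy, of "z - x"] by simp
  then show "lcoset H x = lcoset H y" by (auto simp: mem_lcoset_iff)
qed

lemma some_in_lcoset:
  assumes "add_subgroup H"
  shows "(SOME y. y \<in> lcoset H x) - x \<in> H"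
proof -
  have "x \<in> lcoset H x" by (simp add: mem_lcoset_iff add_subgroup_zero assms)
  then show ?thesis using someI[of "\<lambda>y. y \<in> lcoset H x" x] by (simp add: mem_lcoset_iff)
qed

lemma finite_index_transversal:
  assumes "finite_index H A"
  obtains T where "transversal H A T"
proof
  let ?T = "(\<lambda>Y. SOME y. y \<in> Y) ` lcoset H ` A"
  have H: "add_subgroup H" and A: "add_subgroup A" and HA: "H \<subseteq> A"
    and fin: "finite (lcoset H ` A)"
    using assms by (auto simp: finite_index_def)
  have rep: "(SOME y. y \<in> lcoset H x) - x \<in> H" for x using some_in_lcoset[OF H] .
  show "transversal H A ?T" unfolding transversal_def
  proof (intro conjI ballI)
    show "finite ?T" using fin by simp
    show "?T \<subseteq> A"
    proof clarify
      fix x assume "x \<in> A"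
      then show "(SOME y. y \<in> lcoset H x) \<in> A"
        using add_subgroup_add[OF A, of "(SOME y. y \<in> lcoset H x) - x" x] rep[of x] HA by auto
    qed
    fix x assume x: "x \<in> A"
    show "\<exists>!t. t \<in> ?T \<and> x - t \<in> H"
    proof (intro ex1I conjI)
      show "(SOME y. y \<in> lcoset H x) \<in> ?T" using x by blast
      show "x - (SOME y. y \<in> lcoset H x) \<in> H"
        using add_subgroup_minus[OF H rep[of x]] by simp
      fix t assume t: "t \<in> ?T \<and> x - t \<in> H"
      then obtain y where y: "t = (SOME z. z \<in> lcoset H y)" by blast
      have "x - y \<in> H" using add_subgroup_add[OF H conjunct2[OF t] rep[of y]] y by simp
      then show "t = (SOME z. z \<in> lcoset H x)" using y lcoset_eq_iff[OF H, of x y] by simp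
    qed
  qed
qed

lemma transversal_bij:
  assumes "finite_index H A" "transversal H A T"
  shows "bij_betw (lcoset H) T (lcoset H ` A)"
proof -
  have H: "add_subgroup H" and HA: "H \<subseteq> A" using assms(1) by (auto simp: finite_index_def)
  have 1: "inj_on (lcoset H) T"
  proof (rule inj_onI)
    fix s t assume st: "s \<in> T" "t \<in> T" "lcoset H s = lcoset H t"
    then have "s - t \<in> H" "s - s \<in> H" "s \<in> A"
      using lcoset_eq_iff[OF H] add_subgroup_zero[OF H] assms(2) by (auto simp: transversal_def)
    then show "s = t" using st assms(2) unfolding transversal_def by blast
  qed
  have "lcoset H x \<in> lcoset H ` T" if "x \<in> A" for x
    using that assms(2) lcoset_eq_iff[OF H] unfolding transversal_def by blast
  then have "lcoset H ` T = lcoset H ` A" using assms(2) by (auto simp: transversal_def)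
  then show ?thesis using 1 by (simp add: bij_betw_def)
qed

lemma transversal_card:
  "finite_index H A \<Longrightarrow> transversal H A T \<Longrightarrow> card T = index H A"
  using bij_betw_same_card[OF transversal_bij] by (simp add: index_def)

lemma transversal_sum:
  fixes f :: "'a::ab_group_add \<Rightarrow> 'b::comm_monoid_add"
  assumes f: "periodic_mod H A f" and T: "transversal H A T"
  shows "(\<Sum>Y\<in>lcoset H ` A. f (SOME y. y \<in> Y)) = sum f T"
proof -
  have fi: "finite_index H A" and H: "add_subgroup H" and TA: "T \<subseteq> A"
    using f T by (auto simp: periodic_mod_def finite_index_def transversal_def)
  have "sum f T = (\<Sum>t\<in>T. f (SOME y. y \<in> lcoset H t))"
  proof (rule sum.cong[OF refl])
    fix t assume "t \<in> T"
    then have "f (t + ((SOME y. y \<in> lcoset H t) - t)) = f t"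
      using f some_in_lcoset[OF H, of t] TA unfolding periodic_mod_def by blast
    then show "f t = f (SOME y. y \<in> lcoset H t)" by simp
  qed
  then show ?thesis
    using sum.reindex_bij_betw[OF transversal_bij[OF fi T], of "\<lambda>Y. f (SOME y. y \<in> Y)"] by simp
qed

text \<open>Every coset of \<open>H \<inter> C\<close> in \<open>C\<close> is the trace on
  \<open>C\<close> of a coset of \<open>H\<close>.\<close>

lemma finite_index_Int:
  assumes "finite_index H A" "add_subgroup C" "C \<subseteq> A"
  shows "finite_index (H \<inter> C) C"
proof -
  have H: "add_subgroup H" using assms by (simp add: finite_index_def)
  have HC: "add_subgroup (H \<inter> C)" using H assms(2) by (rule add_subgroup_Int)
  have "lcoset (H \<inter> C) ` C \<subseteq> (\<lambda>Y. Y \<inter> C) ` (lcoset H ` A)"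
  proof
    fix Z assume "Z \<in> lcoset (H \<inter> C) ` C"
    then obtain x where x: "x \<in> C" "Z = lcoset (H \<inter> C) x" by blast
    have "y - x \<in> C \<longleftrightarrow> y \<in> C" for y
      using add_subgroup_add_iff[OF assms(2) x(1), of "y - x"] by simp
    then have "Z = lcoset H x \<inter> C" unfolding x(2) set_eq_iff by (simp add: mem_lcoset_iff)
    then show "Z \<in> (\<lambda>Y. Y \<inter> C) ` (lcoset H ` A)" using x(1) assms(3) by blast
  qed
  then have "finite (lcoset (H \<inter> C) ` C)"
    using assms(1) finite_subset unfolding finite_index_def by blast
  then show ?thesis using HC assms(2) by (simp add: finite_index_def)
qed

text \<open>Reduce first modulo \<open>H\<close> by \<open>s\<close>, then the remainder modulo
  \<open>K\<close> by \<open>t\<close>. Both the multiplicativity of the index and the comparison of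
  averages for different periods rest on this.\<close>

lemma transversal_tower:
  assumes "finite_index H A" "add_subgroup K" "K \<subseteq> H"
    and S: "transversal H A S" and T: "transversal K H T"
  shows "inj_on (\<lambda>(s, t). s + t) (S \<times> T)" "transversal K A ((\<lambda>(s, t). s + t) ` (S \<times> T))"
proof -
  have H: "add_subgroup H" and A: "add_subgroup A" and HA: "H \<subseteq> A"
    using assms by (auto simp: finite_index_def)
  have TH: "T \<subseteq> H" and SA: "S \<subseteq> A" and fin: "finite S" "finite T"
    using S T by (auto simp: transversal_def)
  have uniq: "s = s' \<and> t = t'"
    if "s \<in> S" "s' \<in> S" "t \<in> T" "t' \<in> T" "x \<in> A" "x - (s + t) \<in> K" "x - (s' + t') \<in> K"
    for s s' t t' x
  proof -
    have "x - s = (x - (s + t)) + t" "x - s' = (x - (s' + t')) + t'" by simp_all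
    then have xs: "x - s \<in> H" "x - s' \<in> H"
      using that TH assms(3) add_subgroup_add[OF H] by (metis subsetD)+
    then have ss: "s = s'" using S that unfolding transversal_def by blast
    have "(x - s) - t \<in> K" "(x - s) - t' \<in> K" using that ss by (simp_all add: diff_diff_eq)
    then have "t = t'" using T that xs(1) unfolding transversal_def by blast
    with ss show ?thesis by simp
  qed
  show "inj_on (\<lambda>(s, t). s + t) (S \<times> T)"
  proof (rule inj_onI, clarify)
    fix s t s' t' assume a: "s \<in> S" "s' \<in> S" "t \<in> T" "t' \<in> T" "s + t = s' + t'"
    have "s + t \<in> A" using a SA TH HA add_subgroup_add[OF A] by blast
    then show "s = s' \<and> t = t'"
      using uniq[OF a(1-4), of "s + t"] a(5) add_subgroup_zero[OF assms(2)] by simp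
  qed
  show "transversal K A ((\<lambda>(s, t). s + t) ` (S \<times> T))"
    unfolding transversal_def
  proof (intro conjI ballI)
    show "(\<lambda>(s, t). s + t) ` (S \<times> T) \<subseteq> A"
    proof clarify
      fix s t assume "s \<in> S" "t \<in> T"
      then show "s + t \<in> A" using SA TH HA add_subgroup_add[OF A] by blast
    qed
    fix x assume x: "x \<in> A"
    then obtain s where s: "s \<in> S" "x - s \<in> H" using S unfolding transversal_def by blast
    then obtain t where t: "t \<in> T" "x - s - t \<in> K" using T unfolding transversal_def by blast
    show "\<exists>!u. u \<in> (\<lambda>(s, t). s + t) ` (S \<times> T) \<and> x - u \<in> K"
    proof (intro ex1I conjI)
      show "s + t \<in> (\<lambda>(s, t). s + t) ` (S \<times> T)" using s t by force
      show xst: "x - (s + t) \<in> K" using t by (simp add: diff_diff_eq)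
      fix u assume u: "u \<in> (\<lambda>(s, t). s + t) ` (S \<times> T) \<and> x - u \<in> K"
      then show "u = s + t" using uniq[OF s(1) _ t(1) _ x xst] by fastforce
    qed
  qed (use fin in simp)
qed

lemma finite_index_transversalI:
  assumes "add_subgroup H" "add_subgroup A" "H \<subseteq> A" "transversal H A T"
  shows "finite_index H A"
proof -
  have "lcoset H ` A \<subseteq> lcoset H ` T"
    using assms lcoset_eq_iff[OF assms(1)] unfolding transversal_def by blast
  then have "finite (lcoset H ` A)"
    using assms(4) finite_subset unfolding transversal_def by blast
  then show ?thesis using assms by (simp add: finite_index_def)
qed

lemma
  assumes "finite_index K H" "finite_index H A"
  shows finite_index_trans: "finite_index K A"
    and index_mult: "index K A = index K H * index H A"
proof -
  obtain S T where S: "transversal H A S" and T: "transversal K H T"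
    using finite_index_transversal assms by metis
  have K: "add_subgroup K" "K \<subseteq> H" "add_subgroup A" "K \<subseteq> A"
    using assms by (auto simp: finite_index_def)
  note * = transversal_tower[OF assms(2) K(1,2) S T]
  show KA: "finite_index K A"
    by (rule finite_index_transversalI[OF K(1,3,4) *(2)])
  show "index K A = index K H * index H A"
    using transversal_card[OF KA *(2)] card_image[OF *(1)] transversal_card[OF assms(1) T]
      transversal_card[OF assms(2) S] by (simp add: card_cartesian_product mult.commute)
qed

lemma finite_index_mono:
  assumes "finite_index K A" "K \<subseteq> H" "H \<subseteq> A" "add_subgroup H"
  shows "finite_index K H" "finite_index H A"
proof -
  have K: "add_subgroup K" and A: "add_subgroup A" using assms by (auto simp: finite_index_def)
  show "finite_index K H"
    using finite_index_Int[OF assms(1,4,3)] assms(2) by (simp add: inf.absorb1)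
  have "lcoset H ` A \<subseteq> (\<lambda>Y. lcoset H (SOME y. y \<in> Y)) ` lcoset K ` A"
  proof clarify
    fix x assume x: "x \<in> A"
    have "(SOME y. y \<in> lcoset K x) - x \<in> H" using some_in_lcoset[OF K] assms(2) by blast
    then have "lcoset H x = lcoset H (SOME y. y \<in> lcoset K x)"
      by (simp add: lcoset_eq_iff[OF assms(4), symmetric])
    then show "lcoset H x \<in> (\<lambda>Y. lcoset H (SOME y. y \<in> Y)) ` lcoset K ` A" using x by blast
  qed
  then have "finite (lcoset H ` A)" using assms(1) finite_subset unfolding finite_index_def by blast
  then show "finite_index H A" using assms A by (simp add: finite_index_def)
qed

lemma index_pos: "finite_index H A \<Longrightarrow> index H A > 0"
  by (auto simp: index_def finite_index_def card_gt_0_iff dest: add_subgroup_zero)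

text \<open>A finer period repeats every value \<open>index K H\<close> times, and the denominator
  grows by the same factor. Two arbitrary periods are later compared through their
  intersection.\<close>

lemma qsum_subgroup:
  fixes f :: "'a::ab_group_add \<Rightarrow> complex"
  assumes f: "periodic_mod H A f" and K: "add_subgroup K" "K \<subseteq> H" "finite_index K A"
  shows "(\<Sum>Y\<in>lcoset K ` A. f (SOME y. y \<in> Y)) / of_nat (index K A)
    = (\<Sum>Y\<in>lcoset H ` A. f (SOME y. y \<in> Y)) / of_nat (index H A)"
proof -
  have fi: "finite_index H A" using f by (simp add: periodic_mod_def)
  have KH: "finite_index K H" using finite_index_mono[OF K(3,2)] fi by (auto simp: finite_index_def)
  obtain S T where S: "transversal H A S" and T: "transversal K H T"
    using finite_index_transversal[OF fi] finite_index_transversal[OF KH] by metis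
  note * = transversal_tower[OF fi K(1,2) S T]
  have fK: "periodic_mod K A f" using f K by (auto simp: periodic_mod_def)
  have "sum f ((\<lambda>(s, t). s + t) ` (S \<times> T)) = (\<Sum>s\<in>S. \<Sum>t\<in>T. f (s + t))"
    using sum.reindex[OF *(1), of f] by (simp add: sum.cartesian_product case_prod_unfold)
  also have "\<dots> = (\<Sum>s\<in>S. \<Sum>t\<in>T. f s)"
  proof (intro sum.cong refl)
    fix s t assume "s \<in> S" "t \<in> T"
    then have "s \<in> A" "t \<in> H" using S T unfolding transversal_def by blast+
    then show "f (s + t) = f s" using f unfolding periodic_mod_def by blast
  qed
  finally have "sum f ((\<lambda>(s, t). s + t) ` (S \<times> T)) = of_nat (index K H) * sum f S"
    using transversal_card[OF KH T] by (simp add: sum_distrib_left)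
  then show ?thesis
    using transversal_sum[OF f S] transversal_sum[OF fK *(2)] index_mult[OF KH fi] index_pos[OF KH]
    by simp
qed

lemma finite_index_inter:
  assumes "finite_index H A" "finite_index K A"
  shows "finite_index (H \<inter> K) A"
  using finite_index_trans[OF finite_index_Int[OF assms(1), of K] assms(2)] assms(2)
  by (simp add: finite_index_def)

lemma mean_eq:
  assumes "periodic_mod H A f"
  shows "mean A f = (\<Sum>Y\<in>lcoset H ` A. f (SOME y. y \<in> Y)) / of_nat (index H A)"
proof -
  define K where "K = (SOME H. periodic_mod H A f)"
  have K: "periodic_mod K A f" unfolding K_def using assms by (rule someI)
  have fi: "finite_index H A" "finite_index K A" using assms K by (auto simp: periodic_mod_def)
  have HK: "finite_index (H \<inter> K) A" by (rule finite_index_inter[OF fi])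
  have "add_subgroup (H \<inter> K)" using HK by (simp add: finite_index_def)
  then have "(\<Sum>Y\<in>lcoset K ` A. f (SOME y. y \<in> Y)) / of_nat (index K A)
    = (\<Sum>Y\<in>lcoset H ` A. f (SOME y. y \<in> Y)) / of_nat (index H A)"
    using qsum_subgroup[OF assms _ _ HK] qsum_subgroup[OF K _ _ HK] by simp
  then show ?thesis by (simp add: mean_def K_def)
qed

lemma mean_transversal:
  assumes "periodic_mod H A f" "transversal H A T"
  shows "mean A f = sum f T / of_nat (card T)"
  using mean_eq[OF assms(1)] transversal_sum[OF assms] transversal_card[OF _ assms(2)] assms(1)
  by (simp add: periodic_mod_def)

lemma periodic_mod_cong:
  assumes "\<And>x. x \<in> A \<Longrightarrow> f x = g x"
  shows "periodic_mod H A f \<longleftrightarrow> periodic_mod H A g"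
proof (cases "finite_index H A")
  case True
  then have "x + h \<in> A" if "x \<in> A" "h \<in> H" for x h
    using that by (auto simp: finite_index_def intro: add_subgroup_add)
  then show ?thesis using assms by (auto simp: periodic_mod_def)
qed (simp add: periodic_mod_def)

lemma periodic_on_cong:
  assumes "\<And>x. x \<in> A \<Longrightarrow> f x = g x"
  shows "periodic_on A f \<longleftrightarrow> periodic_on A g"
proof -
  have "periodic_mod H A f \<longleftrightarrow> periodic_mod H A g" for H
    by (rule periodic_mod_cong) (rule assms)
  then show ?thesis by (simp add: periodic_on_def)
qed

lemma mean_cong:
  assumes "periodic_on A f" "\<And>x. x \<in> A \<Longrightarrow> f x = g x"
  shows "mean A f = mean A g"
proof -
  obtain H where H: "periodic_mod H A f" using assms(1) by (auto simp: periodic_on_def)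
  then have Hg: "periodic_mod H A g" using periodic_mod_cong[of A f g H] assms(2) by simp
  obtain T where T: "transversal H A T"
    using H finite_index_transversal by (auto simp: periodic_mod_def)
  have "sum f T = sum g T" using T assms(2) by (intro sum.cong) (auto simp: transversal_def)
  then show ?thesis using mean_transversal[OF H T] mean_transversal[OF Hg T] by simp
qed

lemma periodic_mod_mono:
  assumes "periodic_mod H A f" "K \<subseteq> H" "finite_index K A"
  shows "periodic_mod K A f"
  using assms by (auto simp: periodic_mod_def)

lemma periodic_on_both:
  assumes "periodic_on A f" "periodic_on A g"
  obtains H where "periodic_mod H A f" "periodic_mod H A g"
proof -
  obtain H K where HK: "periodic_mod H A f" "periodic_mod K A g"
    using assms by (auto simp: periodic_on_def)
  then have "finite_index (H \<inter> K) A" by (intro finite_index_inter) (auto simp: periodic_mod_def)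
  then have "periodic_mod (H \<inter> K) A f" "periodic_mod (H \<inter> K) A g"
    using HK periodic_mod_mono by (metis inf_le1 inf_le2)+
  then show thesis using that by blast
qed

lemma periodic_on_combine:
  assumes "periodic_on A f" "periodic_on A g"
  shows "periodic_on A (\<lambda>x. F (f x) (g x))"
proof -
  obtain H where "periodic_mod H A f" "periodic_mod H A g" using periodic_on_both[OF assms] .
  then have "periodic_mod H A (\<lambda>x. F (f x) (g x))" by (auto simp: periodic_mod_def)
  then show ?thesis by (auto simp: periodic_on_def)
qed

lemma periodic_on_compose: "periodic_on A f \<Longrightarrow> periodic_on A (\<lambda>x. F (f x))"
  using periodic_on_combine[of A f f "\<lambda>x _. F x"] by simp

lemma periodic_on_const: "add_subgroup A \<Longrightarrow> periodic_on A (\<lambda>x. c)"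
  unfolding periodic_on_def
proof
  assume A: "add_subgroup A"
  have "lcoset A ` A \<subseteq> {A}" using lcoset_eq_iff[OF A, of _ 0] by (auto simp: lcoset_def)
  then have "finite_index A A" using A by (auto simp: finite_index_def intro: finite_subset)
  then show "periodic_mod A A (\<lambda>x. c)" by (simp add: periodic_mod_def)
qed

lemma periodic_mod_shift:
  assumes "periodic_mod H A f" "a \<in> A"
  shows "periodic_mod H A (\<lambda>x. f (x + a))"
proof -
  have A: "add_subgroup A" using assms by (simp add: periodic_mod_def finite_index_def)
  have "f (x + h + a) = f (x + a)" if "x \<in> A" "h \<in> H" for x h
  proof -
    have "f ((x + a) + h) = f (x + a)"
      using assms that add_subgroup_add[OF A] unfolding periodic_mod_def by blast
    then show ?thesis by (simp add: algebra_simps)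
  qed
  then show ?thesis using assms by (simp add: periodic_mod_def)
qed

lemma mean_const:
  assumes "add_subgroup A" shows "mean A (\<lambda>x. c) = c"
proof -
  obtain H where H: "periodic_mod H A (\<lambda>x. c)"
    using periodic_on_const[OF assms, of c] by (auto simp: periodic_on_def)
  then obtain T where T: "transversal H A T"
    using finite_index_transversal by (auto simp: periodic_mod_def)
  have "card T > 0"
    using H T index_pos[of H A] by (simp add: periodic_mod_def transversal_card)
  then show ?thesis using mean_transversal[OF H T] by simp
qed

lemma mean_mult_left:
  assumes "periodic_on A f" shows "mean A (\<lambda>x. c * f x) = c * mean A f"
proof -
  obtain H where H: "periodic_mod H A f" using assms by (auto simp: periodic_on_def)
  then have Hc: "periodic_mod H A (\<lambda>x. c * f x)" by (simp add: periodic_mod_def)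
  obtain T where T: "transversal H A T"
    using H finite_index_transversal by (auto simp: periodic_mod_def)
  show ?thesis using mean_transversal[OF H T] mean_transversal[OF Hc T]
    by (simp add: sum_distrib_left)
qed

lemma mean_cnj:
  assumes "periodic_on A f" shows "mean A (\<lambda>x. cnj (f x)) = cnj (mean A f)"
proof -
  obtain H where H: "periodic_mod H A f" using assms by (auto simp: periodic_on_def)
  then have Hc: "periodic_mod H A (\<lambda>x. cnj (f x))" by (simp add: periodic_mod_def)
  obtain T where T: "transversal H A T"
    using H finite_index_transversal by (auto simp: periodic_mod_def)
  show ?thesis using mean_transversal[OF H T] mean_transversal[OF Hc T] by simp
qed

text \<open>The map \<open>\<phi>\<close> need only be surjective modulo the periods of \<open>f\<close>, and not injective: this is
  the reason for working with averages instead of sums over quotient groups.\<close>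

lemma
  fixes \<phi> :: "'a::ab_group_add \<Rightarrow> 'b::ab_group_add"
  assumes A: "add_subgroup A"
    and add: "\<And>x y. x \<in> A \<Longrightarrow> y \<in> A \<Longrightarrow> \<phi> (x + y) = \<phi> x + \<phi> y"
    and img: "\<And>x. x \<in> A \<Longrightarrow> \<phi> x \<in> C"
    and f: "periodic_mod H C f"
    and surj: "\<And>y. y \<in> C \<Longrightarrow> \<exists>x\<in>A. y - \<phi> x \<in> H"
  shows periodic_on_reindex: "periodic_on A (\<lambda>x. f (\<phi> x))"
    and mean_reindex: "mean A (\<lambda>x. f (\<phi> x)) = mean C f"
proof -
  have C: "add_subgroup C" and H: "add_subgroup H" and fi: "finite_index H C"
    using f by (auto simp: periodic_mod_def finite_index_def)
  \<comment> \<open>The periods pulled back along \<open>\<phi>\<close>. Lifting a transversal of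
    \<open>H\<close> in \<open>C\<close> through \<open>\<phi>\<close> gives a transversal of
    \<open>?K\<close> in \<open>A\<close>, so the two averages are sums of the same terms.\<close>
  let ?K = "{x \<in> A. \<phi> x \<in> H}"
  have \<phi>0: "\<phi> 0 = 0" using add[of 0 0] add_subgroup_zero[OF A] by simp
  have diff: "\<phi> (x - y) = \<phi> x - \<phi> y" if "x \<in> A" "y \<in> A" for x y
    using add[of "x - y" y] that add_subgroup_diff[OF A] by (simp add: algebra_simps)
  have K: "add_subgroup ?K"
    unfolding add_subgroup_def using A H \<phi>0 diff by (auto simp: add_subgroup_def)
  obtain T where T: "transversal H C T" using finite_index_transversal[OF fi] .
  have "\<exists>r. \<forall>t\<in>T. r t \<in> A \<and> t - \<phi> (r t) \<in> H"
    using surj T unfolding transversal_def by (metis subsetD)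
  then obtain r where r: "\<And>t. t \<in> T \<Longrightarrow> r t \<in> A \<and> t - \<phi> (r t) \<in> H" by blast
  have eq: "t = s" if "t \<in> T" "s \<in> T" "\<phi> (r t) - \<phi> (r s) \<in> H" for t s
  proof -
    have "t - s = (t - \<phi> (r t)) + (\<phi> (r t) - \<phi> (r s)) - (s - \<phi> (r s))" by simp
    then have "t - s \<in> H" using r that add_subgroup_add[OF H] add_subgroup_diff[OF H] by metis
    moreover have "t - t \<in> H" "t \<in> C" using add_subgroup_zero[OF H] T that by (auto simp: transversal_def)
    ultimately show ?thesis using T that unfolding transversal_def by blast
  qed
  have inj: "inj_on r T"
    by (rule inj_onI, rule eq) (auto simp: add_subgroup_zero[OF H])
  have tr: "transversal ?K A (r ` T)"
    unfolding transversal_def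
  proof (intro conjI ballI)
    fix x assume x: "x \<in> A"
    then obtain t where t: "t \<in> T" "\<phi> x - t \<in> H" using img T unfolding transversal_def by blast
    show "\<exists>!u. u \<in> r ` T \<and> x - u \<in> ?K"
    proof (intro ex1I conjI)
      show "r t \<in> r ` T" using t by simp
      have "\<phi> x - \<phi> (r t) \<in> H" using add_subgroup_add[OF H t(2), of "t - \<phi> (r t)"] r[OF t(1)] by simp
      then show xt: "x - r t \<in> ?K" using r[OF t(1)] x diff add_subgroup_diff[OF A] by simp
      fix u assume u: "u \<in> r ` T \<and> x - u \<in> ?K"
      then obtain s where s: "s \<in> T" "u = r s" by blast
      have "\<phi> (x - u) - \<phi> (x - r t) \<in> H" using u xt add_subgroup_diff[OF H] by blast
      then have "\<phi> (r t) - \<phi> (r s) \<in> H" using s x r t diff by simp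
      then show "u = r t" using eq[OF t(1) s(1)] s(2) by simp
    qed
  qed (use T r in \<open>auto simp: transversal_def\<close>)
  have "finite_index ?K A" by (rule finite_index_transversalI[OF K A _ tr]) auto
  moreover have "f (\<phi> (x + h)) = f (\<phi> x)" if "x \<in> A" "h \<in> ?K" for x h
  proof -
    have "f (\<phi> x + \<phi> h) = f (\<phi> x)"
      using that f img[of x] unfolding periodic_mod_def by blast
    then show ?thesis using add[of x h] that by simp
  qed
  ultimately have per: "periodic_mod ?K A (\<lambda>x. f (\<phi> x))" by (auto simp: periodic_mod_def)
  then show "periodic_on A (\<lambda>x. f (\<phi> x))" by (auto simp: periodic_on_def)
  have "f (\<phi> (r t)) = f t" if "t \<in> T" for t
  proof -
    have "f (\<phi> (r t) + (t - \<phi> (r t))) = f (\<phi> (r t))"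
      using f r[OF that] img unfolding periodic_mod_def by blast
    then show ?thesis by simp
  qed
  then have "sum (\<lambda>x. f (\<phi> x)) (r ` T) = sum f T"
    using sum.reindex[OF inj, of "\<lambda>x. f (\<phi> x)"] by simp
  then show "mean A (\<lambda>x. f (\<phi> x)) = mean C f"
    using mean_transversal[OF per tr] mean_transversal[OF f T] card_image[OF inj] by simp
qed

lemma mean_reindex_surj:
  assumes "add_subgroup A" "\<And>x y. x \<in> A \<Longrightarrow> y \<in> A \<Longrightarrow> \<phi> (x + y) = \<phi> x + \<phi> y"
    and "\<phi> ` A = C" "periodic_on C f"
  shows "periodic_on A (\<lambda>x. f (\<phi> x))" "mean A (\<lambda>x. f (\<phi> x)) = mean C f"
proof -
  obtain H where H: "periodic_mod H C f" using assms(4) by (auto simp: periodic_on_def)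
  then have "0 \<in> H" by (auto simp: periodic_mod_def finite_index_def add_subgroup_zero)
  then have s: "\<exists>x\<in>A. y - \<phi> x \<in> H" if "y \<in> C" for y using assms(3) that by force
  show "periodic_on A (\<lambda>x. f (\<phi> x))" "mean A (\<lambda>x. f (\<phi> x)) = mean C f"
    using periodic_on_reindex[OF assms(1,2) _ H s] mean_reindex[OF assms(1,2) _ H s] assms(3) by blast+
qed

lemma mean_shift:
  assumes f: "periodic_on A f" and a: "a \<in> A"
  shows "periodic_on A (\<lambda>x. f (x + a))" "mean A (\<lambda>x. f (x + a)) = mean A f"
proof -
  obtain H where H: "periodic_mod H A f" using f by (auto simp: periodic_on_def)
  then have A: "add_subgroup A" by (simp add: periodic_mod_def finite_index_def)
  note Ha = periodic_mod_shift[OF H a]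
  then show "periodic_on A (\<lambda>x. f (x + a))" by (auto simp: periodic_on_def)
  obtain T where T: "transversal H A T"
    using H finite_index_transversal by (auto simp: periodic_mod_def)
  have inj: "inj_on (\<lambda>x. x + a) T" by (simp add: inj_on_def)
  have "transversal H A ((\<lambda>x. x + a) ` T)"
    unfolding transversal_def
  proof (intro conjI ballI)
    fix x assume "x \<in> A"
    then have "\<exists>!t. t \<in> T \<and> (x - a) - t \<in> H"
      using T a add_subgroup_diff[OF A] by (simp add: transversal_def)
    then obtain t where t: "t \<in> T" "(x - a) - t \<in> H"
      "\<And>s. s \<in> T \<Longrightarrow> (x - a) - s \<in> H \<Longrightarrow> s = t" by blast
    have eq: "x - (s + a) = x - a - s" for s by (simp add: algebra_simps)
    show "\<exists>!t. t \<in> (\<lambda>x. x + a) ` T \<and> x - t \<in> H"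
    proof (intro ex1I conjI)
      show "t + a \<in> (\<lambda>x. x + a) ` T" using t(1) by simp
      show "x - (t + a) \<in> H" using t(2) unfolding eq .
      fix u assume u: "u \<in> (\<lambda>x. x + a) ` T \<and> x - u \<in> H"
      then obtain s where s: "s \<in> T" "u = s + a" by blast
      then show "u = t + a" using t(3)[of s] u unfolding s(2) eq by simp
    qed
  qed (use T a add_subgroup_add[OF A] in \<open>auto simp: transversal_def\<close>)
  then have "mean A f = sum f ((\<lambda>x. x + a) ` T) / of_nat (card T)"
    using mean_transversal[OF H] card_image[OF inj] by simp
  also have "sum f ((\<lambda>x. x + a) ` T) = (\<Sum>x\<in>T. f (x + a))"
    using sum.reindex[OF inj, of f] by simp
  finally show "mean A (\<lambda>x. f (x + a)) = mean A f"
    using mean_transversal[OF Ha T] by simp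
qed

text \<open>Fubini. It is used in both directions: to insert an inner average that is a character
  sum on \<open>C\<close>, and to merge an average over cosets with one over
  \<open>C\<close>.\<close>

lemma
  assumes f: "periodic_on A f" and C: "add_subgroup C" "C \<subseteq> A"
  shows periodic_on_subgroup: "\<And>x. x \<in> A \<Longrightarrow> periodic_on C (\<lambda>y. f (x + y))"
    and periodic_on_mean: "periodic_on A (\<lambda>x. mean C (\<lambda>y. f (x + y)))"
    and mean_tower: "mean A (\<lambda>x. mean C (\<lambda>y. f (x + y))) = mean A f"
proof -
  obtain H where H: "periodic_mod H A f" using f by (auto simp: periodic_on_def)
  then have fi: "finite_index H A" and A: "add_subgroup A"
    by (auto simp: periodic_mod_def finite_index_def)
  have HC: "finite_index (H \<inter> C) C" by (rule finite_index_Int[OF fi C])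
  have per: "periodic_mod (H \<inter> C) C (\<lambda>y. f (x + y))" if x: "x \<in> A" for x
    unfolding periodic_mod_def
  proof (intro conjI ballI HC)
    fix y h assume "y \<in> C" "h \<in> H \<inter> C"
    then have "x + y \<in> A" "h \<in> H" using x C add_subgroup_add[OF A] by auto
    then have "f ((x + y) + h) = f (x + y)" using H unfolding periodic_mod_def by blast
    then show "f (x + (y + h)) = f (x + y)" by (simp add: add.assoc)
  qed
  then show "\<And>x. x \<in> A \<Longrightarrow> periodic_on C (\<lambda>y. f (x + y))" by (auto simp: periodic_on_def)
  obtain S where S: "transversal (H \<inter> C) C S" using finite_index_transversal[OF HC] .
  obtain T where T: "transversal H A T" using finite_index_transversal[OF fi] .
  have inner: "mean C (\<lambda>y. f (x + y)) = (\<Sum>s\<in>S. f (x + s)) / of_nat (card S)" if "x \<in> A" for x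
    using mean_transversal[OF per[OF that] S] .
  have SA: "S \<subseteq> A" using S C by (auto simp: transversal_def)
  have sh: "f (x + h + s) = f (x + s)" if "x \<in> A" "h \<in> H" "s \<in> S" for x h s
    using periodic_mod_shift[OF H, of s] SA that by (auto simp: periodic_mod_def)
  have perF: "periodic_mod H A (\<lambda>x. mean C (\<lambda>y. f (x + y)))"
    unfolding periodic_mod_def
  proof (intro conjI ballI fi)
    fix x h assume x: "x \<in> A" "h \<in> H"
    then have "x + h \<in> A" using fi add_subgroup_add[OF A] by (auto simp: finite_index_def)
    then show "mean C (\<lambda>y. f (x + h + y)) = mean C (\<lambda>y. f (x + y))"
      using x sh by (simp add: inner)
  qed
  then show "periodic_on A (\<lambda>x. mean C (\<lambda>y. f (x + y)))" by (auto simp: periodic_on_def)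
  have cS: "card S > 0" using transversal_card[OF HC S] index_pos[OF HC] by simp
  have cT: "card T > 0" using transversal_card[OF fi T] index_pos[OF fi] by simp
  have TA: "T \<subseteq> A" using T by (simp add: transversal_def)
  have "(\<Sum>t\<in>T. mean C (\<lambda>y. f (t + y))) = (\<Sum>t\<in>T. (\<Sum>s\<in>S. f (t + s)) / of_nat (card S))"
    using TA inner by (intro sum.cong) auto
  also have "\<dots> = (\<Sum>s\<in>S. \<Sum>t\<in>T. f (t + s)) / of_nat (card S)"
    by (subst sum.swap) (simp add: sum_divide_distrib)
  \<comment> \<open>By translation invariance each \<open>s\<close> contributes the full average
    over \<open>A\<close>.\<close>
  also have "(\<Sum>s\<in>S. \<Sum>t\<in>T. f (t + s)) = (\<Sum>s\<in>S. of_nat (card T) * mean A f)"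
  proof (rule sum.cong[OF refl])
    fix s assume s: "s \<in> S"
    have "mean A (\<lambda>x. f (x + s)) = sum (\<lambda>x. f (x + s)) T / of_nat (card T)"
      using mean_transversal[OF periodic_mod_shift[OF H] T] s SA by blast
    then show "(\<Sum>t\<in>T. f (t + s)) = of_nat (card T) * mean A f"
      using mean_shift(2)[OF f, of s] s SA cT by (auto simp: field_simps)
  qed
  finally show "mean A (\<lambda>x. mean C (\<lambda>y. f (x + y))) = mean A f"
    using mean_transversal[OF perF T] cS cT by simp
qed

text \<open>Only one coset of \<open>C\<close> contributes, whence the index in the denominator.
  After a character sum has killed all points outside \<open>C\<close>, this returns to an average
  over \<open>C\<close>.\<close>

lemma mean_restrict:
  assumes f: "periodic_on A f" and C: "finite_index C A"
  shows "periodic_on A (\<lambda>x. if x \<in> C then f x else 0)"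
    "mean A (\<lambda>x. if x \<in> C then f x else 0) = mean C f / of_nat (index C A)"
proof -
  obtain H where H: "periodic_mod H A f" using f by (auto simp: periodic_on_def)
  then have fi: "finite_index H A" and A: "add_subgroup A"
    by (auto simp: periodic_mod_def finite_index_def)
  have sC: "add_subgroup C" "C \<subseteq> A" using C by (auto simp: finite_index_def)
  let ?K = "H \<inter> C"
  let ?g = "\<lambda>x. if x \<in> C then f x else 0"
  have KC: "finite_index ?K C" by (rule finite_index_Int[OF fi sC])
  have KA: "finite_index ?K A" by (rule finite_index_trans[OF KC C])
  have fK: "periodic_mod ?K A f" using periodic_mod_mono[OF H _ KA] by simp
  have fC: "periodic_mod ?K C f" using fK KC sC by (auto simp: periodic_mod_def)
  have gK: "periodic_mod ?K A ?g"
    using fK add_subgroup_add_iff[OF sC(1)] by (auto simp: periodic_mod_def)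
  then show "periodic_on A ?g" by (auto simp: periodic_on_def)
  obtain S T where S: "transversal C A S" and T: "transversal ?K C T"
    using finite_index_transversal[OF C] finite_index_transversal[OF KC] by metis
  have K: "add_subgroup ?K" "?K \<subseteq> C" using KC by (auto simp: finite_index_def)
  note * = transversal_tower[OF C K S T]
  have "sum ?g ((\<lambda>(s, t). s + t) ` (S \<times> T)) = (\<Sum>s\<in>S. \<Sum>t\<in>T. ?g (s + t))"
    using sum.reindex[OF *(1), of ?g] by (simp add: sum.cartesian_product case_prod_unfold)
  also have "\<dots> = (\<Sum>s\<in>S. if s \<in> C then sum f T else 0)"
  proof (rule sum.cong[OF refl])
    fix s assume s: "s \<in> S"
    have TC: "T \<subseteq> C" using T by (simp add: transversal_def)
    have "?g (s + t) = (if s \<in> C then f (s + t) else 0)" if "t \<in> T" for t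
      using add_subgroup_add_iff[OF sC(1), of t s] TC that by auto
    then have "(\<Sum>t\<in>T. ?g (s + t)) = (if s \<in> C then \<Sum>t\<in>T. f (s + t) else 0)" by simp
    moreover have "(\<Sum>t\<in>T. f (s + t)) = sum f T" if sC': "s \<in> C"
    proof -
      have "periodic_on C f" using fC by (auto simp: periodic_on_def)
      from mean_shift(2)[OF this sC'] have "mean C (\<lambda>t. f (t + s)) = mean C f" .
      moreover have "card T > 0" using transversal_card[OF KC T] index_pos[OF KC] by simp
      ultimately have "(\<Sum>t\<in>T. f (t + s)) = sum f T"
        using mean_transversal[OF fC T] mean_transversal[OF periodic_mod_shift[OF fC sC'] T] by simp
      then show ?thesis by (simp add: add.commute)
    qed
    ultimately show "(\<Sum>t\<in>T. ?g (s + t)) = (if s \<in> C then sum f T else 0)" by simp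
  qed
  also have "\<dots> = sum f T"
  proof -
    obtain s0 where s0: "s0 \<in> S" "0 - s0 \<in> C" "\<And>s. s \<in> S \<Longrightarrow> 0 - s \<in> C \<Longrightarrow> s = s0"
      using S add_subgroup_zero[OF A] unfolding transversal_def by blast
    have "s \<in> C \<longleftrightarrow> s = s0" if "s \<in> S" for s
      using s0 that add_subgroup_minus[OF sC(1)] by (metis diff_0 minus_minus)
    then have "(\<Sum>s\<in>S. if s \<in> C then sum f T else 0) = (\<Sum>s\<in>S. if s = s0 then sum f T else 0)"
      by (intro sum.cong) auto
    then show ?thesis using s0(1) S by (simp add: transversal_def)
  qed
  finally have "sum ?g ((\<lambda>(s, t). s + t) ` (S \<times> T)) = sum f T" .
  then show "mean A ?g = mean C f / of_nat (index C A)"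
    using mean_transversal[OF gK *(2)] mean_transversal[OF fC T] card_image[OF *(1)]
      transversal_card[OF C S] by (simp add: card_cartesian_product)
qed

lemma mean_character:
  assumes "periodic_on A g" and A: "add_subgroup A"
    and hom: "\<And>x y. x \<in> A \<Longrightarrow> y \<in> A \<Longrightarrow> g (x + y) = g x * g y"
  shows "mean A g = (if \<forall>x\<in>A. g x = 1 then 1 else 0)"
proof (cases "\<forall>x\<in>A. g x = 1")
  case True
  then have "mean A g = mean A (\<lambda>x. 1)" by (intro mean_cong[OF assms(1)]) auto
  then show ?thesis using True mean_const[OF A] by simp
next
  case False
  then obtain a where a: "a \<in> A" "g a \<noteq> 1" by blast
  have "mean A g = mean A (\<lambda>x. g (x + a))" using mean_shift(2)[OF assms(1) a(1)] by simp
  also have "\<dots> = mean A (\<lambda>x. g a * g x)"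
    using a hom by (intro mean_cong[OF mean_shift(1)[OF assms(1) a(1)]]) (auto simp: mult.commute)
  also have "\<dots> = g a * mean A g" by (rule mean_mult_left[OF assms(1)])
  finally show ?thesis using a(2) False by auto
qed

lemma
  assumes f: "periodic_mod H A f" and g: "periodic_mod K C g"
  shows periodic_mod_Times: "periodic_mod (H \<times> K) (A \<times> C) (\<lambda>(x, y). f x * g y)"
    and mean_Times: "mean (A \<times> C) (\<lambda>(x, y). f x * g y) = mean A f * mean C g"
proof -
  have fin: "finite_index H A" "finite_index K C" using f g by (simp_all add: periodic_mod_def)
  obtain S where S: "transversal H A S" using finite_index_transversal[OF fin(1)] .
  obtain T where T: "transversal K C T" using finite_index_transversal[OF fin(2)] .
  have sub: "add_subgroup H" "add_subgroup A" "H \<subseteq> A" "add_subgroup K" "add_subgroup C" "K \<subseteq> C"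
    using fin by (simp_all add: finite_index_def)
  have tr: "transversal (H \<times> K) (A \<times> C) (S \<times> T)"
    unfolding transversal_def
  proof (intro conjI ballI)
    fix z assume "z \<in> A \<times> C"
    then obtain x y where z: "z = (x, y)" "x \<in> A" "y \<in> C" by blast
    obtain s where s: "s \<in> S" "x - s \<in> H" "\<And>s'. s' \<in> S \<Longrightarrow> x - s' \<in> H \<Longrightarrow> s' = s"
      using S z(2) unfolding transversal_def by blast
    obtain t where t: "t \<in> T" "y - t \<in> K" "\<And>t'. t' \<in> T \<Longrightarrow> y - t' \<in> K \<Longrightarrow> t' = t"
      using T z(3) unfolding transversal_def by blast
    show "\<exists>!u. u \<in> S \<times> T \<and> z - u \<in> H \<times> K"
    proof (intro ex1I conjI)
      show "(s, t) \<in> S \<times> T" "z - (s, t) \<in> H \<times> K" using s(1,2) t(1,2) z(1) by simp_all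
      fix u assume u: "u \<in> S \<times> T \<and> z - u \<in> H \<times> K"
      obtain s' t' where "u = (s', t')" by (cases u)
      then show "u = (s, t)" using s(3)[of s'] t(3)[of t'] u z(1) by simp
    qed
  next
    show "finite (S \<times> T)" "S \<times> T \<subseteq> A \<times> C" using S T unfolding transversal_def by blast+
  qed
  have "finite_index (H \<times> K) (A \<times> C)"
    using sub by (intro finite_index_transversalI[OF _ _ _ tr] add_subgroup_Times Sigma_mono) auto
  moreover have "f (x + h) * g (y + k) = f x * g y"
    if "x \<in> A" "h \<in> H" "y \<in> C" "k \<in> K" for x h y k
    using f g that by (simp add: periodic_mod_def)
  ultimately show per: "periodic_mod (H \<times> K) (A \<times> C) (\<lambda>(x, y). f x * g y)"
    by (auto simp: periodic_mod_def)
  have "sum (\<lambda>(x, y). f x * g y) (S \<times> T) = sum f S * sum g T"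
    unfolding sum_product sum.cartesian_product ..
  then show "mean (A \<times> C) (\<lambda>(x, y). f x * g y) = mean A f * mean C g"
    using mean_transversal[OF per tr] mean_transversal[OF f S] mean_transversal[OF g T]
    by (simp add: card_cartesian_product)
qed

text \<open>A sufficient condition for finite index: the big group is generated by a finite set, every
  element of which has a multiple in the small one.\<close>

lemma finite_index_generated:
  fixes m :: "'i \<Rightarrow> int \<Rightarrow> 'a::ab_group_add"
  assumes "finite S" and H: "add_subgroup H" "add_subgroup A" "H \<subseteq> A"
    and gen: "\<And>x. x \<in> A \<Longrightarrow> \<exists>k. x = (\<Sum>i\<in>S. m i (k i))"
    and add: "\<And>i j k. m i (j + k) = m i j + m i k"
    and tors: "\<And>i. i \<in> S \<Longrightarrow> \<exists>q>0. \<forall>j. m i (q * j) \<in> H"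
  shows "finite_index H A"
proof -
  have "\<forall>i\<in>S. \<exists>q. q > 0 \<and> (\<forall>j. m i (q * j) \<in> H)" using tors by simp
  then obtain q where "\<forall>i\<in>S. q i > 0 \<and> (\<forall>j. m i (q i * j) \<in> H)" using bchoice by meson
  then have q: "\<And>i. i \<in> S \<Longrightarrow> q i > 0 \<and> (\<forall>j. m i (q i * j) \<in> H)" by blast
  have "lcoset H ` A \<subseteq> (\<lambda>k. lcoset H (\<Sum>i\<in>S. m i (k i))) ` (\<Pi>\<^sub>E i\<in>S. {0..<q i})"
  proof clarify
    fix x assume "x \<in> A"
    then obtain k where k: "x = (\<Sum>i\<in>S. m i (k i))" using gen by blast
    let ?k = "\<lambda>i\<in>S. k i mod q i"
    have "?k \<in> (\<Pi>\<^sub>E i\<in>S. {0..<q i})" using q by auto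
    moreover have "m i (k i) - m i (?k i) \<in> H" if "i \<in> S" for i
    proof -
      have "m i (k i) = m i (q i * (k i div q i)) + m i (k i mod q i)"
        using add[of i "q i * (k i div q i)" "k i mod q i"] by simp
      then show ?thesis using q that by simp
    qed
    then have "(\<Sum>i\<in>S. m i (k i)) - (\<Sum>i\<in>S. m i (?k i)) \<in> H"
      unfolding sum_subtractf[symmetric] by (rule add_subgroup_sum[OF H(1)])
    then have "lcoset H x = lcoset H (\<Sum>i\<in>S. m i (?k i))" using k lcoset_eq_iff[OF H(1)] by simp
    ultimately show "lcoset H x \<in> (\<lambda>k. lcoset H (\<Sum>i\<in>S. m i (k i))) ` (\<Pi>\<^sub>E i\<in>S. {0..<q i})"
      by blast
  qed
  moreover have "finite (\<Pi>\<^sub>E i\<in>S. {0..<q i})" using assms(1) by (intro finite_PiE) auto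
  ultimately have "finite (lcoset H ` A)" using finite_subset by blast
  then show ?thesis using H by (simp add: finite_index_def)
qed

text \<open>The periods \<open>H\<close> and \<open>K\<close> are uniform in the other variable, so
  both iterated averages are one finite double sum over \<open>S\<close> and
  \<open>T\<close>.\<close>

lemma mean_swap:
  assumes a: "a \<in> A" and c: "c \<in> C"
    and f: "\<And>y. y \<in> C \<Longrightarrow> periodic_mod H A (\<lambda>x. f x y)" "\<And>x. x \<in> A \<Longrightarrow> periodic_mod K C (f x)"
  shows "mean A (\<lambda>x. mean C (f x)) = mean C (\<lambda>y. mean A (\<lambda>x. f x y))"
    and "periodic_mod H A (\<lambda>x. mean C (f x))"
    and "periodic_mod K C (\<lambda>y. mean A (\<lambda>x. f x y))"
proof -
  have fin: "finite_index H A" "finite_index K C" using f(1)[OF c] f(2)[OF a] by (simp_all add: periodic_mod_def)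
  obtain S where S: "transversal H A S" using finite_index_transversal[OF fin(1)] .
  obtain T where T: "transversal K C T" using finite_index_transversal[OF fin(2)] .
  have SA: "S \<subseteq> A" and TC: "T \<subseteq> C" using S T by (simp_all add: transversal_def)
  have inner: "mean C (f x) = sum (f x) T / of_nat (card T)" if "x \<in> A" for x
    using mean_transversal[OF f(2)[OF that] T] .
  have inner': "mean A (\<lambda>x. f x y) = (\<Sum>x\<in>S. f x y) / of_nat (card S)" if "y \<in> C" for y
    using mean_transversal[OF f(1)[OF that] S] .
  have add: "x + h \<in> A" if "x \<in> A" "h \<in> H" for x h
    using that fin(1) by (auto simp: finite_index_def intro: add_subgroup_add)
  have add': "x + h \<in> C" if "x \<in> C" "h \<in> K" for x h
    using that fin(2) by (auto simp: finite_index_def intro: add_subgroup_add)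
  have per: "f (x + h) y = f x y" if "x \<in> A" "h \<in> H" "y \<in> C" for x h y
    using f(1)[OF that(3)] that by (simp add: periodic_mod_def)
  have per': "f x (y + k) = f x y" if "x \<in> A" "k \<in> K" "y \<in> C" for x k y
    using f(2)[OF that(1)] that by (simp add: periodic_mod_def)
  show p1: "periodic_mod H A (\<lambda>x. mean C (f x))"
    unfolding periodic_mod_def
  proof (intro conjI ballI fin)
    fix x h assume xh: "x \<in> A" "h \<in> H"
    have "sum (f (x + h)) T = sum (f x) T" by (intro sum.cong refl) (use per xh TC in blast)
    then show "mean C (f (x + h)) = mean C (f x)" using inner add xh by simp
  qed
  show p2: "periodic_mod K C (\<lambda>y. mean A (\<lambda>x. f x y))"
    unfolding periodic_mod_def
  proof (intro conjI ballI fin)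
    fix y k assume yk: "y \<in> C" "k \<in> K"
    have "(\<Sum>x\<in>S. f x (y + k)) = (\<Sum>x\<in>S. f x y)" by (intro sum.cong refl) (use per' yk SA in blast)
    then show "mean A (\<lambda>x. f x (y + k)) = mean A (\<lambda>x. f x y)" using inner' add' yk by simp
  qed
  have "mean A (\<lambda>x. mean C (f x)) = (\<Sum>x\<in>S. sum (f x) T / of_nat (card T)) / of_nat (card S)"
    unfolding mean_transversal[OF p1 S] by (intro arg_cong2[of _ _ _ _ "(/)"] sum.cong refl inner) (use SA in blast)
  moreover have "mean C (\<lambda>y. mean A (\<lambda>x. f x y)) = (\<Sum>y\<in>T. (\<Sum>x\<in>S. f x y) / of_nat (card S)) / of_nat (card T)"
    unfolding mean_transversal[OF p2 T] by (intro arg_cong2[of _ _ _ _ "(/)"] sum.cong refl inner') (use TC in blast)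
  moreover have "(\<Sum>x\<in>S. sum (f x) T) = (\<Sum>y\<in>T. \<Sum>x\<in>S. f x y)" by (rule sum.swap)
  ultimately show "mean A (\<lambda>x. mean C (f x)) = mean C (\<lambda>y. mean A (\<lambda>x. f x y))"
    by (simp add: sum_divide_distrib[symmetric])
qed

section \<open>Roots of unity\<close>

definition er :: "rat \<Rightarrow> complex"
  where "er q = ee (of_rat q)"

lemma of_rat_complex: "(of_rat q :: complex) = of_real (of_rat q)"
  by (cases q) (simp add: of_rat_rat)

lemma er_cis: "er q = cis (2 * pi * of_rat q)"
  by (simp add: er_def ee_def cis_conv_exp of_rat_complex mult_ac)

lemma er_add: "er (p + q) = er p * er q"
  by (simp add: er_cis cis_mult of_rat_add algebra_simps)

lemma er_0 [simp]: "er 0 = 1"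
  by (simp add: er_cis)

lemma er_nonzero [simp]: "er q \<noteq> 0"
  by (simp add: er_cis)

lemma norm_er [simp]: "cmod (er q) = 1"
  by (simp add: er_cis)

lemma er_minus_mult: "er (- q) * er q = 1"
  using er_add[of "- q" q] by simp

lemma er_cnj: "cnj (er q) = er (- q)"
  by (simp add: er_cis cis_cnj of_rat_minus)

lemma er_diff: "er (p - q) = er p * er (- q)"
  using er_add[of p "- q"] by simp

lemma er_eq_1_iff: "er q = 1 \<longleftrightarrow> q \<in> \<int>"
proof
  assume "er q = 1"
  then have "cos (2 * pi * of_rat q) = 1" by (simp add: er_cis complex_eq_iff)
  then obtain k :: int where "2 * pi * of_rat q = of_int k * 2 * pi"
    by (auto simp: cos_one_2pi_int)
  then have "(of_rat q :: real) = of_rat (of_int k)" by simp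
  then show "q \<in> \<int>" unfolding of_rat_eq_iff by simp
next
  assume "q \<in> \<int>"
  then obtain k where "q = of_int k" by (auto elim: Ints_cases)
  then show "er q = 1" by (simp add: er_cis cis_multiple_2pi)
qed

lemma er_int [simp]: "q \<in> \<int> \<Longrightarrow> er q = 1"
  by (simp add: er_eq_1_iff)

lemma er_cong: "p - q \<in> \<int> \<Longrightarrow> er p = er q"
  using er_add[of "p - q" q] by simp

lemma er_power: "er q ^ k = er (of_nat k * q)"
  by (induction k) (simp_all add: er_add algebra_simps)

lemma er_sum: "finite I \<Longrightarrow> er (sum f I) = (\<Prod>i\<in>I. er (f i))"
  by (induction I rule: finite_induct) (simp_all add: er_add)

lemma er_half: "er (1 / 2) = -1"
  by (simp add: er_cis of_rat_divide)

lemma er_quarter: "er (1 / 4) = \<i>"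
  by (simp add: er_cis of_rat_divide)

text \<open>The additive group generated by the \<open>M\<close>-th roots of unity; it is a ring, playing the role of
  the ring of integers of a cyclotomic field.\<close>

inductive_set cyc :: "nat \<Rightarrow> complex set" for M :: nat where
  cyc_root: "er (of_int j / of_nat M) \<in> cyc M"
| cyc_diff: "x \<in> cyc M \<Longrightarrow> y \<in> cyc M \<Longrightarrow> x - y \<in> cyc M"

lemma cyc_0: "0 \<in> cyc M"
  using cyc_diff[OF cyc_root[of 0] cyc_root[of 0]] by simp

lemma cyc_minus: "x \<in> cyc M \<Longrightarrow> - x \<in> cyc M"
  using cyc_diff[OF cyc_0] by fastforce

lemma cyc_add: "x \<in> cyc M \<Longrightarrow> y \<in> cyc M \<Longrightarrow> x + y \<in> cyc M"
  using cyc_diff[OF _ cyc_minus, of x M y] by simp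

lemma cyc_1: "1 \<in> cyc M"
  using cyc_root[of 0 M] by simp

lemma cyc_mult_root: "x \<in> cyc M \<Longrightarrow> er (of_int j / of_nat M) * x \<in> cyc M"
proof (induction rule: cyc.induct)
  case (cyc_root i)
  have "er (of_int j / of_nat M) * er (of_int i / of_nat M) = er (of_int (j + i) / of_nat M)"
    by (simp add: er_add[symmetric] add_divide_distrib)
  then show ?case using cyc.cyc_root[of "j + i" M] by simp
next
  case (cyc_diff x y)
  then show ?case using cyc.cyc_diff by (simp add: right_diff_distrib)
qed

lemma cyc_mult: "x \<in> cyc M \<Longrightarrow> y \<in> cyc M \<Longrightarrow> x * y \<in> cyc M"
proof (induction rule: cyc.induct)
  case (cyc_root j)
  then show ?case by (rule cyc_mult_root)
next
  case (cyc_diff x z)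
  then show ?case using cyc.cyc_diff by (simp add: left_diff_distrib)
qed

lemma cyc_power: "x \<in> cyc M \<Longrightarrow> x ^ k \<in> cyc M"
  by (induction k) (simp_all add: cyc_1 cyc_mult)

lemma cyc_sum: "(\<And>i. i \<in> I \<Longrightarrow> f i \<in> cyc M) \<Longrightarrow> sum f I \<in> cyc M"
  by (induction I rule: infinite_finite_induct) (simp_all add: cyc_0 cyc_add)

lemma cyc_of_nat: "of_nat k \<in> cyc M"
  by (induction k) (simp_all add: cyc_0 cyc_1 cyc_add)

lemma cyc_of_int: "of_int k \<in> cyc M"
  by (cases k) (simp_all add: cyc_of_nat cyc_minus cyc_diff cyc_1 cyc_add del: of_nat_Suc)

lemma cyc_er:
  assumes "M > 0" "of_nat M * q \<in> \<int>"
  shows "er q \<in> cyc M"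
proof -
  obtain j where "of_nat M * q = of_int j" using assms(2) by (auto elim: Ints_cases)
  then have "q = of_int j / of_nat M" using assms(1) by (simp add: field_simps)
  then show ?thesis using cyc_root by simp
qed

lemma rat_bounded_denominators_int:
  fixes r :: rat
  assumes d: "d > 0" and *: "\<And>k. of_int d * r ^ k \<in> \<int>"
  shows "r \<in> \<int>"
proof -
  obtain a b where ab: "r = Fract a b" "b > 0" "coprime a b" by (cases r)
  then have r: "r = of_int a / of_int b" by (simp add: Fract_of_int_quotient)
  \<comment> \<open>The exponent \<open>d\<close> is large enough: a denominator
    \<open>b \<ge> 2\<close> would give \<open>2 ^ d \<le> b ^ d \<le> d\<close>.\<close>
  let ?k = "nat d"
  obtain z where "of_int d * r ^ ?k = of_int z" using * by (auto elim: Ints_cases)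
  then have "of_int (d * a ^ ?k) = (of_int (z * b ^ ?k) :: rat)"
    using ab(2) by (simp add: r field_simps power_divide)
  then have "d * a ^ ?k = z * b ^ ?k" by (simp only: of_int_eq_iff)
  then have "b ^ ?k dvd d * a ^ ?k" by simp
  moreover have "coprime (b ^ ?k) (a ^ ?k)" using ab(3) by (simp add: coprime_commute)
  ultimately have "b ^ ?k dvd d" by (simp add: coprime_dvd_mult_left_iff)
  then have le: "b ^ ?k \<le> d" using d by (simp add: zdvd_imp_le)
  have "b = 1"
  proof (rule ccontr)
    assume "b \<noteq> 1"
    then have "2 \<le> b" using ab(2) by simp
    then have "2 ^ ?k \<le> b ^ ?k" by (intro power_mono) auto
    moreover have "int ?k < 2 ^ ?k" using of_nat_less_two_power by blast
    ultimately show False using le d by simp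
  qed
  then show ?thesis by (simp add: r)
qed

text \<open>A rational-linear functional \<open>\<tau>\<close> on the complex numbers with
  \<open>\<tau> 1 = 1\<close> takes only finitely many values on the \<open>M\<close>-th roots of
  unity, so one common denominator \<open>d\<close> serves for all of \<open>cyc M\<close>. Since
  every power of \<open>r\<close> lies in \<open>cyc M\<close>, all \<open>d * r ^ k\<close> are
  integers, which forces \<open>r\<close> to be one.\<close>

lemma cyc_rational:
  assumes M: "M > 0" and r: "of_rat r \<in> cyc M"
  shows "r \<in> \<int>"
proof -
  interpret Q: vector_space "\<lambda>(q::rat) (z::complex). of_rat q * z"
    by standard (simp_all add: of_rat_add of_rat_mult algebra_simps)
  let ?B = "Q.extend_basis {1}"
  have "Q.independent {1}" by (simp add: Q.independent_insert)
  then have B: "Q.independent ?B" "Q.span ?B = UNIV" "{1} \<subseteq> ?B"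
    using Q.independent_extend_basis Q.span_extend_basis Q.extend_basis_superset by blast+
  define \<tau> where "\<tau> z = Q.representation ?B z 1" for z
  have \<tau>_diff: "\<tau> (x - y) = \<tau> x - \<tau> y" for x y
    using B by (simp add: \<tau>_def Q.representation_diff)
  have \<tau>_rat: "\<tau> (of_rat q) = q" for q
    using B Q.representation_scale[of ?B 1 q] Q.representation_basis[of ?B 1]
    by (simp add: \<tau>_def)
  define den where "den j = snd (quotient_of (\<tau> (er (of_int j / of_nat M))))" for j
  define d where "d = (\<Prod>j\<in>{0..<int M}. den j)"
  have den: "den j > 0" "of_int (den j) * \<tau> (er (of_int j / of_nat M)) \<in> \<int>" for j
  proof -
    obtain a b where ab: "quotient_of (\<tau> (er (of_int j / of_nat M))) = (a, b)" by fastforce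
    then have "b > 0" "\<tau> (er (of_int j / of_nat M)) = of_int a / of_int b"
      using quotient_of_denom_pos quotient_of_div by blast+
    then show "den j > 0" "of_int (den j) * \<tau> (er (of_int j / of_nat M)) \<in> \<int>"
      using ab by (simp_all add: den_def)
  qed
  have d: "d > 0" unfolding d_def using den by (intro prod_pos) auto
  have dj: "of_int d * \<tau> (er (of_int j / of_nat M)) \<in> \<int>" for j
  proof -
    let ?j = "j mod int M"
    have "of_int j / of_nat M - of_int ?j / of_nat M = (of_int (j div int M) :: rat)"
    proof -
      have "(of_int j :: rat) = of_int (j div int M * int M + ?j)" by simp
      also have "\<dots> = of_int (j div int M) * of_nat M + of_int ?j"
        by (simp only: of_int_add of_int_mult of_int_of_nat_eq)
      finally show ?thesis using M by (simp add: field_simps)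
    qed
    then have e: "er (of_int j / of_nat M) = er (of_int ?j / of_nat M)" by (intro er_cong) simp
    have "?j \<in> {0..<int M}" using M by simp
    then have "den ?j dvd d" unfolding d_def by (intro dvd_prodI) auto
    then obtain c where "d = c * den ?j" by (metis dvd_def mult.commute)
    then show ?thesis using den(2)[of ?j] e by (simp add: mult.assoc)
  qed
  have "of_int d * \<tau> z \<in> \<int>" if "z \<in> cyc M" for z
    using that
  proof (induction rule: cyc.induct)
    case (cyc_root j)
    then show ?case by (rule dj)
  next
    case (cyc_diff x y)
    then show ?case by (simp add: \<tau>_diff right_diff_distrib)
  qed
  from this[OF cyc_power[OF r]] have "of_int d * r ^ k \<in> \<int>" for k
    by (simp add: of_rat_power[symmetric] \<tau>_rat del: of_rat_power)
  then show ?thesis using rat_bounded_denominators_int[OF d] by blast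
qed

text \<open>The Frobenius congruence: the inner binomial coefficients are divisible by
  \<open>p\<close>.\<close>

lemma cyc_add_power_prime:
  assumes p: "prime p" and x: "x \<in> cyc M" and y: "y \<in> cyc M"
  shows "\<exists>z\<in>cyc M. (x + y) ^ p = x ^ p + y ^ p + of_nat p * z"
proof -
  have p0: "p > 0" using p prime_gt_0_nat by blast
  have "(x + y) ^ p = (\<Sum>k\<le>p. of_nat (p choose k) * x ^ k * y ^ (p - k))"
    by (rule binomial_ring)
  also have "\<dots> = (\<Sum>k\<in>{0, p}. of_nat (p choose k) * x ^ k * y ^ (p - k))
      + (\<Sum>k\<in>{..p} - {0, p}. of_nat (p choose k) * x ^ k * y ^ (p - k))"
    by (subst sum.subset_diff[of "{0, p}"]) (auto simp: add.commute)
  also have "(\<Sum>k\<in>{0, p}. of_nat (p choose k) * x ^ k * y ^ (p - k)) = x ^ p + y ^ p"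
    using p0 by simp
  also have "(\<Sum>k\<in>{..p} - {0, p}. of_nat (p choose k) * x ^ k * y ^ (p - k))
      = of_nat p * (\<Sum>k\<in>{..p} - {0, p}. of_nat ((p choose k) div p) * x ^ k * y ^ (p - k))"
    unfolding sum_distrib_left
  proof (rule sum.cong[OF refl])
    fix k assume "k \<in> {..p} - {0, p}"
    then have "p dvd (p choose k)" using p by (intro dvd_choose_prime) auto
    then have "of_nat (p choose k) = (of_nat p * of_nat ((p choose k) div p) :: complex)"
      unfolding of_nat_mult[symmetric] by simp
    then show "of_nat (p choose k) * x ^ k * y ^ (p - k)
        = of_nat p * (of_nat ((p choose k) div p) * x ^ k * y ^ (p - k))" by (simp add: mult.assoc)
  qed
  finally have "(x + y) ^ p = x ^ p + y ^ p + of_nat p * (\<Sum>k\<in>{..p} - {0, p}. of_nat ((p choose k) div p) * x ^ k * y ^ (p - k))" .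
  moreover have "(\<Sum>k\<in>{..p} - {0, p}. of_nat ((p choose k) div p) * x ^ k * y ^ (p - k)) \<in> cyc M"
    using x y by (intro cyc_sum cyc_mult cyc_of_nat cyc_power)
  ultimately show ?thesis by blast
qed

lemma cyc_sum_power_prime:
  assumes p: "prime p" and "finite I" "\<And>i. i \<in> I \<Longrightarrow> f i \<in> cyc M"
  shows "\<exists>z\<in>cyc M. (\<Sum>i\<in>I. f i) ^ p = (\<Sum>i\<in>I. f i ^ p) + of_nat p * z"
  using assms(2,3)
proof (induction I rule: finite_induct)
  case empty
  have "p > 0" using p prime_gt_0_nat by blast
  then show ?case by (intro bexI[of _ 0]) (simp_all add: cyc_0)
next
  case (insert i I)
  obtain z where z: "z \<in> cyc M" "(\<Sum>i\<in>I. f i) ^ p = (\<Sum>i\<in>I. f i ^ p) + of_nat p * z"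
    using insert by auto
  obtain u where u: "u \<in> cyc M"
    "(f i + (\<Sum>i\<in>I. f i)) ^ p = f i ^ p + (\<Sum>i\<in>I. f i) ^ p + of_nat p * u"
    using cyc_add_power_prime[OF p, of "f i" M "\<Sum>i\<in>I. f i"] insert.prems cyc_sum[of I f M] by auto
  have "(\<Sum>i\<in>insert i I. f i) ^ p = (\<Sum>i\<in>insert i I. f i ^ p) + of_nat p * (z + u)"
    using insert.hyps u(2) z(2) by (simp add: algebra_simps)
  then show ?case using cyc_add[OF z(1) u(1)] by blast
qed

section \<open>The quadratic Gauss sum\<close>

text \<open>The Gaussian binomial coefficient. Pascal's recursion keeps it meaningful at roots of
  unity, where the quotient formula has vanishing denominators.\<close>

fun qbinomial :: "'a::comm_ring_1 \<Rightarrow> nat \<Rightarrow> nat \<Rightarrow> 'a" where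
  "qbinomial z n 0 = 1"
| "qbinomial z 0 (Suc k) = 0"
| "qbinomial z (Suc n) (Suc k) = z ^ Suc k * qbinomial z n (Suc k) + qbinomial z n k"

lemma qbinomial_eq_0: "n < k \<Longrightarrow> qbinomial z n k = 0"
  by (induction z n k rule: qbinomial.induct) auto

lemma qbinomial_n_n: "qbinomial z n n = 1"
  by (induction n) (simp_all add: qbinomial_eq_0)

text \<open>A division-free substitute for the quotient formula; the second Pascal rule
  \<open>qbinomial_Suc_Suc'\<close> is this identity rearranged.\<close>

lemma qbinomial_ratio:
  "k \<le> n \<Longrightarrow> (1 - z ^ Suc k) * qbinomial z n (Suc k) = (1 - z ^ (n - k)) * qbinomial z n k"
proof (induction n arbitrary: k)
  case 0
  then show ?case by simp
next
  case (Suc n)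
  \<comment> \<open>The absorption identity between rows \<open>n\<close> and
    \<open>n + 1\<close>.\<close>
  have A: "(1 - z ^ Suc k) * qbinomial z (Suc n) (Suc k) = (1 - z ^ Suc n) * qbinomial z n k"
  proof (cases "k \<le> n")
    case True
    have "z ^ Suc k * z ^ (n - k) = z ^ Suc n" by (simp only: power_add[symmetric]) (use True in simp)
    moreover have "(1 - z ^ Suc k) * qbinomial z (Suc n) (Suc k)
        = z ^ Suc k * ((1 - z ^ Suc k) * qbinomial z n (Suc k)) + (1 - z ^ Suc k) * qbinomial z n k"
      by (simp add: algebra_simps)
    moreover have "x * ((1 - y) * r) + (1 - x) * r = (1 - x * y) * r" for x y r :: 'a
      by (simp add: algebra_simps)
    ultimately show ?thesis unfolding Suc.IH[OF True] by metis
  next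
    case False
    then show ?thesis by (simp add: qbinomial_eq_0)
  qed
  show ?case
  proof (cases k)
    case 0
    then show ?thesis using A by simp
  next
    case (Suc j)
    then have j: "j \<le> n" using Suc.prems by simp
    have e: "z ^ (n - j) * z ^ Suc j = z ^ Suc n" by (simp only: power_add[symmetric]) (use j in simp)
    have "(1 - z ^ (n - j)) * qbinomial z (Suc n) (Suc j)
        = z ^ Suc j * (1 - z ^ (n - j)) * qbinomial z n (Suc j) + (1 - z ^ (n - j)) * qbinomial z n j"
      by (simp add: algebra_simps)
    also have "\<dots> = (1 - z ^ (n - j) * z ^ Suc j) * qbinomial z n (Suc j)"
      unfolding Suc.IH[OF j, symmetric] by (simp add: algebra_simps)
    finally have "(1 - z ^ (n - j)) * qbinomial z (Suc n) (Suc j) = (1 - z ^ Suc n) * qbinomial z n (Suc j)"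
      unfolding e .
    then show ?thesis using A Suc by simp
  qed
qed

lemma qbinomial_Suc_Suc':
  assumes "k \<le> n"
  shows "qbinomial z (Suc n) (Suc k) = qbinomial z n (Suc k) + z ^ (n - k) * qbinomial z n k"
  using qbinomial_ratio[OF assms, of z] by (simp add: algebra_simps)

lemma qbinomial_symmetric: "k \<le> n \<Longrightarrow> qbinomial z n (n - k) = qbinomial z n k"
proof (induction n arbitrary: k)
  case 0
  then show ?case by simp
next
  case (Suc n)
  show ?case
  proof (cases k)
    case 0
    then show ?thesis by (simp only: diff_zero qbinomial_n_n qbinomial.simps)
  next
    case (Suc i)
    show ?thesis
    proof (cases "i = n")
      case True
      then show ?thesis using Suc by (simp only: diff_self_eq_0 qbinomial_n_n qbinomial.simps)
    next
      case False
      then have i: "i < n" using Suc Suc.prems by simp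
      define j where "j = n - Suc i"
      have j: "n - i = Suc j" "j \<le> n" "n - j = Suc i" "Suc n - Suc i = Suc j"
        using i by (simp_all add: j_def)
      have "qbinomial z (Suc n) (Suc j) = qbinomial z n (n - i) + z ^ Suc i * qbinomial z n (n - Suc i)"
        using qbinomial_Suc_Suc'[OF j(2), of z] j by (simp add: j_def)
      also have "\<dots> = qbinomial z n i + z ^ Suc i * qbinomial z n (Suc i)"
        using Suc.IH[of i] Suc.IH[of "Suc i"] i by simp
      finally show ?thesis using Suc j by (simp add: add.commute)
    qed
  qed
qed

text \<open>Gauss's identity for the sign of his sum. The second Pascal rule splits the sum for
  \<open>n + 1\<close> into the sum for \<open>n\<close> and a part which the symmetry
  \<open>k \<mapsto> n - k\<close> turns into \<open>q ^ (n + 1)\<close> times the sum for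
  \<open>n\<close>.\<close>

lemma gauss_qbinomial_sum:
  fixes q :: "'a::comm_ring_1"
  shows "(\<Sum>k\<le>n. q ^ k * qbinomial (q ^ 2) n k) = (\<Prod>j=1..n. 1 + q ^ j)"
proof (induction n)
  case 0
  then show ?case by simp
next
  case (Suc n)
  let ?b = "qbinomial (q ^ 2)"
  have "(\<Sum>k\<le>Suc n. q ^ k * ?b (Suc n) k) = 1 + (\<Sum>k\<le>n. q ^ Suc k * ?b (Suc n) (Suc k))"
    by (subst sum.atMost_Suc_shift) simp
  also have "(\<Sum>k\<le>n. q ^ Suc k * ?b (Suc n) (Suc k))
      = (\<Sum>k\<le>n. q ^ Suc k * ?b n (Suc k)) + (\<Sum>k\<le>n. q ^ Suc k * (q ^ 2) ^ (n - k) * ?b n k)"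
    unfolding sum.distrib[symmetric]
    by (intro sum.cong refl) (subst qbinomial_Suc_Suc', auto simp: algebra_simps)
  also have "(\<Sum>k\<le>n. q ^ Suc k * (q ^ 2) ^ (n - k) * ?b n k)
      = (\<Sum>k\<le>n. q ^ Suc (n - k) * (q ^ 2) ^ k * ?b n k)"
    by (subst sum.nat_diff_reindex[symmetric, of _ "Suc n", simplified lessThan_Suc_atMost])
      (auto intro!: sum.cong simp: qbinomial_symmetric)
  also have "\<dots> = q ^ Suc n * (\<Sum>k\<le>n. q ^ k * ?b n k)"
    unfolding sum_distrib_left
  proof (intro sum.cong refl)
    fix k assume "k \<in> {..n}"
    then have "Suc (n - k) + 2 * k = Suc n + k" by simp
    then have "q ^ Suc (n - k) * (q ^ 2) ^ k = q ^ Suc n * q ^ k"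
      by (simp only: power_mult[symmetric] power_add[symmetric])
    then show "q ^ Suc (n - k) * (q ^ 2) ^ k * ?b n k = q ^ Suc n * (q ^ k * ?b n k)"
      by (simp only: mult.assoc[symmetric])
  qed
  also have "1 + ((\<Sum>k\<le>n. q ^ Suc k * ?b n (Suc k)) + q ^ Suc n * (\<Sum>k\<le>n. q ^ k * ?b n k))
      = (\<Sum>k\<le>Suc n. q ^ k * ?b n k) + q ^ Suc n * (\<Sum>k\<le>n. q ^ k * ?b n k)"
    by (subst sum.atMost_Suc_shift[of "\<lambda>k. q ^ k * ?b n k"]) (simp only: qbinomial.simps power_0 mult_1 add.assoc)
  also have "(\<Sum>k\<le>Suc n. q ^ k * ?b n k) = (\<Sum>k\<le>n. q ^ k * ?b n k)"
    by (simp add: qbinomial_eq_0)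
  also have "(\<Sum>k\<le>n. q ^ k * ?b n k) + q ^ Suc n * (\<Sum>k\<le>n. q ^ k * ?b n k)
      = (1 + q ^ Suc n) * (\<Sum>k\<le>n. q ^ k * ?b n k)"
    by (simp add: algebra_simps)
  also have "\<dots> = (\<Prod>j=1..Suc n. 1 + q ^ j)" unfolding Suc.IH by (simp add: mult.commute)
  finally show ?case .
qed

text \<open>At a primitive \<open>M\<close>-th root of unity \<open>z\<close> consecutive
  coefficients of row \<open>M - 1\<close> have ratio \<open>- z ^ - (k + 1)\<close>, so the
  coefficients are signed powers of \<open>z\<close> with triangular exponents. The square root
  \<open>q\<close> of \<open>z\<close> avoids halving \<open>k (k + 1)\<close>.\<close>

lemma qbinomial_root_of_unity:
  fixes z :: "'a::idom"
  assumes "z ^ M = 1" "\<And>j. 0 < j \<Longrightarrow> j < M \<Longrightarrow> z ^ j \<noteq> 1" "q ^ 2 = z" "k < M"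
  shows "q ^ (k * Suc k) * qbinomial z (M - 1) k = (-1) ^ k"
  using assms(4)
proof (induction k)
  case 0
  then show ?case by simp
next
  case (Suc k)
  have k: "k \<le> M - 1" "M - 1 - k + Suc k = M" using Suc.prems by simp_all
  have "(1 - z ^ Suc k) * (z ^ Suc k * qbinomial z (M - 1) (Suc k))
      = z ^ Suc k * ((1 - z ^ Suc k) * qbinomial z (M - 1) (Suc k))"
    by (simp only: mult.left_commute)
  also have "\<dots> = z ^ Suc k * (1 - z ^ (M - 1 - k)) * qbinomial z (M - 1) k"
    unfolding qbinomial_ratio[OF k(1), of z] by (simp only: mult.assoc)
  also have "z ^ Suc k * (1 - z ^ (M - 1 - k)) = z ^ Suc k - z ^ (M - 1 - k + Suc k)"
    by (simp only: right_diff_distrib power_add[symmetric] add.commute mult_1_right)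
  also have "\<dots> * qbinomial z (M - 1) k = (1 - z ^ Suc k) * (- qbinomial z (M - 1) k)"
    unfolding k(2) assms(1) by (simp add: algebra_simps)
  finally have e: "z ^ Suc k * qbinomial z (M - 1) (Suc k) = - qbinomial z (M - 1) k"
    using assms(2)[of "Suc k"] Suc.prems by (metis mult_left_cancel right_minus_eq zero_less_Suc)
  have "Suc k * Suc (Suc k) = k * Suc k + 2 * Suc k" by simp
  then have "q ^ (Suc k * Suc (Suc k)) = q ^ (k * Suc k) * z ^ Suc k"
    by (simp only: power_add power_mult assms(3))
  then have "q ^ (Suc k * Suc (Suc k)) * qbinomial z (M - 1) (Suc k)
      = - (q ^ (k * Suc k) * qbinomial z (M - 1) k)"
    using e by (simp only: mult.assoc) simp
  then show ?case using Suc by simp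
qed

lemma gauss_sum_product:
  assumes M: "M > 0"
  shows "(\<Sum>k<M. er (of_nat k ^ 2 / of_nat (2 * M)))
    = (\<Prod>j=1..M - 1. 1 + (-1) ^ j * er (- (of_nat j / of_nat (2 * M))))"
proof -
  \<comment> \<open>The sign is chosen so that \<open>q ^ (k * k)\<close> carries the factor
    \<open>(-1) ^ k\<close> of \<open>qbinomial_root_of_unity\<close>; what remains in the
    \<open>k\<close>-th term is exactly the term of the quadratic Gauss sum.\<close>
  define q where "q = - er (- (1 / of_nat (2 * M)))"
  define z where "z = er (- (1 / of_nat M))"
  have qj: "q ^ j = (-1) ^ j * er (- (of_nat j / of_nat (2 * M)))" for j
    unfolding q_def by (subst power_minus) (simp add: er_power)
  have qz: "q ^ 2 = z" unfolding qj z_def by simp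
  have zM: "z ^ M = 1" using M by (simp add: z_def er_power)
  have zj: "z ^ j \<noteq> 1" if "0 < j" "j < M" for j
  proof
    assume "z ^ j = 1"
    then have "- (of_nat j / of_nat M) \<in> (\<int> :: rat set)" by (simp add: z_def er_power er_eq_1_iff)
    then have "of_nat j / of_nat M \<in> (\<int> :: rat set)" by simp
    then obtain i where "(of_nat j / of_nat M :: rat) = of_int i" by (elim Ints_cases)
    then have "(of_int (int j) :: rat) = of_int (i * int M)" using M by (simp add: field_simps)
    then have "int j = i * int M" by (simp only: of_int_eq_iff)
    then have "int M dvd int j" by simp
    then show False using that by (simp add: nat_dvd_not_less)
  qed
  have trm: "q ^ k * qbinomial z (M - 1) k = er (of_nat k ^ 2 / of_nat (2 * M))" if "k < M" for k
  proof -
    have "q ^ (k * k) * (q ^ k * qbinomial z (M - 1) k) = q ^ (k * Suc k) * qbinomial z (M - 1) k"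
      by (simp add: power_add mult.assoc mult.commute)
    also have "\<dots> = (-1) ^ k" by (rule qbinomial_root_of_unity[OF zM zj qz that])
    also have "\<dots> = q ^ (k * k) * er (of_nat k ^ 2 / of_nat (2 * M))"
    proof -
      have "(-1 :: complex) ^ (k * k) = (-1) ^ k" by (simp add: minus_one_power_iff)
      then show ?thesis unfolding qj
        using er_minus_mult[of "of_nat k ^ 2 / of_nat (2 * M)"] by (simp add: power2_eq_square mult.assoc)
    qed
    finally show ?thesis by (simp add: q_def)
  qed
  have "(\<Sum>k<M. er (of_nat k ^ 2 / of_nat (2 * M))) = (\<Sum>k\<le>M - 1. q ^ k * qbinomial (q ^ 2) (M - 1) k)"
    using M trm unfolding qz by (intro sum.cong) auto
  also have "\<dots> = (\<Prod>j=1..M - 1. 1 + q ^ j)" by (rule gauss_qbinomial_sum)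
  finally show ?thesis unfolding qj .
qed

text \<open>Only the phase is needed, because the modulus is found later by squaring. Each factor of
  the product formula is a positive real times \<open>er (t j)\<close>, and the exponents
  \<open>t j\<close> add up to \<open>1 / 8\<close>.\<close>

lemma gauss_sum_phase:
  assumes m: "m > 0"
  shows "\<exists>r>0. (\<Sum>k<2*m. er (of_nat k ^ 2 / of_nat (4 * m))) = of_real r * er (1 / 8)"
proof -
  \<comment> \<open>With \<open>x = pi * j / (4 * m)\<close> the factor is
    \<open>1 + (-1) ^ j * exp (- 2 i x)\<close>; pulling out \<open>exp (- i x)\<close> leaves
    \<open>2 cos x\<close> for even \<open>j\<close> and \<open>2 i sin x\<close> for odd
    \<open>j\<close>. Both are covered by \<open>s\<close>, and the \<open>i\<close> by the
    \<open>1 / 4\<close> in \<open>t\<close>.\<close>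
  define s where "s j = (if odd j then sin (pi * j / (4 * m)) else cos (pi * j / (4 * m)))" for j :: nat
  define t where "t j = (if odd j then 1 / 4 else 0) - of_nat j / (of_nat (8 * m) :: rat)" for j :: nat
  have factor: "1 + (-1) ^ j * er (- (of_nat j / of_nat (2 * (2 * m)))) = of_real (2 * s j) * er (t j)" for j
  proof -
    have h: "er (- (of_nat j / of_nat (2 * (2 * m)))) = er (- (of_nat j / of_nat (8 * m))) * er (- (of_nat j / of_nat (8 * m)))"
      using m by (simp add: er_add[symmetric] field_simps)
    have c: "er (of_nat j / of_nat (8 * m)) = cis (pi * j / (4 * m))"
      using m by (simp add: er_cis of_rat_divide of_rat_mult field_simps)
    have c': "er (- (of_nat j / of_nat (8 * m))) = cis (- (pi * j / (4 * m)))"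
      using m by (simp add: er_cis of_rat_divide of_rat_mult of_rat_minus field_simps)
    let ?u = "er (of_nat j / of_nat (8 * m))" and ?v = "er (- (of_nat j / of_nat (8 * m)))"
    have one: "?v * ?u = 1" by (rule er_minus_mult)
    show ?thesis
    proof (cases "odd j")
      case True
      have "1 + (-1) ^ j * er (- (of_nat j / of_nat (2 * (2 * m)))) = 1 - ?v * ?v"
        unfolding h using True by simp
      also have "\<dots> = (?u - ?v) * ?v" using one by (simp add: algebra_simps)
      also have "?u - ?v = of_real (2 * s j) * \<i>"
        unfolding c c' using True by (simp add: s_def complex_eq_iff)
      also have "of_real (2 * s j) * \<i> * ?v = of_real (2 * s j) * er (t j)"
        using True er_diff[of "1/4" "of_nat j / of_nat (8 * m)"] by (simp add: t_def er_quarter)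
      finally show ?thesis .
    next
      case False
      have "1 + (-1) ^ j * er (- (of_nat j / of_nat (2 * (2 * m)))) = 1 + ?v * ?v"
        unfolding h using False by simp
      also have "\<dots> = (?u + ?v) * ?v" using one by (simp add: algebra_simps)
      also have "?u + ?v = of_real (2 * s j)"
        unfolding c c' using False by (simp add: s_def complex_eq_iff)
      also have "?v = er (t j)" using False by (simp add: t_def)
      finally show ?thesis .
    qed
  qed
  have s_pos: "s j > 0" if "1 \<le> j" "j \<le> 2 * m - 1" for j
  proof -
    have "real j < 2 * real m" using that m by linarith
    then have "pi * j / (4 * m) < pi / 2" using m by (simp add: field_simps)
    moreover have "pi * j / (4 * m) > 0" using that m by simp
    ultimately show ?thesis unfolding s_def using sin_gt_zero cos_gt_zero by auto
  qed
  \<comment> \<open>With the linear part added back, two consecutive terms contribute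
    \<open>1 / 4\<close>.\<close>
  have t_sum: "(\<Sum>j=1..2 * l. t j + 1 / 4 / of_nat (2 * m) * of_nat j) = of_nat l / 4" for l
    by (induction l) (simp_all add: t_def field_simps)
  have id: "(\<Sum>j=1..l. of_nat j) = (of_nat l * of_nat (l + 1) / 2 :: rat)" for l
    by (induction l) (simp_all add: field_simps)
  have "(\<Sum>j=1..2 * m. t j) + (1 / 4 / of_nat (2 * m)) * (\<Sum>j=1..2 * m. of_nat j) = of_nat m / 4"
    using t_sum[of m] unfolding sum.distrib sum_distrib_left .
  then have "8 * of_nat m * (8 * (\<Sum>j=1..2 * m. t j) + 1) = 0" using m unfolding id by (simp add: field_simps)
  then have "8 * (\<Sum>j=1..2 * m. t j) + 1 = 0" using m by simp
  then have "(\<Sum>j=1..2 * m. t j) = - 1 / 8" by linarith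
  \<comment> \<open>The sum was taken up to the even bound \<open>2 * m\<close>, one term beyond the
    factors of the product. Removing the surplus \<open>- 1 / 4\<close> turns \<open>- 1 / 8\<close>
    into \<open>1 / 8\<close>.\<close>
  moreover have "(\<Sum>j=1..2 * m. t j) = (\<Sum>j=1..2 * m - 1. t j) + t (2 * m)"
    using m sum.atLeastAtMost_rev[of t 1 "2 * m"] by (cases m) simp_all
  moreover have "t (2 * m) = - 1 / 4" using m by (simp add: t_def)
  ultimately have tt: "(\<Sum>j=1..2 * m - 1. t j) = 1 / 8" by simp
  have "(\<Sum>k<2*m. er (of_nat k ^ 2 / of_nat (4 * m)))
      = (\<Prod>j=1..2 * m - 1. of_real (2 * s j) * er (t j))"
    using gauss_sum_product[of "2 * m"] m unfolding factor by simp
  also have "\<dots> = of_real (\<Prod>j=1..2 * m - 1. 2 * s j) * er (1 / 8)"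
    unfolding prod.distrib[of "\<lambda>j. of_real (2 * s j)"] er_sum[symmetric, OF finite_atLeastAtMost] tt of_real_prod ..
  finally have "(\<Sum>k<2*m. er (of_nat k ^ 2 / of_nat (4 * m)))
    = of_real (\<Prod>j=1..2 * m - 1. 2 * s j) * er (1 / 8)" .
  moreover have "(\<Prod>j=1..2 * m - 1. 2 * s j) > 0" using s_pos by (intro prod_pos) auto
  ultimately show ?thesis by blast
qed

section \<open>Congruences and the Kronecker symbol\<close>

text \<open>Pigeonhole: with \<open>p = 2 * h + 1\<close> there are \<open>h + 1\<close> values
  \<open>a\<^sup>2\<close> and \<open>h + 1\<close> values \<open>- 1 - b\<^sup>2\<close> modulo
  \<open>p\<close>, too many to be disjoint.\<close>

lemma neg_one_sum_two_squares_prime: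
  assumes p: "prime p" "odd p"
  shows "\<exists>a b::int. int p dvd a\<^sup>2 + b\<^sup>2 + 1"
proof -
  define h where "h = (p - 1) div 2"
  have p2: "p = 2 * h + 1" using p by (auto simp: h_def elim: oddE)
  have ip: "prime (int p)" using p by simp
  have sq: "x = y" if "x \<in> {0..int h}" "y \<in> {0..int h}" "int p dvd x\<^sup>2 - y\<^sup>2" for x y
  proof -
    have "x\<^sup>2 - y\<^sup>2 = (x - y) * (x + y)" by (simp add: power2_eq_square algebra_simps)
    then have "int p dvd x - y \<or> int p dvd x + y"
      using that(3) prime_dvd_mult_iff[OF ip] by simp
    then show ?thesis
    proof
      assume "int p dvd x - y"
      then show ?thesis using that p2 dvd_imp_le_int[of "x - y" "int p"] by force
    next
      assume d: "int p dvd x + y"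
      show ?thesis
      proof (cases "x + y = 0")
        case False
        then show ?thesis using that p2 zdvd_imp_le[OF d] by simp
      qed (use that in simp)
    qed
  qed
  let ?f = "\<lambda>x::int. x\<^sup>2 mod int p" and ?g = "\<lambda>x::int. (- 1 - x\<^sup>2) mod int p"
  have "inj_on ?f {0..int h}" by (rule inj_onI, rule sq) (simp_all add: mod_eq_dvd_iff)
  moreover have "inj_on ?g {0..int h}"
  proof (rule inj_onI)
    fix x y assume xy: "x \<in> {0..int h}" "y \<in> {0..int h}" "?g x = ?g y"
    then have "int p dvd (-1 - x\<^sup>2) - (-1 - y\<^sup>2)" by (simp only: mod_eq_dvd_iff)
    then have "int p dvd y\<^sup>2 - x\<^sup>2" by simp
    then show "x = y" using sq xy by metis
  qed
  ultimately have c: "card (?f ` {0..int h}) = h + 1" "card (?g ` {0..int h}) = h + 1"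
    by (simp_all add: card_image)
  have "?f ` {0..int h} \<inter> ?g ` {0..int h} \<noteq> {}"
  proof
    assume "?f ` {0..int h} \<inter> ?g ` {0..int h} = {}"
    then have "card (?f ` {0..int h} \<union> ?g ` {0..int h}) = 2 * h + 2"
      using c by (simp add: card_Un_disjoint)
    moreover have "?f ` {0..int h} \<union> ?g ` {0..int h} \<subseteq> {0..<int p}" using p2 by auto
    then have "card (?f ` {0..int h} \<union> ?g ` {0..int h}) \<le> p"
      using card_mono[of "{0..<int p}"] by fastforce
    ultimately show False using p2 by simp
  qed
  then obtain a b where "?f a = ?g b" by blast
  then have "int p dvd a\<^sup>2 - (- 1 - b\<^sup>2)" by (simp only: mod_eq_dvd_iff)
  then show ?thesis by (intro exI[of _ a] exI[of _ b]) (simp add: algebra_simps)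
qed

text \<open>Hensel's step. Replacing \<open>a\<close> by \<open>a + c * s\<close> multiplies
  \<open>c\<close> by \<open>u + 2 * a * s + c * s\<^sup>2\<close>, and since \<open>p\<close>
  divides \<open>c\<close> only \<open>u + 2 * a * s \<equiv> 0\<close> modulo \<open>p\<close> has
  to be solved, where \<open>2 * a\<close> is a unit.\<close>

lemma neg_one_sum_two_squares_lift:
  fixes c a b :: int
  assumes p: "prime p" "odd p" and c: "int p dvd c" "c dvd a\<^sup>2 + b\<^sup>2 + 1" and a: "\<not> int p dvd a"
  shows "\<exists>a'. int p * c dvd a'\<^sup>2 + b\<^sup>2 + 1"
proof -
  obtain u where u: "a\<^sup>2 + b\<^sup>2 + 1 = c * u" using c(2) by (auto elim: dvdE)
  have ip: "prime (int p)" using p by simp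
  have "\<not> int p dvd 2"
  proof
    assume "int p dvd 2"
    then have "p \<le> 2" using zdvd_imp_le[of "int p" 2] by simp
    then show False using p prime_ge_2_nat[of p] by (cases "p = 2") auto
  qed
  then have "\<not> int p dvd 2 * a" using a prime_dvd_mult_iff[OF ip] by simp
  then have "coprime (2 * a) (int p)" using ip prime_imp_coprime coprime_commute by blast
  then obtain i where i: "[2 * a * i = 1] (mod int p)" using cong_solve_coprime_int by blast
  define s where "s = - u * i"
  have "u + 2 * a * s = u * (1 - 2 * a * i)" by (simp add: s_def algebra_simps)
  moreover have "int p dvd 1 - 2 * a * i" using i by (metis cong_iff_dvd_diff cong_sym)
  ultimately have "int p dvd u + 2 * a * s + c * s\<^sup>2" using c(1) by simp
  moreover have "(a + c * s)\<^sup>2 + b\<^sup>2 + 1 = c * (u + 2 * a * s + c * s\<^sup>2)"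
    using u by (simp add: power2_eq_square algebra_simps)
  ultimately show ?thesis by (intro exI[of _ "a + c * s"]) (simp add: mult.commute mult_dvd_mono)
qed

text \<open>Supplies the similitude with multiplier \<open>- 1\<close> modulo \<open>c\<close> that
  \<open>gmean_fourth_power\<close> needs.\<close>

lemma neg_one_sum_two_squares:
  "odd c \<Longrightarrow> \<exists>a b::int. int c dvd a\<^sup>2 + b\<^sup>2 + 1"
proof (induction c rule: less_induct)
  case (less c)
  show ?case
  proof (cases "c = 1")
    case False
    then obtain p where p: "prime p" "p dvd c" using prime_factor_nat by blast
    then obtain d where d: "c = p * d" by blast
    have odd: "odd p" "odd d" using less.prems d by auto
    then have "d > 0" by (cases d) auto
    then have "d < c" using d prime_gt_1_nat[OF p(1)] by simp
    then obtain a b where ab: "int d dvd a\<^sup>2 + b\<^sup>2 + 1" using less.IH odd by blast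
    have ip: "prime (int p)" using p by simp
    show ?thesis
    \<comment> \<open>A repeated prime calls for lifting, a new one for the Chinese remainder
      theorem. In the first case \<open>p\<close> cannot divide both \<open>a\<close> and
      \<open>b\<close>, because it divides \<open>a\<^sup>2 + b\<^sup>2 + 1\<close>.\<close>
    proof (cases "p dvd d")
      case True
      have sym: "b\<^sup>2 + a\<^sup>2 + 1 = a\<^sup>2 + b\<^sup>2 + 1" by simp
      have "\<not> (int p dvd a \<and> int p dvd b)"
      proof
        assume "int p dvd a \<and> int p dvd b"
        then have "int p dvd a\<^sup>2 + b\<^sup>2" by (simp add: power2_eq_square)
        moreover have "int p dvd a\<^sup>2 + b\<^sup>2 + 1" using True ab by (meson dvd_trans of_nat_dvd_iff)
        ultimately have "int p dvd 1" using dvd_add_right_iff by blast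
        then show False using ip not_prime_unit by blast
      qed
      then consider "\<not> int p dvd a" | "\<not> int p dvd b" by blast
      then show ?thesis
      proof cases
        case 1
        then show ?thesis
          using neg_one_sum_two_squares_lift[OF p(1) odd(1) _ ab] True d by auto
      next
        case 2
        then obtain b' where "int p * int d dvd b'\<^sup>2 + a\<^sup>2 + 1"
          using neg_one_sum_two_squares_lift[OF p(1) odd(1) _ _ 2, of "int d" a] ab True
          by (auto simp: sym)
        then show ?thesis using d by auto
      qed
    next
      case False
      then have cop: "coprime (int p) (int d)" using prime_imp_coprime[OF p(1)] by simp
      obtain a1 b1 where ab1: "int p dvd a1\<^sup>2 + b1\<^sup>2 + 1"
        using neg_one_sum_two_squares_prime[OF p(1) odd(1)] by blast
      obtain x where x: "[x = a1] (mod int p)" "[x = a] (mod int d)"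
        using binary_chinese_remainder_int[OF cop] by blast
      obtain y where y: "[y = b1] (mod int p)" "[y = b] (mod int d)"
        using binary_chinese_remainder_int[OF cop] by blast
      have "[x\<^sup>2 + y\<^sup>2 + 1 = a1\<^sup>2 + b1\<^sup>2 + 1] (mod int p)" using x y by (intro cong_add cong_pow) auto
      then have 1: "int p dvd x\<^sup>2 + y\<^sup>2 + 1" using ab1 cong_dvd_iff by blast
      have "[x\<^sup>2 + y\<^sup>2 + 1 = a\<^sup>2 + b\<^sup>2 + 1] (mod int d)" using x y by (intro cong_add cong_pow) auto
      then have "int d dvd x\<^sup>2 + y\<^sup>2 + 1" using ab cong_dvd_iff by blast
      then have "int p * int d dvd x\<^sup>2 + y\<^sup>2 + 1" using 1 cop divides_mult by blast
      then show ?thesis using d by auto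
    qed
  qed simp
qed

section \<open>Multiplicativity of the Legendre and Kronecker symbols\<close>

lemma Legendre_values: "Legendre a p \<in> {-1, 0, 1}"
  by (simp add: Legendre_def)

lemma Legendre_mult:
  assumes p: "prime p" "2 < p"
  shows "Legendre (a * b) (int p) = Legendre a (int p) * Legendre b (int p)"
proof -
  have "[Legendre (a * b) (int p) = (a * b) ^ ((p - 1) div 2)] (mod int p)"
    by (rule euler_criterion[OF p])
  moreover have "[Legendre a (int p) * Legendre b (int p) = a ^ ((p - 1) div 2) * b ^ ((p - 1) div 2)] (mod int p)"
    by (intro cong_mult euler_criterion[OF p])
  ultimately have "[Legendre (a * b) (int p) = Legendre a (int p) * Legendre b (int p)] (mod int p)"
    by (metis cong_sym cong_trans power_mult_distrib)
  then have d: "int p dvd Legendre (a * b) (int p) - Legendre a (int p) * Legendre b (int p)"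
    by (simp add: cong_iff_dvd_diff)
  have "\<bar>Legendre (a * b) (int p) - Legendre a (int p) * Legendre b (int p)\<bar> \<le> 2"
    using Legendre_values[of a "int p"] Legendre_values[of b "int p"] Legendre_values[of "a * b" "int p"]
    by auto
  moreover have "\<bar>int p\<bar> > 2" using p(2) by simp
  ultimately show ?thesis using dvd_imp_le_int[OF _ d] by (cases "Legendre (a * b) (int p) - Legendre a (int p) * Legendre b (int p) = 0") (simp, linarith)
qed

lemma kronecker_two_mult: "kronecker_two (a * b) = kronecker_two a * kronecker_two b"
proof (cases "odd a \<and> odd b")
  case True
  have "x mod 8 \<in> {1, 3, 5, 7}" if "odd x" for x :: int
  proof -
    have "x mod 8 \<in> {0..<8}" by simp
    also have "{0..<8 :: int} = {0, 1, 2, 3, 4, 5, 6, 7}" by auto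
    finally have "x mod 8 \<in> {0, 1, 2, 3, 4, 5, 6, 7}" .
    moreover have "odd (x mod 8)" using that dvd_mod_iff[of 2 8 x] by simp
    ultimately show ?thesis by auto
  qed
  then obtain r s where rs: "r \<in> {1, 3, 5, 7}" "s \<in> {1, 3, 5, 7}" "a mod 8 = r" "b mod 8 = s"
    using True by blast
  have ab: "(a * b) mod 8 = (r * s) mod 8" unfolding rs(3,4)[symmetric] mod_mult_eq ..
  have "odd (a * b)" using True by simp
  then show ?thesis
    using True rs(1,2) unfolding kronecker_two_def ab rs(3,4) by (elim insertE emptyE) simp_all
qed (auto simp: kronecker_two_def)

lemma kronecker_1: "kronecker a 1 = 1"
  by (simp add: kronecker_def)

lemma kronecker_prime_times:
  assumes p: "prime p" and m: "m > 0"
  shows "kronecker a (int (p * m)) =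
    (if p = 2 then kronecker_two a else Legendre a (int p)) * kronecker a (int m)"
proof -
  have p0: "p > 0" using p prime_gt_0_nat by blast
  have "prime_factorization (p * m) = {#p#} + prime_factorization m"
    using p m p0 by (simp add: prime_factorization_mult prime_factorization_prime)
  moreover have "\<not> int p * int m < 0" by (simp add: mult_less_0_iff)
  ultimately show ?thesis using m p0 by (simp add: kronecker_def nat_mult_distrib)
qed

lemma kronecker_mult:
  assumes m: "m > 0"
  shows "kronecker (a * b) (int m) = kronecker a (int m) * kronecker b (int m)"
proof -
  let ?k = "\<lambda>a p. if p = 2 then kronecker_two a else Legendre a (int p)"
  have *: "?k (a * b) p = ?k a p * ?k b p" if "prime p" for p
    using that Legendre_mult[OF that] prime_ge_2_nat[OF that] kronecker_two_mult by auto
  have "(\<Prod>p\<in>#prime_factorization m. ?k (a * b) p)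
      = (\<Prod>p\<in>#prime_factorization m. ?k a p * ?k b p)"
    by (intro arg_cong[of _ _ prod_mset] image_mset_cong) (rule *, erule in_prime_factors_imp_prime)
  then show ?thesis using m by (simp add: kronecker_def prod_mset.distrib)
qed

lemma kronecker_power: "m > 0 \<Longrightarrow> kronecker (a ^ k) (int m) = kronecker a (int m) ^ k"
proof (induction k)
  case 0
  have "?case" if "kronecker 1 (int m) = 1" using that by simp
  moreover have *: "(if p = 2 then kronecker_two 1 else Legendre 1 (int p)) = 1" if "prime p" for p
  proof -
    have "QuadRes (int p) 1" unfolding QuadRes_def by (rule exI[of _ 1]) simp
    moreover have "\<not> [1 = 0] (mod int p)" using prime_gt_1_nat[OF that] by (simp add: cong_0_iff)
    ultimately show ?thesis by (simp add: kronecker_two_def Legendre_def)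
  qed
  have "(\<Prod>p\<in>#prime_factorization m. if p = 2 then kronecker_two 1 else Legendre 1 (int p)) = (\<Prod>p\<in>#prime_factorization m. 1)"
    by (intro arg_cong[of _ _ prod_mset] image_mset_cong) (rule *, erule in_prime_factors_imp_prime)
  ultimately show ?case using 0 by (simp add: kronecker_def)
qed (simp add: kronecker_mult)

section \<open>Lattices and their duals\<close>

context Z_lattice
begin

abbreviation Q :: "'v \<Rightarrow> rat" where "Q \<equiv> qform B"

abbreviation dual :: "'v set" where "dual \<equiv> dual_lattice L B"

abbreviation multiples :: "nat \<Rightarrow> 'v set" where "multiples m \<equiv> scl (of_nat m) ` L"

lemma B_add_right: "B x (y + z) = B x y + B x z"
  using Vector_Spaces.linear.axioms(3)[OF bilinear[of x]] by (simp add: module_hom_iff)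

lemma B_scl_right: "B x (scl r y) = r * B x y"
  using Vector_Spaces.linear.axioms(3)[OF bilinear[of x]] by (simp add: module_hom_iff)

lemma B_add_left: "B (x + y) z = B x z + B y z"
  by (simp only: symmetric[of _ z] B_add_right)

lemma B_scl_left: "B (scl r x) y = r * B x y"
  by (simp only: symmetric[of _ y] B_scl_right)

lemma B_zero: "B 0 x = 0" "B x 0 = 0"
  using B_scl_left[of 0 0 x] B_scl_right[of x 0 0] by simp_all

lemma B_minus: "B (- x) y = - B x y" "B x (- y) = - B x y"
  using B_scl_left[of "-1" x y] B_scl_right[of x "-1" y] by simp_all

lemma B_diff_left: "B (x - y) z = B x z - B y z"
  using B_add_left[of x "- y" z] by (simp add: B_minus)

lemma B_diff_right: "B x (y - z) = B x y - B x z"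
  using B_add_right[of x y "- z"] by (simp add: B_minus)

lemma B_sum_right: "B x (sum f I) = (\<Sum>i\<in>I. B x (f i))"
  by (induction I rule: infinite_finite_induct) (simp_all add: B_zero B_add_right)

lemma B_sum_left: "B (sum f I) x = (\<Sum>i\<in>I. B (f i) x)"
  by (simp only: symmetric[of _ x] B_sum_right)

lemma Q_add: "Q (x + y) = Q x + Q y + B x y"
  by (simp add: qform_def B_add_left B_add_right symmetric[of y x] field_simps)

lemma Q_diff: "Q (x - y) = Q x + Q y - B x y"
  by (simp add: qform_def B_diff_left B_diff_right symmetric[of y x] field_simps)

lemma Q_scl: "Q (scl r x) = r\<^sup>2 * Q x"
  by (simp add: qform_def B_scl_left B_scl_right power2_eq_square)

lemma Q_zero: "Q 0 = 0"
  by (simp add: qform_def B_zero)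

lemma Q_minus: "Q (- x) = Q x"
  by (simp add: qform_def B_minus)

definition int_span :: "'v set \<Rightarrow> 'v set"
  where "int_span E = range (\<lambda>k :: 'v \<Rightarrow> int. \<Sum>x\<in>E. scl (of_int (k x)) x)"

lemma int_spanI: "x = (\<Sum>e\<in>E. scl (of_int (k e)) e) \<Longrightarrow> x \<in> int_span E"
  by (auto simp: int_span_def)

lemma int_spanE:
  assumes "x \<in> int_span E"
  obtains k :: "'v \<Rightarrow> int" where "x = (\<Sum>e\<in>E. scl (of_int (k e)) e)"
  using assms by (auto simp: int_span_def)

lemma int_span_subgroup: "add_subgroup (int_span E)"
  unfolding add_subgroup_def
proof (intro conjI ballI)
  show "0 \<in> int_span E" by (rule int_spanI[where k = "\<lambda>_. 0"]) simp
  fix x y assume "x \<in> int_span E" "y \<in> int_span E"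
  then obtain k l where "x = (\<Sum>e\<in>E. scl (of_int (k e)) e)" "y = (\<Sum>e\<in>E. scl (of_int (l e)) e)"
    by (elim int_spanE)
  then show "x - y \<in> int_span E"
    by (intro int_spanI[where k = "\<lambda>e. k e - l e"]) (simp add: sum_subtractf scale_left_diff_distrib)
qed

lemma int_span_base:
  assumes "finite E" "e \<in> E" shows "e \<in> int_span E"
proof -
  have "(\<Sum>x\<in>E. scl (of_int (if x = e then 1 else 0)) x) = (\<Sum>x\<in>E. if x = e then e else 0)"
    by (intro sum.cong) auto
  then have "e = (\<Sum>x\<in>E. scl (of_int (if x = e then 1 else 0)) x)" using assms by simp
  then show ?thesis by (rule int_spanI)
qed

lemma basis:
  obtains E where "finite E" "independent E" "span E = UNIV" "card E = dim L" "L = int_span E"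
proof -
  obtain E where E: "finite E" "independent E" "span E = UNIV" "L = int_span E"
    using free unfolding int_span_def by blast
  then have "E \<subseteq> L" using int_span_base by blast
  then have "span L = UNIV" using E(3) span_mono[of E L] by auto
  then have "card E = dim L" using dim_eq_card[of E L] E by simp
  with E that show thesis by blast
qed

lemma L_subgroup: "add_subgroup L"
  by (rule basis) (simp add: int_span_subgroup)

lemma scl_int_subgroup: "add_subgroup A \<Longrightarrow> x \<in> A \<Longrightarrow> scl (of_int k) x \<in> A"
proof -
  assume A: "add_subgroup A" "x \<in> A"
  have n: "scl (of_nat m) x \<in> A" for m
    by (induction m) (use A in \<open>simp_all add: add_subgroup_zero scale_left_distrib add_subgroup_add\<close>)
  show ?thesis
  proof (cases k)
    case (neg m)
    have "scl (of_int k) x = - scl (of_nat (Suc m)) x" unfolding neg by (simp only: of_int_minus of_int_of_nat_eq scale_minus_left)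
    then show ?thesis using add_subgroup_minus[OF A(1) n[of "Suc m"]] by simp
  qed (use n in simp)
qed

lemma scl_nat_subgroup: "add_subgroup A \<Longrightarrow> x \<in> A \<Longrightarrow> scl (of_nat k) x \<in> A"
  using scl_int_subgroup[of A x "int k"] by simp

lemma scl_image_subgroup: "add_subgroup A \<Longrightarrow> add_subgroup (scl r ` A)"
  unfolding add_subgroup_def
proof (intro conjI ballI)
  assume A: "0 \<in> A \<and> (\<forall>x\<in>A. \<forall>y\<in>A. x - y \<in> A)"
  then show "0 \<in> scl r ` A" using image_eqI[of 0 "scl r" 0 A] by simp
  fix x y assume "x \<in> scl r ` A" "y \<in> scl r ` A"
  then obtain u v where "x = scl r u" "u \<in> A" "y = scl r v" "v \<in> A" by blast
  then show "x - y \<in> scl r ` A"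
    using A image_eqI[of "x - y" "scl r" "u - v" A] by (simp add: scale_right_diff_distrib)
qed

lemma multiples_subset: "multiples m \<subseteq> L"
  using scl_nat_subgroup[OF L_subgroup] by auto

lemma multiple_in_L: "\<exists>k>0. scl (of_nat k) x \<in> L"
proof -
  obtain E where E: "finite E" "span E = UNIV"
    and L: "L = int_span E"
    by (rule basis)
  obtain u where u: "x = (\<Sum>e\<in>E. scl (u e) e)" using span_finite[OF E(1)] E(2) by blast
  define den where "den e = nat (snd (quotient_of (u e)))" for e
  have den: "den e > 0" "\<exists>j. of_nat (den e) * u e = of_int j" for e
  proof -
    obtain a b where ab: "quotient_of (u e) = (a, b)" by fastforce
    then have "b > 0" "u e = of_int a / of_int b"
      using quotient_of_denom_pos quotient_of_div by blast+
    then show "den e > 0" "\<exists>j. of_nat (den e) * u e = of_int j"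
      using ab by (auto simp: den_def)
  qed
  let ?d = "\<Prod>e\<in>E. den e"
  have "\<exists>j. of_nat ?d * u e = of_int j" if e: "e \<in> E" for e
  proof -
    obtain j where j: "of_nat (den e) * u e = of_int j" using den by blast
    have "?d = den e * (\<Prod>e\<in>E - {e}. den e)" using E(1) e by (simp add: prod.remove)
    then have "of_nat ?d * u e = of_nat (\<Prod>e\<in>E - {e}. den e) * of_int j"
      using j by (simp add: mult_ac)
    then show ?thesis by (metis of_int_mult of_int_of_nat_eq)
  qed
  then obtain j where j: "\<And>e. e \<in> E \<Longrightarrow> of_nat ?d * u e = of_int (j e)" by metis
  have "scl (of_nat ?d) x = (\<Sum>e\<in>E. scl (of_int (j e)) e)"
    unfolding u scale_sum_right by (intro sum.cong refl) (simp only: scale_scale j)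
  then have "scl (of_nat ?d) x \<in> L" unfolding L by (rule int_spanI)
  moreover have "?d > 0" using den by (simp add: prod_pos)
  ultimately show ?thesis by blast
qed

lemma dual_subgroup: "add_subgroup dual"
  by (auto simp: add_subgroup_def dual_lattice_def B_zero B_diff_left)

lemma B_dual: "x \<in> dual \<Longrightarrow> y \<in> L \<Longrightarrow> B x y \<in> \<int>" "x \<in> L \<Longrightarrow> y \<in> dual \<Longrightarrow> B x y \<in> \<int>"
  by (simp_all add: dual_lattice_def symmetric[of x])

lemma index_multiples:
  assumes m: "m > 0"
  shows "finite_index (multiples m) L" "index (multiples m) L = m ^ dim L"
proof -
  obtain E where E: "finite E" "independent E" "card E = dim L"
    and L: "L = int_span E"
    by (rule basis)
  let ?f = "\<lambda>k :: 'v \<Rightarrow> int. \<Sum>x\<in>E. scl (of_int (k x)) x"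
  let ?Box = "\<Pi>\<^sub>E e\<in>E. {0..<int m}"
  have mult: "?f k \<in> multiples m" if "\<And>e. e \<in> E \<Longrightarrow> int m dvd k e" for k
  proof -
    have "?f k = scl (of_nat m) (?f (\<lambda>e. k e div int m))"
      unfolding scale_sum_right
    proof (intro sum.cong refl)
      fix e assume "e \<in> E"
      then have "k e = int m * (k e div int m)" using that by simp
      then have "(of_int (k e) :: rat) = of_nat m * of_int (k e div int m)"
        by (metis of_int_mult of_int_of_nat_eq)
      then show "scl (of_int (k e)) e = scl (of_nat m) (scl (of_int (k e div int m)) e)" by simp
    qed
    moreover have "?f (\<lambda>e. k e div int m) \<in> L" unfolding L by (rule int_spanI) (rule refl)
    ultimately show ?thesis by (rule image_eqI)
  qed
  have diff: "?f k - ?f l = ?f (\<lambda>e. k e - l e)" for k l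
    by (simp add: sum_subtractf scale_left_diff_distrib)
  have mult': "int m dvd k e" if k: "?f k \<in> multiples m" and e: "e \<in> E" for k e
  proof -
    obtain l where "?f k = scl (of_nat m) (?f l)" using k unfolding L int_span_def by blast
    then have "?f k - ?f (\<lambda>e. int m * l e) = 0" by (simp add: scale_sum_right)
    then have "(\<Sum>x\<in>E. scl (of_int (k x - int m * l x)) x) = 0" unfolding diff .
    then have "(of_int (k e - int m * l e) :: rat) = 0"
      using independentD[OF E(2,1) subset_refl, of "\<lambda>x. of_int (k x - int m * l x)"] e by blast
    then have "k e = int m * l e" by (metis eq_iff_diff_eq_0 of_int_0_eq_iff)
    then show ?thesis by simp
  qed
  have inj: "inj_on ?f ?Box"
  proof (rule inj_onI)
    fix k l assume kl: "k \<in> ?Box" "l \<in> ?Box" "?f k = ?f l"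
    have "?f (\<lambda>e. k e - l e) = 0" using diff[of k l] kl(3) by simp
    then have "(of_int (k e - l e) :: rat) = 0" if "e \<in> E" for e
      using independentD[OF E(2,1) subset_refl, of "\<lambda>x. of_int (k x - l x)"] that by blast
    then have "k e = l e" if "e \<in> E" for e using that by (metis eq_iff_diff_eq_0 of_int_0_eq_iff)
    then show "k = l" using kl(1,2) by (meson PiE_ext)
  qed
  have sub: "add_subgroup (multiples m)" by (rule scl_image_subgroup[OF L_subgroup])
  have tr: "transversal (multiples m) L (?f ` ?Box)"
    unfolding transversal_def
  proof (intro conjI ballI)
    show "finite (?f ` ?Box)" using E(1) by (intro finite_imageI finite_PiE) auto
    show "?f ` ?Box \<subseteq> L" unfolding L int_span_def by blast
    fix x assume "x \<in> L"
    then obtain k where k: "x = ?f k" unfolding L by (elim int_spanE)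
    let ?k = "\<lambda>e\<in>E. k e mod int m"
    show "\<exists>!t. t \<in> ?f ` ?Box \<and> x - t \<in> multiples m"
    proof (intro ex1I conjI)
      show "?f ?k \<in> ?f ` ?Box" using m by (intro imageI) auto
      show xk: "x - ?f ?k \<in> multiples m"
        unfolding k diff by (rule mult) (simp add: minus_mod_eq_mult_div)
      fix t assume t: "t \<in> ?f ` ?Box \<and> x - t \<in> multiples m"
      then obtain l where l: "t = ?f l" "l \<in> ?Box" by blast
      have "?f ?k - ?f l \<in> multiples m"
        using add_subgroup_diff[OF sub conjunct2[OF t] xk] l by simp
      then have d: "int m dvd ?k e - l e" if "e \<in> E" for e
        using mult'[of "\<lambda>e. ?k e - l e"] that unfolding diff by blast
      have "?k e = l e" if e: "e \<in> E" for e
      proof -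
        have "?k e \<in> {0..<int m}" "l e \<in> {0..<int m}" using e l m by auto
        then have "\<bar>?k e - l e\<bar> < int m" unfolding atLeastLessThan_iff by linarith
        then show ?thesis using d[OF e] dvd_imp_le_int[of "?k e - l e" "int m"] by fastforce
      qed
      then show "t = ?f ?k" unfolding l by (intro sum.cong) auto
    qed
  qed
  show fi: "finite_index (multiples m) L"
    by (rule finite_index_transversalI[OF sub L_subgroup multiples_subset tr])
  show "index (multiples m) L = m ^ dim L"
    using transversal_card[OF fi tr] card_image[OF inj] E by (simp add: card_PiE)
qed

text \<open>Bounded denominators over \<open>L\<close> give finite index over each
  \<open>multiples m\<close>; in the positive definite even case they also make
  \<open>er (r * Q x + B x z)\<close> periodic for all rational \<open>r\<close> and all
  \<open>z\<close> (\<open>periodic_on_er\<close>).\<close>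

definition overlattice :: "'v set \<Rightarrow> bool"
  where "overlattice A \<longleftrightarrow> add_subgroup A \<and> L \<subseteq> A \<and> (\<exists>d>0. \<forall>x\<in>A. scl (of_nat d) x \<in> L)"

lemma overlattice_L: "overlattice L"
  unfolding overlattice_def using L_subgroup by (auto intro!: exI[of _ 1])

lemma overlattice_finite_index:
  assumes A: "overlattice A" and m: "m > 0"
  shows "finite_index (multiples m) A"
proof -
  obtain d where d: "d > 0" "\<And>x. x \<in> A \<Longrightarrow> scl (of_nat d) x \<in> L" and A': "add_subgroup A" "L \<subseteq> A"
    using A unfolding overlattice_def by blast
  obtain E where E: "finite E"
    and L: "L = int_span E"
    by (rule basis)
  have EL: "e \<in> L" if "e \<in> E" for e using int_span_base[OF E that] L by simp
  have sub: "multiples m \<subseteq> A" using multiples_subset A' by blast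
  show ?thesis
  proof (rule finite_index_generated[where S = E and m = "\<lambda>e k. scl (of_int k / of_nat d) e"])
    fix x assume "x \<in> A"
    then obtain k :: "'v \<Rightarrow> int" where "scl (of_nat d) x = (\<Sum>e\<in>E. scl (of_int (k e)) e)"
      using d(2) unfolding L by (blast elim: int_spanE)
    then have "scl (1 / of_nat d) (scl (of_nat d) x) = (\<Sum>e\<in>E. scl (of_int (k e) / of_nat d) e)"
      by (simp add: scale_sum_right)
    then show "\<exists>k. x = (\<Sum>e\<in>E. scl (of_int (k e) / of_nat d) e)" using d(1) by auto
  next
    fix e j k
    show "scl (of_int (j + k) / of_nat d) e = scl (of_int j / of_nat d) e + scl (of_int k / of_nat d) e"
      by (simp add: add_divide_distrib scale_left_distrib)
  next
    fix e assume "e \<in> E"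
    have "scl (of_int (int (d * m) * j) / of_nat d) e = scl (of_nat m) (scl (of_int j) e)" for j
      using d(1) by simp
    then have "\<forall>j. scl (of_int (int (d * m) * j) / of_nat d) e \<in> multiples m"
      using scl_int_subgroup[OF L_subgroup EL[OF \<open>e \<in> E\<close>]] by blast
    then show "\<exists>q>0. \<forall>j. scl (of_int (q * j) / of_nat d) e \<in> multiples m"
      using d(1) m by (intro exI[of _ "int (d * m)"]) simp
  qed (use E sub A' scl_image_subgroup[OF L_subgroup] in auto)
qed

lemma overlattice_finite_index_L: "overlattice A \<Longrightarrow> finite_index L A"
  using overlattice_finite_index[of A 1] by simp

lemma overlattice_multiple:
  assumes "overlattice A" obtains d where "d > 0" "\<And>x. x \<in> A \<Longrightarrow> scl (of_nat d) x \<in> L"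
  using assms unfolding overlattice_def by blast

end

section \<open>Orthogonal bases and the bidual of a positive definite even lattice\<close>

context pos_def_even_lattice
begin

lemma B_int: "x \<in> L \<Longrightarrow> y \<in> L \<Longrightarrow> B x y \<in> \<int>"
proof -
  assume "x \<in> L" "y \<in> L"
  then have "Q (x + y) - Q x - Q y \<in> \<int>" using even add_subgroup_add[OF L_subgroup] by (intro Ints_diff) auto
  then show ?thesis by (simp add: Q_add)
qed

lemma L_subset_dual: "L \<subseteq> dual"
  using B_int by (auto simp: dual_lattice_def)

lemma Q_pos: "x \<noteq> 0 \<Longrightarrow> Q x > 0"
proof -
  assume x: "x \<noteq> 0"
  obtain k where k: "k > 0" "scl (of_nat k) x \<in> L" using multiple_in_L by blast
  then have "Q (scl (of_nat k) x) > 0" using pos_def[OF k(2)] x by simp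
  then show ?thesis using k(1) by (simp add: Q_scl zero_less_mult_iff)
qed

lemma B_self_pos: "x \<noteq> 0 \<Longrightarrow> B x x > 0"
  using Q_pos[of x] by (simp add: qform_def)

lemma periodic_on_er:
  assumes A: "overlattice A"
  shows "periodic_on A (\<lambda>x. er (r * Q x + B x z))"
proof -
  obtain d where d: "d > 0" "\<And>x. x \<in> A \<Longrightarrow> scl (of_nat d) x \<in> L" using overlattice_multiple[OF A] by blast
  obtain dz where dz: "dz > 0" "scl (of_nat dz) z \<in> L" using multiple_in_L by blast
  obtain a b where ab: "quotient_of r = (a, b)" by fastforce
  then have b: "b > 0" "of_int b * r = of_int a"
    using quotient_of_denom_pos[OF ab] quotient_of_div[OF ab] by auto
  define n where "n = nat b"
  have n: "n > 0" "of_nat n * r = of_int a" using b by (simp_all add: n_def)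
  \<comment> \<open>\<open>d\<close> clears the denominators of \<open>A\<close>, \<open>n\<close>
    that of \<open>r\<close>, and \<open>dz\<close> those of \<open>z\<close>.\<close>
  let ?m = "d * n * dz"
  have "er (r * Q (x + h) + B (x + h) z) = er (r * Q x + B x z)" if x: "x \<in> A" and h: "h \<in> multiples ?m" for x h
  proof -
    obtain l where l: "l \<in> L" "h = scl (of_nat ?m) l" using h by blast
    have "r * B x h = of_int a * of_nat dz * B (scl (of_nat d) x) l"
      unfolding n(2)[symmetric] l(2) by (simp add: B_scl_left B_scl_right)
    then have 1: "r * B x h \<in> \<int>" using B_int[OF d(2)[OF x] l(1)] by simp
    have "r * Q h = of_int a * of_nat (d * dz * ?m) * Q l"
      unfolding n(2)[symmetric] l(2) by (simp add: Q_scl power2_eq_square)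
    then have 2: "r * Q h \<in> \<int>" using even[OF l(1)] by simp
    have "B h z = of_nat (d * n) * B l (scl (of_nat dz) z)"
      unfolding l(2) by (simp add: B_scl_left B_scl_right)
    then have 3: "B h z \<in> \<int>" using B_int[OF l(1) dz(2)] by simp
    have "(r * Q (x + h) + B (x + h) z) - (r * Q x + B x z) = r * B x h + r * Q h + B h z"
      by (simp add: Q_add B_add_left symmetric[of h x] algebra_simps)
    then show ?thesis using 1 2 3 by (intro er_cong) simp
  qed
  moreover have "finite_index (multiples ?m) A" using overlattice_finite_index[OF A, of ?m] d(1) n(1) dz(1) by (simp del: of_nat_mult)
  ultimately show ?thesis by (auto simp: periodic_on_def periodic_mod_def)
qed

lemma orthogonal_expansion:
  assumes F: "finite F" "span F = UNIV" "0 \<notin> F" "\<And>x y. x \<in> F \<Longrightarrow> y \<in> F \<Longrightarrow> x \<noteq> y \<Longrightarrow> B x y = 0"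
  shows "x = (\<Sum>b\<in>F. scl (B x b / B b b) b)"
proof -
  let ?y = "x - (\<Sum>b\<in>F. scl (B x b / B b b) b)"
  have pos: "B b b \<noteq> 0" if "b \<in> F" for b
    using B_self_pos[of b] F(3) that by (metis less_irrefl)
  have "B ?y c = 0" if c: "c \<in> F" for c
  proof -
    have "B (\<Sum>b\<in>F. scl (B x b / B b b) b) c = (\<Sum>b\<in>F. if b = c then B x c else 0)"
      unfolding B_sum_left B_scl_left
    proof (intro sum.cong refl)
      fix b assume b: "b \<in> F"
      show "B x b / B b b * B b c = (if b = c then B x c else 0)"
        using F(4)[OF b c] pos[OF b] by auto
    qed
    then show ?thesis using c F(1) by (simp add: B_diff_left)
  qed
  then have zero: "B ?y (\<Sum>b\<in>F. scl (u b) b) = 0" for u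
    unfolding B_sum_right B_scl_right by (intro sum.neutral) simp
  obtain u where u: "?y = (\<Sum>b\<in>F. scl (u b) b)" using span_finite[OF F(1)] F(2) by blast
  have "B ?y ?y = 0" using zero[of u] unfolding u[symmetric] .
  then have "?y = 0" using B_self_pos[of ?y] less_irrefl by metis
  then show ?thesis by simp
qed

text \<open>Orthogonalisation over the rationals; each new vector is multiplied by a positive
  integer so that it lies in \<open>L\<close>.\<close>

lemma gram_schmidt:
  assumes "finite E" "independent E"
  shows "\<exists>F. finite F \<and> F \<subseteq> L \<and> card F = card E \<and> span F = span E \<and> 0 \<notin> F \<and>
    (\<forall>x\<in>F. \<forall>y\<in>F. x \<noteq> y \<longrightarrow> B x y = 0)"
  using assms
proof (induction E rule: finite_induct)
  case empty
  then show ?case by (intro exI[of _ "{}"]) simp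
next
  case (insert e E)
  have ind: "independent E" "e \<notin> span E" using insert.prems insert.hyps by (simp_all add: independent_insert)
  obtain F where F: "finite F" "F \<subseteq> L" "card F = card E" "span F = span E" "0 \<notin> F"
    "\<And>x y. x \<in> F \<Longrightarrow> y \<in> F \<Longrightarrow> x \<noteq> y \<Longrightarrow> B x y = 0"
    using insert.IH[OF ind(1)] by blast
  have pos: "B f f \<noteq> 0" if "f \<in> F" for f
    using B_self_pos[of f] F(5) that by (metis less_irrefl)
  define s where "s = (\<Sum>f\<in>F. scl (B e f / B f f) f)"
  have s: "s \<in> span F" unfolding s_def by (intro span_sum span_scale span_base)
  obtain k where k: "k > 0" "scl (of_nat k) (e - s) \<in> L" using multiple_in_L by blast
  define b where "b = scl (of_nat k) (e - s)"
  have e: "e = scl (1 / of_nat k) b + s" using k(1) by (simp add: b_def)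
  have orth: "B b c = 0" if c: "c \<in> F" for c
  proof -
    have "B s c = (\<Sum>f\<in>F. if f = c then B e c else 0)"
      unfolding s_def B_sum_left B_scl_left
    proof (intro sum.cong refl)
      fix f assume f: "f \<in> F"
      show "B e f / B f f * B f c = (if f = c then B e c else 0)"
        using F(6)[OF f c] pos[OF f] by auto
    qed
    then show ?thesis using c F(1) by (simp add: b_def B_scl_left B_diff_left)
  qed
  have b0: "b \<noteq> 0"
  proof
    assume "b = 0"
    then have "e = s" using e by simp
    then show False using s ind(2) F(4) by simp
  qed
  have bF: "b \<notin> F" using orth[of b] B_self_pos[OF b0] by fastforce
  have "span (insert b F) = span (insert e E)"
  proof (subst span_eq, intro conjI)
    have sub: "span E \<subseteq> span (insert e E)" "span F \<subseteq> span (insert b F)" by (intro span_mono; blast)+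
    have "F \<subseteq> span (insert e E)" using F(4) sub(1) span_superset[of F] by blast
    moreover have "s \<in> span (insert e E)" using s sub(1) F(4) by blast
    then have "b \<in> span (insert e E)" unfolding b_def by (intro span_scale span_diff[OF span_base[OF insertI1]])
    ultimately show "insert b F \<subseteq> span (insert e E)" by simp
    have "E \<subseteq> span (insert b F)" using F(4) sub(2) span_superset[of E] by blast
    moreover have "s \<in> span (insert b F)" using s sub(2) by blast
    then have "e \<in> span (insert b F)" by (subst e, intro span_add span_scale) (simp_all add: span_base)
    ultimately show "insert e E \<subseteq> span (insert b F)" by simp
  qed
  moreover have "B x y = 0" if "x \<in> insert b F" "y \<in> insert b F" "x \<noteq> y" for x y
  proof (cases "x = b")
    case True
    then show ?thesis using that orth[of y] by simp
  next
    case False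
    then show ?thesis using that orth[of x] F(6)[of x y] symmetric[of x b] by (cases "y = b") simp_all
  qed
  ultimately show ?case
    using F b0 bF k(2) insert.hyps by (intro exI[of _ "insert b F"]) (auto simp: b_def)
qed

lemma orthogonal_basis:
  obtains F where "finite F" "F \<subseteq> L" "card F = dim L" "span F = UNIV" "0 \<notin> F"
    "\<forall>x\<in>F. \<forall>y\<in>F. x \<noteq> y \<longrightarrow> B x y = 0"
proof -
  obtain E where E: "finite E" "independent E" "span E = UNIV" "card E = dim L" by (rule basis)
  obtain F where "finite F" "F \<subseteq> L" "card F = card E" "span F = span E" "0 \<notin> F"
    "\<forall>x\<in>F. \<forall>y\<in>F. x \<noteq> y \<longrightarrow> B x y = 0" using gram_schmidt[OF E(1,2)] by blast
  with E that show thesis by simp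
qed

lemma dual_dual:
  assumes x: "\<And>y. y \<in> dual \<Longrightarrow> B x y \<in> \<int>"
  shows "x \<in> L"
proof -
  obtain E where E: "finite E" "independent E" "span E = UNIV" "L = int_span E" by (rule basis)
  obtain F where "finite F" "span F = UNIV" "0 \<notin> F"
    "\<forall>x\<in>F. \<forall>y\<in>F. x \<noteq> y \<longrightarrow> B x y = 0" by (rule orthogonal_basis)
  then have F: "finite F" "span F = UNIV" "0 \<notin> F"
    "\<And>x y. x \<in> F \<Longrightarrow> y \<in> F \<Longrightarrow> x \<noteq> y \<Longrightarrow> B x y = 0" by simp_all
  let ?r = "representation E"
  \<comment> \<open>\<open>c e\<close> represents the coordinate functional of \<open>e\<close>, so
    these vectors are the basis dual to \<open>E\<close>. Pairing \<open>x\<close> with them reads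
    off its coordinates, which are therefore integers.\<close>
  define c where "c e = (\<Sum>b\<in>F. scl (?r b e / B b b) b)" for e
  have Bc: "B y (c e) = ?r y e" for y e
  proof -
    have "?r y e = ?r (\<Sum>b\<in>F. scl (B y b / B b b) b) e"
      by (subst orthogonal_expansion[OF F, of y]) auto
    also have "\<dots> = (\<Sum>b\<in>F. B y b / B b b * ?r b e)"
      using E by (subst representation_sum) (simp_all add: representation_scale)
    also have "\<dots> = B y (c e)" by (simp add: c_def B_sum_right B_scl_right mult.commute)
    finally show ?thesis by simp
  qed
  have "c e \<in> dual" if e: "e \<in> E" for e
    unfolding dual_lattice_def
  proof (intro CollectI ballI)
    fix y assume "y \<in> L"
    then obtain k where k: "y = (\<Sum>e\<in>E. scl (of_int (k e)) e)" using E(4) by (blast elim: int_spanE)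
    have "?r y e = (\<Sum>f\<in>E. of_int (k f) * (if f = e then 1 else 0))"
      unfolding k using E by (subst representation_sum)
        (auto intro!: sum.cong simp: representation_scale representation_basis)
    also have "\<dots> = of_int (k e)" using E(1) e by (simp add: if_distrib cong: if_cong)
    finally show "B (c e) y \<in> \<int>" using Bc[of y e] by (simp add: symmetric[of "c e"])
  qed
  then have r: "?r x e \<in> \<int>" if "e \<in> E" for e
    using x[of "c e"] that unfolding Bc by blast
  define j where "j e = \<lfloor>?r x e\<rfloor>" for e
  have j: "?r x e = of_int (j e)" if "e \<in> E" for e
    using r[OF that] by (auto simp: j_def elim!: Ints_cases)
  have "x = (\<Sum>e\<in>E. scl (?r x e) e)" using sum_representation_eq[OF E(2) _ E(1) subset_refl, of x] E(3) by simp
  also have "\<dots> = (\<Sum>e\<in>E. scl (of_int (j e)) e)" using j by simp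
  finally show "x \<in> L" unfolding E(4) by (rule int_spanI)
qed

text \<open>The lattice \<open>int_span G\<close> is the dual of an orthogonal sublattice of \<open>L\<close>.\<close>

lemma orthogonal_overlattice:
  obtains G where "finite G" "card G = dim L" "dual \<subseteq> int_span G" "overlattice (int_span G)"
    "\<forall>x\<in>G. \<forall>y\<in>G. x \<noteq> y \<longrightarrow> B x y = 0"
    "\<forall>x\<in>G. \<exists>q>0. Q x = 1 / of_nat (4 * q)"
proof -
  obtain F where "finite F" "F \<subseteq> L" "card F = dim L" "span F = UNIV" "0 \<notin> F"
    "\<forall>x\<in>F. \<forall>y\<in>F. x \<noteq> y \<longrightarrow> B x y = 0" by (rule orthogonal_basis)
  then have F: "finite F" "F \<subseteq> L" "card F = dim L" "span F = UNIV" "0 \<notin> F"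
    "\<And>x y. x \<in> F \<Longrightarrow> y \<in> F \<Longrightarrow> x \<noteq> y \<Longrightarrow> B x y = 0" by simp_all
  have pos: "B b b > 0" if "b \<in> F" for b using B_self_pos F(5) that by metis
  \<comment> \<open>The basis dual to \<open>F\<close>. If \<open>B b b = 2 * q\<close> then
    \<open>Q (g b) = 1 / (4 * q)\<close>, the form for which \<open>gauss_sum_phase\<close> gives
    the one-dimensional phase.\<close>
  define g where "g b = scl (1 / B b b) b" for b
  have Bg: "B (g b) c = (if b = c then 1 else 0)" if "b \<in> F" "c \<in> F" for b c
    using that F(6)[OF that] pos[OF that(1)] by (auto simp: g_def B_scl_left)
  have inj: "inj_on g F"
  proof (rule inj_onI)
    fix b c assume "b \<in> F" "c \<in> F" "g b = g c"
    then show "b = c" using Bg[of b b] Bg[of c b] by (cases "b = c") simp_all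
  qed
  have q: "\<exists>q>0. B b b = of_nat (2 * q)" if b: "b \<in> F" for b
  proof -
    have "Q b \<in> \<int>" using even F(2) b by blast
    then obtain j where j: "Q b = of_int j" by (elim Ints_cases)
    have "b \<noteq> 0" using F(5) b by metis
    then have "j > 0" using Q_pos[of b] j by simp
    then show ?thesis using j by (intro exI[of _ "nat j"]) (simp add: qform_def)
  qed
  have Gdual: "dual \<subseteq> int_span (g ` F)"
  proof
    fix x assume x: "x \<in> dual"
    define j where "j b = \<lfloor>B x b\<rfloor>" for b
    have j: "B x b = of_int (j b)" if "b \<in> F" for b
    proof -
      have "B x b \<in> \<int>" using B_dual(1)[OF x] F(2) that by blast
      then show ?thesis by (auto simp: j_def elim!: Ints_cases)
    qed
    have "x = (\<Sum>b\<in>F. scl (B x b / B b b) b)" by (rule orthogonal_expansion) (use F in auto)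
    also have "\<dots> = (\<Sum>b\<in>F. scl (of_int (j (the_inv_into F g (g b)))) (g b))"
    proof (intro sum.cong refl)
      fix b assume b: "b \<in> F"
      show "scl (B x b / B b b) b = scl (of_int (j (the_inv_into F g (g b)))) (g b)"
        unfolding the_inv_into_f_f[OF inj b] j[OF b, symmetric] by (simp add: g_def)
    qed
    also have "\<dots> = (\<Sum>y\<in>g ` F. scl (of_int (j (the_inv_into F g y))) y)"
      by (subst sum.reindex[OF inj]) simp
    finally show "x \<in> int_span (g ` F)" by (rule int_spanI)
  qed
  have "\<exists>d>0. \<forall>x\<in>int_span (g ` F). scl (of_nat d) x \<in> L"
  proof -
    define q' where "q' b = (SOME q. q > 0 \<and> B b b = of_nat (2 * q))" for b
    have q: "q' b > 0 \<and> B b b = of_nat (2 * q' b)" if "b \<in> F" for b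
      unfolding q'_def using q[OF that] by (rule someI_ex)
    let ?d = "\<Prod>b\<in>F. 2 * q' b"
    have "scl (of_nat ?d) (g b) \<in> L" if b: "b \<in> F" for b
    proof -
      have "?d = 2 * q' b * (\<Prod>b\<in>F - {b}. 2 * q' b)" using F(1) b by (simp add: prod.remove)
      then have "scl (of_nat ?d) (g b) = scl (of_nat (\<Prod>b\<in>F - {b}. 2 * q' b)) b"
        using q[OF b] by (simp only: g_def scale_scale) simp
      moreover have "b \<in> L" using F(2) b by blast
      ultimately show ?thesis using scl_nat_subgroup[OF L_subgroup] by metis
    qed
    then have gd: "scl (of_nat ?d) y \<in> L" if "y \<in> g ` F" for y using that by blast
    have "scl (of_nat ?d) x \<in> L" if x: "x \<in> int_span (g ` F)" for x
    proof -
      obtain k where k: "x = (\<Sum>y\<in>g ` F. scl (of_int (k y)) y)" using x by (elim int_spanE)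
      have "scl (of_nat ?d) x = (\<Sum>y\<in>g ` F. scl (of_int (k y)) (scl (of_nat ?d) y))"
        unfolding k scale_sum_right by (simp only: scale_left_commute)
      also have "\<dots> \<in> L" using gd scl_int_subgroup[OF L_subgroup] by (intro add_subgroup_sum[OF L_subgroup]) blast
      finally show ?thesis .
    qed
    moreover have "?d > 0" using q by (intro prod_pos) auto
    ultimately show ?thesis by blast
  qed
  then have over: "overlattice (int_span (g ` F))"
    unfolding overlattice_def using int_span_subgroup L_subset_dual Gdual by blast
  have orth: "B x y = 0" if xy: "x \<in> g ` F" "y \<in> g ` F" "x \<noteq> y" for x y
  proof -
    obtain b c where "b \<in> F" "c \<in> F" "x = g b" "y = g c" using xy by blast
    then show ?thesis using F(6)[of b c] xy(3) by (cases "b = c") (simp_all add: g_def B_scl_left B_scl_right)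
  qed
  have "\<exists>q>0. Q x = 1 / of_nat (4 * q)" if x: "x \<in> g ` F" for x
  proof -
    obtain b where b: "b \<in> F" "x = g b" using x by blast
    obtain q where "q > 0" "B b b = of_nat (2 * q)" using q[OF b(1)] by blast
    then show ?thesis unfolding b(2) g_def Q_scl
      by (intro exI[of _ q]) (simp add: qform_def power2_eq_square field_simps)
  qed
  then have Qq: "\<forall>x\<in>g ` F. \<exists>q>0. Q x = 1 / of_nat (4 * q)" by blast
  have orth': "\<forall>x\<in>g ` F. \<forall>y\<in>g ` F. x \<noteq> y \<longrightarrow> B x y = 0" using orth by blast
  have "finite (g ` F)" "card (g ` F) = dim L" using F(1,3) card_image[OF inj] by simp_all
  from that[OF this Gdual over orth' Qq] show thesis .
qed

lemma overlattice_subset: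
  "overlattice A \<Longrightarrow> add_subgroup C \<Longrightarrow> L \<subseteq> C \<Longrightarrow> C \<subseteq> A \<Longrightarrow> overlattice C"
  unfolding overlattice_def by (meson subsetD)

lemma overlattice_dual: "overlattice dual"
proof -
  obtain G where G: "dual \<subseteq> int_span G" "overlattice (int_span G)" by (rule orthogonal_overlattice)
  show ?thesis by (rule overlattice_subset[OF G(2) dual_subgroup L_subset_dual G(1)])
qed

end

section \<open>Gauss sums of orthogonal lattices and Milgram's formula\<close>

lemma mean_er_multiples:
  assumes q: "q > 0"
  shows "periodic_on UNIV (\<lambda>k :: int. er (of_int k ^ 2 / of_nat (4 * q)))"
    "\<exists>r>0. mean UNIV (\<lambda>k :: int. er (of_int k ^ 2 / of_nat (4 * q))) = of_real r * er (1 / 8)"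
proof -
  let ?f = "\<lambda>k :: int. er (of_int k ^ 2 / of_nat (4 * q))"
  \<comment> \<open>Period \<open>2 * q\<close> and not \<open>4 * q\<close>:
    \<open>(k + 2 q j)\<^sup>2 - k\<^sup>2 = 4 q (k j + q j\<^sup>2)\<close>. This is the length of
    the sum in \<open>gauss_sum_phase\<close>.\<close>
  let ?H = "{k :: int. int (2 * q) dvd k}"
  have H: "add_subgroup ?H" by (auto simp: add_subgroup_def)
  have tr: "transversal ?H UNIV {0..<int (2 * q)}"
    unfolding transversal_def
  proof (intro conjI ballI)
    fix x :: int
    show "\<exists>!t. t \<in> {0..<int (2 * q)} \<and> x - t \<in> ?H"
    proof (intro ex1I conjI)
      show "x mod int (2 * q) \<in> {0..<int (2 * q)}" using q by simp
      show "x - x mod int (2 * q) \<in> ?H" by (simp add: minus_mod_eq_mult_div)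
      fix t assume "t \<in> {0..<int (2 * q)} \<and> x - t \<in> ?H"
      then have t: "t \<in> {0..<int (2 * q)}" "x mod int (2 * q) = t mod int (2 * q)"
        by (simp_all only: mod_eq_dvd_iff mem_Collect_eq)
      then show "t = x mod int (2 * q)" by simp
    qed
  qed simp_all
  have fi: "finite_index ?H UNIV" by (rule finite_index_transversalI[OF H add_subgroup_UNIV _ tr]) simp
  have "?f (k + h) = ?f k" if "h \<in> ?H" for k h
  proof -
    have "2 * int q dvd h" using that by simp
    then obtain j where h: "h = 2 * int q * j" by (rule dvdE)
    have "of_int (k + h) ^ 2 / of_nat (4 * q) - of_int k ^ 2 / of_nat (4 * q) = (of_int (k * j + int q * j\<^sup>2) :: rat)"
      using q unfolding h by (simp add: field_simps power2_eq_square)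
    then show ?thesis by (intro er_cong) simp
  qed
  then have per: "periodic_mod ?H UNIV ?f" using fi by (simp add: periodic_mod_def)
  then show "periodic_on UNIV ?f" by (auto simp: periodic_on_def)
  have "sum ?f {0..<int (2 * q)} = (\<Sum>k<2 * q. er (of_nat k ^ 2 / of_nat (4 * q)))"
    by (rule sum.reindex_bij_witness[of _ int nat]) auto
  moreover obtain r where "r > 0" "(\<Sum>k<2*q. er (of_nat k ^ 2 / of_nat (4 * q))) = of_real r * er (1 / 8)"
    using gauss_sum_phase[OF q] by blast
  ultimately have "mean UNIV ?f = of_real (r / of_nat (2 * q)) * er (1 / 8)" "r / of_nat (2 * q) > 0"
    using mean_transversal[OF per tr] q by simp_all
  then show "\<exists>r>0. mean UNIV ?f = of_real r * er (1 / 8)" by blast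
qed

context pos_def_even_lattice
begin

text \<open>The Gauss sum of an orthogonal sum is a product. Each basis vector is adjoined through
  the map \<open>(x, k) \<mapsto> x + k g\<close> and contributes a positive factor and the phase
  \<open>er (1 / 8)\<close>.\<close>

lemma mean_orthogonal:
  assumes G: "finite G" "overlattice (int_span G)"
    "\<And>x y. x \<in> G \<Longrightarrow> y \<in> G \<Longrightarrow> x \<noteq> y \<Longrightarrow> B x y = 0"
    "\<And>x. x \<in> G \<Longrightarrow> \<exists>q>0. Q x = 1 / of_nat (4 * q)"
  shows "\<exists>r>0. mean (int_span G) (\<lambda>x. er (Q x)) = of_real r * er (of_nat (card G) / 8)"
proof -
  have perG: "periodic_on (int_span G) (\<lambda>x. er (Q x))"
    using periodic_on_er[OF G(2), of 1 0] by (simp add: B_zero)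
  have sub: "int_span S \<subseteq> int_span G" if "S \<subseteq> G" for S
  proof
    fix x assume "x \<in> int_span S"
    then obtain k where k: "x = (\<Sum>e\<in>S. scl (of_int (k e)) e)" by (elim int_spanE)
    show "x \<in> int_span G" unfolding k
    proof (rule add_subgroup_sum[OF int_span_subgroup])
      fix e assume "e \<in> S"
      then have "e \<in> int_span G" using that int_span_base[OF G(1)] by blast
      then show "scl (of_int (k e)) e \<in> int_span G" by (rule scl_int_subgroup[OF int_span_subgroup])
    qed
  qed
  have per: "periodic_on (int_span S) (\<lambda>x. er (Q x))" if "S \<subseteq> G" for S
    using periodic_on_subgroup[OF perG int_span_subgroup sub[OF that], of 0]
      add_subgroup_zero[OF int_span_subgroup] by simp
  have "\<exists>r>0. mean (int_span S) (\<lambda>x. er (Q x)) = of_real r * er (of_nat (card S) / 8)" if "finite S" "S \<subseteq> G" for S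
    using that
  proof (induction S rule: finite_induct)
    case empty
    have "int_span {} = {0}" by (auto simp: int_span_def)
    then have "mean (int_span {}) (\<lambda>x. er (Q x)) = mean (int_span {}) (\<lambda>x. 1)"
      by (intro mean_cong[OF per]) (simp_all add: Q_zero)
    then show ?case using mean_const[OF int_span_subgroup] by (intro exI[of _ 1]) simp
  next
    case (insert g S)
    let ?A = "int_span S" and ?C = "int_span (insert g S)"
    let ?\<phi> = "\<lambda>(x, k :: int). x + scl (of_int k) g"
    obtain r where r: "r > 0" "mean ?A (\<lambda>x. er (Q x)) = of_real r * er (of_nat (card S) / 8)"
      using insert by blast
    obtain q where q: "q > 0" "Q g = 1 / of_nat (4 * q)" using G(4) insert.prems by blast
    have Qg: "Q (scl (of_int k) g) = of_int k ^ 2 / of_nat (4 * q)" for k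
      unfolding Q_scl q(2) by simp
    obtain t where t: "t > 0" "mean UNIV (\<lambda>k :: int. er (Q (scl (of_int k) g))) = of_real t * er (1 / 8)"
      using mean_er_multiples(2)[OF q(1)] unfolding Qg by blast
    have perg: "periodic_on UNIV (\<lambda>k :: int. er (Q (scl (of_int k) g)))"
      using mean_er_multiples(1)[OF q(1)] unfolding Qg .
    have sg: "add_subgroup (?A \<times> (UNIV :: int set))"
      by (intro add_subgroup_Times int_span_subgroup add_subgroup_UNIV)
    have add: "?\<phi> (x + y) = ?\<phi> x + ?\<phi> y" for x y
      by (cases x; cases y) (simp add: scale_left_distrib algebra_simps)
    have img: "?\<phi> ` (?A \<times> UNIV) = ?C"
    proof (intro equalityI subsetI)
      fix z assume "z \<in> ?\<phi> ` (?A \<times> UNIV)"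
      then obtain x k where z: "z = x + scl (of_int k) g" "x \<in> ?A" by auto
      then obtain l where "x = (\<Sum>e\<in>S. scl (of_int (l e)) e)" by (elim int_spanE)
      then have "z = (\<Sum>e\<in>insert g S. scl (of_int ((l(g := k)) e)) e)"
        using z(1) insert.hyps by (subst sum.insert) (auto simp: add.commute intro!: sum.cong)
      then show "z \<in> ?C" by (rule int_spanI)
    next
      fix z assume "z \<in> ?C"
      then obtain l where "z = (\<Sum>e\<in>insert g S. scl (of_int (l e)) e)" by (elim int_spanE)
      then have "z = ?\<phi> ((\<Sum>e\<in>S. scl (of_int (l e)) e), l g)"
        using insert.hyps by (simp add: add.commute)
      moreover have "(\<Sum>e\<in>S. scl (of_int (l e)) e) \<in> ?A" by (rule int_spanI) simp
      ultimately show "z \<in> ?\<phi> ` (?A \<times> UNIV)" by blast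
    qed
    note re = mean_reindex_surj[OF sg add img per[OF insert.prems]]
    have er: "er (Q (?\<phi> z)) = (\<lambda>(x, k). er (Q x) * er (Q (scl (of_int k) g))) z" if z: "z \<in> ?A \<times> UNIV" for z
    proof -
      obtain x k where xk: "z = (x, k)" "x \<in> ?A" using z by blast
      then obtain l where "x = (\<Sum>e\<in>S. scl (of_int (l e)) e)" by (elim int_spanE)
      then have "B x g = (\<Sum>e\<in>S. of_int (l e) * B e g)" by (simp add: B_sum_left B_scl_left)
      also have "\<dots> = 0" using insert G(3) by (intro sum.neutral) auto
      finally show ?thesis unfolding xk by (simp add: Q_add B_scl_right er_add)
    qed
    obtain H K where HK: "periodic_mod H ?A (\<lambda>x. er (Q x))"
      "periodic_mod K UNIV (\<lambda>k :: int. er (Q (scl (of_int k) g)))"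
      using per[of S] perg insert.prems unfolding periodic_on_def by blast
    have "mean ?C (\<lambda>x. er (Q x)) = mean (?A \<times> UNIV) (\<lambda>z. er (Q (?\<phi> z)))" using re(2) by simp
    also have "\<dots> = mean (?A \<times> UNIV) (\<lambda>(x, k). er (Q x) * er (Q (scl (of_int k) g)))"
      by (rule mean_cong[OF re(1) er])
    also have "\<dots> = of_real (r * t) * (er (of_nat (card S) / 8) * er (1 / 8))"
      unfolding mean_Times[OF HK] r(2) t(2) by simp
    also have "er (of_nat (card S) / 8) * er (1 / 8) = er (of_nat (card (insert g S)) / 8)"
      using insert.hyps by (simp add: er_add[symmetric] add_divide_distrib add.commute)
    finally show ?case using r(1) t(1) by (intro exI[of _ "r * t"]) simp
  qed
  from this[OF G(1) subset_refl] show ?thesis .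
qed

abbreviation disc :: nat where "disc \<equiv> index L dual"

lemma disc_pos: "disc > 0"
  by (rule index_pos[OF overlattice_finite_index_L[OF overlattice_dual]])

lemma periodic_er_Q_dual: "periodic_mod L dual (\<lambda>x. er (Q x))"
  unfolding periodic_mod_def
proof (intro conjI ballI overlattice_finite_index_L[OF overlattice_dual])
  fix x h assume "x \<in> dual" "h \<in> L"
  then show "er (Q (x + h)) = er (Q x)"
    using B_dual(1) even by (intro er_cong) (simp add: Q_add)
qed

lemma periodic_er_B_dual: "z \<in> dual \<Longrightarrow> periodic_mod L dual (\<lambda>x. er (B x z))"
  unfolding periodic_mod_def
proof (intro conjI ballI overlattice_finite_index_L[OF overlattice_dual])
  fix x h assume "x \<in> dual" "h \<in> L" "z \<in> dual"
  then show "er (B (x + h) z) = er (B x z)"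
    using B_dual(2) by (intro er_cong) (simp add: B_add_left)
qed

lemma mean_dual_character:
  assumes z: "z \<in> dual"
  shows "mean dual (\<lambda>x. er (B x z)) = (if z \<in> L then 1 else 0)"
proof -
  have "(\<forall>x\<in>dual. er (B x z) = 1) \<longleftrightarrow> z \<in> L"
    using dual_dual[of z] B_dual(1) unfolding er_eq_1_iff by (auto simp: symmetric[of z])
  moreover have "periodic_on dual (\<lambda>x. er (B x z))"
    using periodic_er_B_dual[OF z] unfolding periodic_on_def by blast
  ultimately show ?thesis
    using mean_character[OF _ dual_subgroup, of "\<lambda>x. er (B x z)"] by (simp add: B_add_left er_add)
qed

text \<open>The hypothesis says that \<open>t\<close> acts injectively on \<open>dual / L\<close>.
  In the double average for the squared modulus the shift \<open>x \<mapsto> x + y\<close> leaves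
  \<open>t * Q x + t * B x y\<close>; the average over \<open>y\<close> then forces
  \<open>t x \<in> L\<close>, hence \<open>x \<in> L\<close>, where the remaining summand is
  1.\<close>

lemma norm_mean_dual:
  assumes t: "\<And>u. u \<in> dual \<Longrightarrow> scl (of_nat t) u \<in> L \<Longrightarrow> u \<in> L"
  shows "mean dual (\<lambda>x. er (of_nat t * Q x)) * cnj (mean dual (\<lambda>x. er (of_nat t * Q x))) = 1 / of_nat disc"
proof -
  let ?f = "\<lambda>x. er (of_nat t * Q x)"
  have perm: "periodic_mod L dual ?f"
    using periodic_er_Q_dual unfolding periodic_mod_def er_power[symmetric] by simp
  then have per: "periodic_on dual ?f" unfolding periodic_on_def by blast
  have perc: "periodic_on dual (\<lambda>y. cnj (?f y))" by (rule periodic_on_compose[OF per])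
  have tB: "of_nat t * B x y = B x (scl (of_nat t) y)" "of_nat t * B x y = B y (scl (of_nat t) x)" for x y
    by (simp_all add: B_scl_right symmetric[of x])
  note td = scl_nat_subgroup[OF dual_subgroup, of _ t]
  have per2: "periodic_mod L dual (\<lambda>x. er (of_nat t * Q x + of_nat t * B x y))" if y: "y \<in> dual" for y
    using perm periodic_er_B_dual[OF td[OF y]] unfolding periodic_mod_def er_add tB(1) by simp
  have per3: "periodic_mod L dual (\<lambda>y. er (of_nat t * Q x + of_nat t * B x y))" if x: "x \<in> dual" for x
    using periodic_er_B_dual[OF td[OF x]] unfolding periodic_mod_def er_add tB(2) by simp
  have z: "0 \<in> dual" by (rule add_subgroup_zero[OF dual_subgroup])
  note sw = mean_swap[OF z z per2 per3]
  have "mean dual ?f * cnj (mean dual ?f) = mean dual (\<lambda>y. mean dual ?f * cnj (?f y))"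
    using mean_mult_left[OF perc] mean_cnj[OF per] by simp
  also have "\<dots> = mean dual (\<lambda>y. mean dual (\<lambda>x. er (of_nat t * Q x + of_nat t * B x y)))"
  proof (rule mean_cong)
    show "periodic_on dual (\<lambda>y. mean dual ?f * cnj (?f y))" by (rule periodic_on_compose[OF per])
    fix y assume y: "y \<in> dual"
    have "mean dual ?f * cnj (?f y) = cnj (?f y) * mean dual (\<lambda>x. ?f (x + y))"
      using mean_shift(2)[OF per y] by simp
    also have "\<dots> = mean dual (\<lambda>x. cnj (?f y) * ?f (x + y))"
      using mean_mult_left[OF mean_shift(1)[OF per y]] by simp
    also have "\<dots> = mean dual (\<lambda>x. er (of_nat t * Q x + of_nat t * B x y))"
      by (intro mean_cong periodic_on_compose[OF mean_shift(1)[OF per y]])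
        (simp add: er_cnj er_add[symmetric] Q_add distrib_left)
    finally show "mean dual ?f * cnj (?f y) = mean dual (\<lambda>x. er (of_nat t * Q x + of_nat t * B x y))" .
  qed
  also have "\<dots> = mean dual (\<lambda>x. mean dual (\<lambda>y. er (of_nat t * Q x + of_nat t * B x y)))" using sw(1) by simp
  also have "\<dots> = mean dual (\<lambda>x. if x \<in> L then 1 else 0)"
  proof (rule mean_cong)
    show "periodic_on dual (\<lambda>x. mean dual (\<lambda>y. er (of_nat t * Q x + of_nat t * B x y)))"
      using sw(2) unfolding periodic_on_def by blast
    fix x assume x: "x \<in> dual"
    have "periodic_on dual (\<lambda>y. er (B y (scl (of_nat t) x)))"
      using periodic_er_B_dual[OF td[OF x]] unfolding periodic_on_def by blast
    then have "mean dual (\<lambda>y. er (of_nat t * Q x + of_nat t * B x y))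
        = er (of_nat t * Q x) * mean dual (\<lambda>y. er (B y (scl (of_nat t) x)))"
      unfolding er_add tB(2) by (rule mean_mult_left)
    moreover have "scl (of_nat t) x \<in> L \<longleftrightarrow> x \<in> L"
      using t[OF x] scl_nat_subgroup[OF L_subgroup, of x t] by blast
    ultimately show "mean dual (\<lambda>y. er (of_nat t * Q x + of_nat t * B x y)) = (if x \<in> L then 1 else 0)"
      using mean_dual_character[OF td[OF x]] even by simp
  qed
  also have "\<dots> = 1 / of_nat disc"
    using mean_restrict(2)[OF periodic_on_const[OF dual_subgroup] overlattice_finite_index_L[OF overlattice_dual], of 1]
      mean_const[OF L_subgroup, of 1] by simp
  finally show ?thesis .
qed

text \<open>Milgram's formula, by comparison with the dual of an orthogonal sublattice: averaging first over
  cosets of \<open>L\<close> kills everything outside \<open>dual\<close>. This determines the phase.\<close>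

theorem milgram: "mean dual (\<lambda>x. er (Q x)) = er (of_nat (dim L) / 8) / of_real (sqrt (real disc))"
proof -
  obtain G where "finite G" "card G = dim L" "dual \<subseteq> int_span G" "overlattice (int_span G)"
    "\<forall>x\<in>G. \<forall>y\<in>G. x \<noteq> y \<longrightarrow> B x y = 0"
    "\<forall>x\<in>G. \<exists>q>0. Q x = 1 / of_nat (4 * q)" by (rule orthogonal_overlattice)
  then have G: "finite G" "card G = dim L" "dual \<subseteq> int_span G" "overlattice (int_span G)"
    "\<And>x y. x \<in> G \<Longrightarrow> y \<in> G \<Longrightarrow> x \<noteq> y \<Longrightarrow> B x y = 0"
    "\<And>x. x \<in> G \<Longrightarrow> \<exists>q>0. Q x = 1 / of_nat (4 * q)" by simp_all
  let ?P = "int_span G" and ?f = "\<lambda>x. er (Q x)"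
  obtain r where r: "r > 0" "mean ?P ?f = of_real r * er (of_nat (dim L) / 8)"
    using mean_orthogonal[OF G(1,4,5,6)] G(2) by auto
  have fi: "finite_index dual ?P"
    using finite_index_mono(2)[OF overlattice_finite_index_L[OF G(4)] L_subset_dual G(3) dual_subgroup] .
  have per: "periodic_on ?P ?f" using periodic_on_er[OF G(4), of 1 0] by (simp add: B_zero)
  have LP: "L \<subseteq> ?P" using L_subset_dual G(3) by blast
  have "mean ?P ?f = mean ?P (\<lambda>x. mean L (\<lambda>h. ?f (x + h)))"
    using mean_tower[OF per L_subgroup LP] by simp
  also have "\<dots> = mean ?P (\<lambda>x. if x \<in> dual then ?f x else 0)"
  proof (rule mean_cong[OF periodic_on_mean[OF per L_subgroup LP]])
    fix x assume x: "x \<in> ?P"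
    have perB: "periodic_on L (\<lambda>h. er (B h x))" using periodic_on_er[OF overlattice_L, of 0 x] by simp
    have "mean L (\<lambda>h. ?f (x + h)) = mean L (\<lambda>h. ?f x * er (B h x))"
    proof (rule mean_cong[OF periodic_on_subgroup[OF per L_subgroup LP x]])
      fix h assume "h \<in> L"
      then show "?f (x + h) = ?f x * er (B h x)" using even by (simp add: Q_add er_add symmetric[of x])
    qed
    also have "\<dots> = ?f x * mean L (\<lambda>h. er (B h x))" by (rule mean_mult_left[OF perB])
    also have "mean L (\<lambda>h. er (B h x)) = (if \<forall>h\<in>L. er (B h x) = 1 then 1 else 0)"
      by (rule mean_character[OF perB L_subgroup]) (simp add: B_add_left er_add)
    also have "(\<forall>h\<in>L. er (B h x) = 1) \<longleftrightarrow> x \<in> dual"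
      unfolding er_eq_1_iff by (simp add: dual_lattice_def symmetric[of x])
    finally show "mean L (\<lambda>h. ?f (x + h)) = (if x \<in> dual then ?f x else 0)" by simp
  qed
  also have "\<dots> = mean dual ?f / of_nat (index dual ?P)" by (rule mean_restrict(2)[OF per fi])
  finally have "mean dual ?f = of_real (r * index dual ?P) * er (of_nat (dim L) / 8)"
    using r(2) index_pos[OF fi] by (simp add: field_simps)
  moreover define t where "t = r * index dual ?P"
  ultimately have t: "mean dual ?f = of_real t * er (of_nat (dim L) / 8)" "t > 0"
    using r(1) index_pos[OF fi] by simp_all
  \<comment> \<open>The phase is settled; the positive factor \<open>t\<close> follows from the
    squared modulus.\<close>
  let ?e = "er (of_nat (dim L) / 8)"
  have "?e * cnj ?e = 1" by (simp add: er_cnj er_add[symmetric])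
  then have "complex_of_real (t * t) = (of_real t * ?e) * cnj (of_real t * ?e)"
    by (simp add: mult.assoc mult.left_commute)
  then have "complex_of_real (t * t) = of_real (1 / real disc)"
    unfolding t(1)[symmetric] using norm_mean_dual[of 1] by simp
  then have "t * t = 1 / real disc" by (simp only: of_real_eq_iff)
  then have "sqrt (1 / real disc) = t"
    using t(2) by (intro real_sqrt_unique) (simp_all add: power2_eq_square)
  then have "t = 1 / sqrt (real disc)" by (simp add: real_sqrt_divide)
  then show ?thesis unfolding t(1) by simp
qed

end

context Z_lattice
begin

lemma dim_L: "dim L = dim UNIV"
proof -
  obtain E where E: "independent E" "span E = UNIV" "card E = dim L" by (rule basis)
  then show ?thesis using dim_eq_card[of E UNIV] by simp
qed

lemma lcoset_scl: "r \<noteq> 0 \<Longrightarrow> lcoset (scl r ` H) (scl r x) = scl r ` lcoset H x"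
  unfolding lcoset_def by (simp add: image_image scale_right_distrib)

lemma
  assumes r: "r \<noteq> 0" and fi: "finite_index H A"
  shows finite_index_scl: "finite_index (scl r ` H) (scl r ` A)"
    and index_scl: "index (scl r ` H) (scl r ` A) = index H A"
proof -
  have e: "lcoset (scl r ` H) ` scl r ` A = (`) (scl r) ` lcoset H ` A"
    by (simp add: image_image lcoset_scl[OF r])
  have inj: "inj (scl r)" using r by (intro injI) simp
  show "finite_index (scl r ` H) (scl r ` A)"
    using fi scl_image_subgroup e by (auto simp: finite_index_def)
  show "index (scl r ` H) (scl r ` A) = index H A"
    unfolding index_def e by (rule card_image) (simp add: inj_on_def inj_image_eq_iff[OF inj])
qed

end

context pos_def_even_lattice
begin

section \<open>Rescaled lattices\<close>

text \<open>The form of this lattice is \<open>Q / m\<close> on the same space, its dual is again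
  \<open>dual\<close>, and its discriminant is \<open>m ^ dim L\<close> times the old one. Results
  about averages of \<open>Q\<close> over \<open>dual\<close> therefore transfer to
  \<open>Q / m\<close>.\<close>

lemma rescaled:
  assumes m: "m > 0"
  shows "pos_def_even_lattice scl (multiples m) (\<lambda>x y. B x y / of_nat m)"
proof (intro pos_def_even_lattice.intro Z_lattice.intro vector_space_axioms Z_lattice_axioms.intro
    pos_def_even_lattice_axioms.intro)
  have m0: "of_nat m \<noteq> (0 :: rat)" using m by simp
  obtain E where E: "finite E" "independent E" "span E = UNIV" "card E = dim L" "L = int_span E"
    by (rule basis)
  let ?s = "scl (of_nat m)"
  have inj: "inj_on ?s E" using m0 by (intro inj_onI) simp
  have img: "multiples m = range (\<lambda>k :: 'v \<Rightarrow> int. \<Sum>x\<in>?s ` E. scl (of_int (k x)) x)" (is "_ = range ?f")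
  proof (intro equalityI subsetI)
    fix x assume "x \<in> multiples m"
    then obtain y where y: "y \<in> int_span E" "x = ?s y" using E(5) by blast
    from y(1) obtain k where "y = (\<Sum>e\<in>E. scl (of_int (k e)) e)" by (rule int_spanE)
    then have "x = (\<Sum>e\<in>E. scl (of_int (k e)) (?s e))"
      unfolding y(2) by (simp only: scale_sum_right scale_left_commute)
    also have "\<dots> = (\<Sum>e\<in>E. scl (of_int (k (the_inv_into E ?s (?s e)))) (?s e))"
      by (intro sum.cong refl) (simp only: the_inv_into_f_f[OF inj])
    also have "\<dots> = ?f (\<lambda>y. k (the_inv_into E ?s y))"
      by (simp only: sum.reindex[OF inj] o_def)
    finally show "x \<in> range ?f" by (rule range_eqI[where f = ?f])
  next
    fix x assume "x \<in> range ?f"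
    then obtain k where "x = ?f k" by blast
    then have "x = ?s (\<Sum>e\<in>E. scl (of_int (k (?s e))) e)"
      by (simp only: sum.reindex[OF inj] o_def scale_sum_right scale_left_commute)
    then show "x \<in> multiples m" unfolding E(5) by (rule image_eqI) (rule int_spanI[OF refl])
  qed
  have span: "span (?s ` E) = UNIV"
  proof -
    have "e \<in> span (?s ` E)" if "e \<in> E" for e
    proof -
      have "?s e \<in> span (?s ` E)" using that by (intro span_base imageI)
      from span_scale[OF this, of "1 / of_nat m"] show ?thesis using m0 by simp
    qed
    then have "span E \<subseteq> span (span (?s ` E))" by (intro span_mono) blast
    then have "UNIV \<subseteq> span (?s ` E)" using E(3) by (simp add: span_span)
    then show ?thesis by (simp only: top.extremum_unique)
  qed
  have "independent (?s ` E)"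
    unfolding dependent_finite[OF finite_imageI[OF E(1)]]
  proof clarify
    fix u e assume u: "(\<Sum>v\<in>?s ` E. scl (u v) v) = 0" and e: "e \<in> E" and nz: "u (?s e) \<noteq> 0"
    have "(\<Sum>e\<in>E. scl (u (?s e) * of_nat m) e) = 0"
      using u by (simp only: sum.reindex[OF inj] o_def scale_scale)
    then have "u (?s e) * of_nat m = 0"
      using independentD[OF E(2,1) subset_refl, of "\<lambda>e. u (?s e) * of_nat m"] e by blast
    then show False using nz m0 by simp
  qed
  with img span E(1) show "\<exists>E. finite E \<and> independent E \<and> span E = UNIV \<and>
      multiples m = range (\<lambda>k :: 'v \<Rightarrow> int. \<Sum>x\<in>E. scl (of_int (k x)) x)"
    by (intro exI[of _ "?s ` E"]) simp
  fix x y
  show "B x y / of_nat m = B y x / of_nat m" by (simp only: symmetric[of x])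
  have "module_hom scl (*) (\<lambda>y. B x y / of_nat m)"
    using Vector_Spaces.linear.axioms(3)[OF bilinear[of x]]
    by (simp add: module_hom_iff add_divide_distrib)
  then show "Vector_Spaces.linear scl (*) (\<lambda>y. B x y / of_nat m)"
    using Vector_Spaces.linear.axioms(1,2)[OF bilinear[of x]] by (simp add: Vector_Spaces.linear_def)
  show "x = 0" if "\<And>y. B x y / of_nat m = 0"
    using nondegenerate[of x] that m0 by simp
next
  fix x assume "x \<in> multiples m"
  then obtain l where l: "l \<in> L" "x = scl (of_nat m) l" by blast
  have q: "qform (\<lambda>x y. B x y / of_nat m) x = of_nat m * Q l"
    using m unfolding l(2) by (simp add: qform_def B_scl_left B_scl_right)
  show "qform (\<lambda>x y. B x y / of_nat m) x \<in> \<int>" unfolding q using even[OF l(1)] by simp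
  assume "x \<noteq> 0"
  then show "qform (\<lambda>x y. B x y / of_nat m) x > 0" unfolding q using pos_def[OF l(1)] m l(2) by auto
qed

lemma dual_rescaled: "m > 0 \<Longrightarrow> dual_lattice (multiples m) (\<lambda>x y. B x y / of_nat m) = dual"
  by (simp add: dual_lattice_def B_scl_right)

lemma qform_rescaled: "qform (\<lambda>x y. B x y / of_nat m) x = Q x / of_nat m"
  by (simp add: qform_def)

lemma index_rescaled: "m > 0 \<Longrightarrow> index (multiples m) dual = disc * m ^ dim L"
  using index_mult[OF index_multiples(1) overlattice_finite_index_L[OF overlattice_dual]]
    index_multiples(2) by simp

lemma dim_rescaled: "m > 0 \<Longrightarrow> dim (multiples m) = dim L"
  using Z_lattice.dim_L[OF pos_def_even_lattice.axioms(1)[OF rescaled]] dim_L by simp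

lemma milgram_rescaled:
  assumes m: "m > 0"
  shows "mean dual (\<lambda>x. er (Q x / of_nat m))
    = er (of_nat (dim L) / 8) / of_real (sqrt (real (disc * m ^ dim L)))"
  using pos_def_even_lattice.milgram[OF rescaled[OF m]]
  unfolding dual_rescaled[OF m] qform_rescaled index_rescaled[OF m] dim_rescaled[OF m] .

lemma periodic_on_er':
  assumes "overlattice A" "\<And>x. x \<in> A \<Longrightarrow> f x = r * Q x + B x z + s"
  shows "periodic_on A (\<lambda>x. er (f x))"
proof -
  have "periodic_on A (\<lambda>x. er (r * Q x + B x z) * er s)"
    by (rule periodic_on_compose[OF periodic_on_er[OF assms(1)]])
  then show ?thesis
    using periodic_on_cong[of A "\<lambda>x. er (f x)" "\<lambda>x. er (r * Q x + B x z) * er s"] assms(2)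
    by (simp add: er_add)
qed

text \<open>No basis of \<open>dual\<close> is used: the index of \<open>multiples a\<close> in
  \<open>dual\<close> is counted once through \<open>L\<close> and once through the
  \<open>a\<close>-fold multiple of \<open>dual\<close>, and the common factor \<open>disc\<close>
  cancels.\<close>

lemma index_multiples_dual:
  assumes a: "a > 0"
  shows "finite_index (scl (of_nat a) ` dual) dual" "index (scl (of_nat a) ` dual) dual = a ^ dim L"
proof -
  have a0: "of_nat a \<noteq> (0 :: rat)" using a by simp
  have fi: "finite_index (multiples a) dual" by (rule overlattice_finite_index[OF overlattice_dual a])
  have fd: "finite_index (multiples a) (scl (of_nat a) ` dual)"
    by (rule finite_index_scl[OF a0 overlattice_finite_index_L[OF overlattice_dual]])
  have sub: "scl (of_nat a) ` dual \<subseteq> dual" using scl_nat_subgroup[OF dual_subgroup] by blast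
  show f: "finite_index (scl (of_nat a) ` dual) dual"
    by (rule finite_index_mono(2)[OF fi _ sub scl_image_subgroup[OF dual_subgroup]])
      (use fd in \<open>simp add: finite_index_def\<close>)
  have "disc * index (scl (of_nat a) ` dual) dual = disc * a ^ dim L"
    using index_mult[OF fd f] index_scl[OF a0 overlattice_finite_index_L[OF overlattice_dual]]
      index_rescaled[OF a] by metis
  then show "index (scl (of_nat a) ` dual) dual = a ^ dim L"
    unfolding nat_mult_eq_cancel1[OF disc_pos] .
qed

section \<open>Reciprocity\<close>

lemma periodic_on_shifted:
  assumes "a > 0" "c > 0"
  shows "periodic_on L (\<lambda>x. er (- (Q (scl (of_nat c) x + z) / of_nat (a * c))))"
proof (rule periodic_on_er'[OF overlattice_L])
  fix x
  have "Q (scl (of_nat c) x + z) = (of_nat c)\<^sup>2 * Q x + Q z + of_nat c * B x z"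
    by (simp only: Q_add Q_scl B_scl_left)
  then show "- (Q (scl (of_nat c) x + z) / of_nat (a * c))
      = - of_nat c / of_nat a * Q x + B x (scl (- 1 / of_nat a) z) + - Q z / of_nat (a * c)"
    using assms by (simp only: B_scl_right) (simp add: power2_eq_square field_simps)
qed

text \<open>Milgram's formula for the lattice rescaled by \<open>a c\<close> expresses \<open>er (- Q s / (a c))\<close> as an
  average over \<open>t\<close>; summing over \<open>s = c x + z\<close> leaves the \<open>t\<close> divisible by \<open>a\<close>.\<close>

lemma reciprocity:
  assumes a: "a > 0" and c: "c > 0" and z: "z \<in> dual"
  shows "mean dual (\<lambda>t. er (Q t / of_nat (a * c))) *
      mean L (\<lambda>x. er (- (Q (scl (of_nat c) x + z) / of_nat (a * c))))
    = mean dual (\<lambda>y. er ((of_nat a * Q y - B y z) / of_nat c)) / of_nat (a ^ dim L)"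
proof -
  let ?m = "a * c"
  have m: "?m > 0" and a0: "of_nat a \<noteq> (0 :: rat)" and c0: "of_nat c \<noteq> (0 :: rat)" using a c by simp_all
  let ?s = "\<lambda>x. scl (of_nat c) x + z"
  let ?f = "\<lambda>x t. er ((Q t + B t (?s x)) / of_nat ?m)"
  have Ld: "x \<in> L \<Longrightarrow> x \<in> dual" for x using L_subset_dual by blast
  have s: "?s x \<in> dual" if "x \<in> L" for x
    by (rule add_subgroup_add[OF dual_subgroup scl_nat_subgroup[OF dual_subgroup Ld[OF that]] z])
  \<comment> \<open>Completing the square by the translation
    \<open>t \<mapsto> t + u\<close>.\<close>
  have shift: "mean dual (\<lambda>t. er (Q t / of_nat ?m)) * er (- (Q u / of_nat ?m))
      = mean dual (\<lambda>t. er ((Q t + B t u) / of_nat ?m))" if u: "u \<in> dual" for u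
  proof -
    have per: "periodic_on dual (\<lambda>t. er (Q t / of_nat ?m))"
      by (rule periodic_on_er'[OF overlattice_dual, of _ "1 / of_nat ?m" 0 0]) (simp add: B_zero)
    have "mean dual (\<lambda>t. er (Q t / of_nat ?m)) * er (- (Q u / of_nat ?m))
        = er (- (Q u / of_nat ?m)) * mean dual (\<lambda>t. er (Q (t + u) / of_nat ?m))"
      using mean_shift(2)[OF per u] by simp
    also have "\<dots> = mean dual (\<lambda>t. er (- (Q u / of_nat ?m)) * er (Q (t + u) / of_nat ?m))"
      using mean_mult_left[OF mean_shift(1)[OF per u]] by simp
    also have "\<dots> = mean dual (\<lambda>t. er ((Q t + B t u) / of_nat ?m))"
      by (intro mean_cong periodic_on_compose[OF mean_shift(1)[OF per u]])
        (simp add: er_add[symmetric] Q_add add_divide_distrib)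
    finally show ?thesis .
  qed
  have perx: "periodic_mod (multiples ?m) L (\<lambda>x. ?f x t)" if t: "t \<in> dual" for t
    unfolding periodic_mod_def
  proof (intro conjI ballI index_multiples(1)[OF m])
    fix x h assume "x \<in> L" "h \<in> multiples ?m"
    then obtain l where l: "l \<in> L" "h = scl (of_nat ?m) l" by blast
    have "(Q t + B t (?s (x + h))) / of_nat ?m - (Q t + B t (?s x)) / of_nat ?m = of_nat c * B t l"
      using a0 c0 unfolding l(2) by (simp add: B_add_right B_scl_right scale_right_distrib field_simps)
    then show "?f (x + h) t = ?f x t" using B_dual(1)[OF t l(1)] by (intro er_cong) simp
  qed
  have pert: "periodic_mod (multiples ?m) dual (?f x)" if x: "x \<in> L" for x
    unfolding periodic_mod_def
  proof (intro conjI ballI overlattice_finite_index[OF overlattice_dual m])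
    fix t h assume t: "t \<in> dual" and "h \<in> multiples ?m"
    then obtain l where l: "l \<in> L" "h = scl (of_nat ?m) l" by blast
    have "(Q (t + h) + B (t + h) (?s x)) / of_nat ?m - (Q t + B t (?s x)) / of_nat ?m
        = of_nat ?m * Q l + B t l + B l (?s x)"
    proof -
      have "Q (t + h) + B (t + h) (?s x) = (Q t + B t (?s x)) + of_nat ?m * (of_nat ?m * Q l + B t l + B l (?s x))"
        unfolding l(2) Q_add Q_scl B_add_left B_scl_left B_scl_right by (simp add: power2_eq_square algebra_simps)
      then show ?thesis using m by (simp add: add_divide_distrib del: of_nat_mult)
    qed
    then show "?f x (t + h) = ?f x t"
      using even[OF l(1)] B_dual(1)[OF t l(1)] B_dual(2)[OF l(1) s[OF x]] by (intro er_cong) simp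
  qed
  have zL: "0 \<in> L" and zd: "0 \<in> dual" using add_subgroup_zero L_subgroup dual_subgroup by blast+
  note sw = mean_swap[OF zL zd perx pert]
  note per1 = periodic_on_shifted[OF a c, of z]
  have per2: "periodic_on dual (\<lambda>t. er ((Q t + B t z) / of_nat ?m))"
    by (rule periodic_on_er'[OF overlattice_dual, of _ "1 / of_nat ?m" "scl (1 / of_nat ?m) z" 0])
      (simp add: B_scl_right add_divide_distrib)
  have "mean dual (\<lambda>t. er (Q t / of_nat ?m)) * mean L (\<lambda>x. er (- (Q (?s x) / of_nat ?m)))
      = mean L (\<lambda>x. mean dual (?f x))"
    unfolding mean_mult_left[OF per1, symmetric]
    by (rule mean_cong[OF periodic_on_compose[OF per1]]) (rule shift[OF s])
  also have "\<dots> = mean dual (\<lambda>t. mean L (\<lambda>x. ?f x t))" by (rule sw(1))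
  \<comment> \<open>In \<open>x\<close> the summand is the character \<open>er (B x t / a)\<close>
    of \<open>L\<close>, which is trivial exactly when \<open>t\<close> is \<open>a\<close> times an
    element of \<open>dual\<close>.\<close>
  also have "\<dots> = mean dual (\<lambda>t. if t \<in> scl (of_nat a) ` dual then er ((Q t + B t z) / of_nat ?m) else 0)"
  proof (rule mean_cong)
    show "periodic_on dual (\<lambda>t. mean L (\<lambda>x. ?f x t))" using sw(3) unfolding periodic_on_def by blast
    fix t assume t: "t \<in> dual"
    have perB: "periodic_on L (\<lambda>x. er (B x t / of_nat a))"
      by (rule periodic_on_er'[OF overlattice_L, of _ 0 "scl (1 / of_nat a) t" 0]) (simp add: B_scl_right)
    have "mean L (\<lambda>x. ?f x t) = mean L (\<lambda>x. er ((Q t + B t z) / of_nat ?m) * er (B x t / of_nat a))"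
    proof (rule mean_cong)
      show "periodic_on L (\<lambda>x. ?f x t)" using perx[OF t] unfolding periodic_on_def by blast
      fix x
      have "(Q t + B t (?s x)) / of_nat ?m = (Q t + B t z) / of_nat ?m + B x t / of_nat a"
        using a0 c0 by (simp add: B_add_right B_scl_right symmetric[of t x] field_simps)
      then show "?f x t = er ((Q t + B t z) / of_nat ?m) * er (B x t / of_nat a)" by (simp only: er_add)
    qed
    also have "\<dots> = er ((Q t + B t z) / of_nat ?m) * mean L (\<lambda>x. er (B x t / of_nat a))"
      by (rule mean_mult_left[OF perB])
    also have "mean L (\<lambda>x. er (B x t / of_nat a)) = (if \<forall>x\<in>L. er (B x t / of_nat a) = 1 then 1 else 0)"
      by (rule mean_character[OF perB L_subgroup]) (simp add: B_add_left add_divide_distrib er_add)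
    also have "(\<forall>x\<in>L. er (B x t / of_nat a) = 1) \<longleftrightarrow> scl (1 / of_nat a) t \<in> dual"
      unfolding er_eq_1_iff by (simp add: dual_lattice_def B_scl_left symmetric[of t])
    also have "scl (1 / of_nat a) t \<in> dual \<longleftrightarrow> t \<in> scl (of_nat a) ` dual"
    proof
      assume "scl (1 / of_nat a) t \<in> dual"
      then have "scl (of_nat a) (scl (1 / of_nat a) t) \<in> scl (of_nat a) ` dual" by (rule imageI)
      then show "t \<in> scl (of_nat a) ` dual" using a0 by simp
    next
      assume "t \<in> scl (of_nat a) ` dual"
      then obtain u where "u \<in> dual" "t = scl (of_nat a) u" by blast
      then show "scl (1 / of_nat a) t \<in> dual" using a0 by simp
    qed
    finally show "mean L (\<lambda>x. ?f x t)
      = (if t \<in> scl (of_nat a) ` dual then er ((Q t + B t z) / of_nat ?m) else 0)" by simp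
  qed
  also have "\<dots> = mean (scl (of_nat a) ` dual) (\<lambda>t. er ((Q t + B t z) / of_nat ?m)) / of_nat (a ^ dim L)"
    using mean_restrict(2)[OF per2 index_multiples_dual(1)[OF a]] index_multiples_dual(2)[OF a] by simp
  also have "mean (scl (of_nat a) ` dual) (\<lambda>t. er ((Q t + B t z) / of_nat ?m))
      = mean dual (\<lambda>y. er ((of_nat a * Q y - B y z) / of_nat c))"
  proof -
    \<comment> \<open>Substituting \<open>t = - a y\<close> rather than \<open>a y\<close> produces
      the sign of \<open>- B y z\<close>.\<close>
    have img: "(\<lambda>y. scl (- of_nat a) y) ` dual = scl (of_nat a) ` dual"
    proof -
      have "(\<lambda>y. scl (- of_nat a) y) ` dual = scl (of_nat a) ` uminus ` dual" by (simp add: image_image)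
      also have "uminus ` dual = dual"
      proof (intro equalityI subsetI)
        fix y assume "y \<in> dual"
        then have "- (- y) \<in> uminus ` dual" by (intro imageI add_subgroup_minus[OF dual_subgroup])
        then show "y \<in> uminus ` dual" by simp
      qed (use add_subgroup_minus[OF dual_subgroup] in blast)
      finally show ?thesis .
    qed
    have "scl (of_nat a) ` dual \<subseteq> dual" using scl_nat_subgroup[OF dual_subgroup] by blast
    from periodic_on_subgroup[OF per2 scl_image_subgroup[OF dual_subgroup] this zd]
    have per3: "periodic_on (scl (of_nat a) ` dual) (\<lambda>t. er ((Q t + B t z) / of_nat ?m))" by simp
    note re = mean_reindex_surj[OF dual_subgroup scale_right_distrib img per3]
    have "mean dual (\<lambda>y. er ((Q (scl (- of_nat a) y) + B (scl (- of_nat a) y) z) / of_nat ?m))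
        = mean dual (\<lambda>y. er ((of_nat a * Q y - B y z) / of_nat c))"
    proof (rule mean_cong[OF re(1)])
      fix y
      have "(Q (scl (- of_nat a) y) + B (scl (- of_nat a) y) z) / of_nat ?m = (of_nat a * Q y - B y z) / of_nat c"
        unfolding Q_scl B_scl_left using a0 c0 by (simp add: power2_eq_square field_simps)
      then show "er ((Q (scl (- of_nat a) y) + B (scl (- of_nat a) y) z) / of_nat ?m)
        = er ((of_nat a * Q y - B y z) / of_nat c)" by simp
    qed
    then show ?thesis using re(2) by simp
  qed
  finally show ?thesis .
qed

text \<open>The matrix entries of the Weil representation at \<open>(a, b, c, d)\<close> with \<open>c > 0\<close>; the entry \<open>b\<close> is
  determined by the others.\<close>

definition weil_entry :: "int \<Rightarrow> nat \<Rightarrow> int \<Rightarrow> 'v \<Rightarrow> 'v \<Rightarrow> complex"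
  where "weil_entry a c d w v = er (- (of_nat (dim L) / 8)) * of_real (sqrt c) ^ dim L / of_real (sqrt disc) *
    mean L (\<lambda>x. er ((of_int a * Q (x + w) - B (x + w) v + of_int d * Q v) / of_nat c))"

text \<open>Left multiplication by \<open>S\<close> is a finite Fourier transform in
  \<open>w\<close>. The average over \<open>L\<close> inside \<open>weil_entry\<close> and the outer
  one over \<open>dual\<close> merge into a single average over \<open>dual\<close>, to which
  \<open>reciprocity\<close> applies.\<close>

lemma weil_entry_S:
  assumes a: "a > 0" and c: "c > 0" and w: "w \<in> dual" and v: "v \<in> dual"
    and det: "int a * d - b * int c = 1"
  shows "er (- (of_nat (dim L) / 8)) * of_real (sqrt disc) *
      mean dual (\<lambda>u. er (- B w u) * weil_entry a c d u v) = weil_entry (- int c) a b w v"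
proof -
  \<comment> \<open>This \<open>?z\<close> combines \<open>v / c\<close> and the Fourier kernel
    \<open>B w y\<close> into one linear term \<open>B y ?z / c\<close>.\<close>
  let ?n = "dim L" and ?z = "v + scl (of_nat c) w"
  let ?e = "er (- (of_nat (dim L) / 8))"
  let ?F = "\<lambda>y. er ((of_nat a * Q y - B y v + of_int d * Q v) / of_nat c - B w y)"
  have a0: "of_nat a \<noteq> (0 :: rat)" and c0: "of_nat c \<noteq> (0 :: rat)" using a c by simp_all
  have z: "?z \<in> dual" using v w by (intro add_subgroup_add[OF dual_subgroup] scl_nat_subgroup[OF dual_subgroup])
  have F: "?F y = er (of_int d * Q v / of_nat c) * er ((of_nat a * Q y - B y ?z) / of_nat c)" for y
  proof -
    have "(of_nat a * Q y - B y v + of_int d * Q v) / of_nat c - B w y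
        = of_int d * Q v / of_nat c + (of_nat a * Q y - B y ?z) / of_nat c"
      using c0 by (simp add: B_add_right B_scl_right symmetric[of w] field_simps)
    then show ?thesis by (simp only: er_add)
  qed
  have perF: "periodic_on dual ?F"
    by (rule periodic_on_er'[OF overlattice_dual, of _ "of_nat a / of_nat c" "- (scl (1 / of_nat c) v) - w" "of_int d * Q v / of_nat c"])
      (use c0 in \<open>simp add: B_diff_right B_add_right B_minus B_scl_right symmetric[of w] field_simps\<close>)
  have perG: "periodic_on dual (\<lambda>y. er ((of_nat a * Q y - B y ?z) / of_nat c))"
    by (rule periodic_on_er'[OF overlattice_dual, of _ "of_nat a / of_nat c" "- (scl (1 / of_nat c) ?z)" 0])
      (use c0 in \<open>simp add: B_add_right B_diff_right B_minus B_scl_right field_simps\<close>)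
  have inner: "er (- B w u) * weil_entry a c d u v
      = (?e * of_real (sqrt c) ^ ?n / of_real (sqrt disc)) * mean L (\<lambda>x. ?F (u + x))" if u: "u \<in> dual" for u
  proof -
    have perL: "periodic_on L (\<lambda>x. er ((of_nat a * Q (x + u) - B (x + u) v + of_int d * Q v) / of_nat c))"
      by (rule periodic_on_er'[OF overlattice_L, of _ "of_nat a / of_nat c" "scl (1 / of_nat c) (scl (of_nat a) u - v)"
          "(of_nat a * Q u - B u v + of_int d * Q v) / of_nat c"])
        (use c0 in \<open>simp add: Q_add B_add_left B_diff_right B_scl_right field_simps\<close>)
    have "er (- B w u) * mean L (\<lambda>x. er ((of_nat a * Q (x + u) - B (x + u) v + of_int d * Q v) / of_nat c))
        = mean L (\<lambda>x. er (- B w u) * er ((of_nat a * Q (x + u) - B (x + u) v + of_int d * Q v) / of_nat c))"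
      using mean_mult_left[OF perL] by simp
    also have "\<dots> = mean L (\<lambda>x. ?F (u + x))"
    proof (rule mean_cong[OF periodic_on_compose[OF perL]])
      fix x assume x: "x \<in> L"
      have "(- B w u + (of_nat a * Q (x + u) - B (x + u) v + of_int d * Q v) / of_nat c)
          - ((of_nat a * Q (u + x) - B (u + x) v + of_int d * Q v) / of_nat c - B w (u + x)) = B w x"
        by (simp add: B_add_right add.commute[of u x])
      then show "er (- B w u) * er ((of_nat a * Q (x + u) - B (x + u) v + of_int d * Q v) / of_nat c) = ?F (u + x)"
        unfolding er_add[symmetric] using B_dual(1)[OF w x] by (intro er_cong) simp
    qed
    finally show ?thesis unfolding weil_entry_def by (simp add: mult_ac)
  qed
  let ?g = "mean dual (\<lambda>t. er (Q t / of_nat (a * c)))"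
  let ?M = "mean L (\<lambda>x. er (- (Q (scl (of_nat c) x + ?z) / of_nat (a * c))))"
  let ?R = "mean L (\<lambda>x. er ((of_int (- int c) * Q (x + w) - B (x + w) v + of_int b * Q v) / of_nat a))"
  have "mean dual (\<lambda>u. er (- B w u) * weil_entry a c d u v)
      = mean dual (\<lambda>u. (?e * of_real (sqrt c) ^ ?n / of_real (sqrt disc)) * mean L (\<lambda>x. ?F (u + x)))"
    by (rule mean_cong[symmetric, OF periodic_on_compose[OF periodic_on_mean[OF perF L_subgroup L_subset_dual]]])
      (rule inner[symmetric])
  also have "\<dots> = (?e * of_real (sqrt c) ^ ?n / of_real (sqrt disc)) * mean dual ?F"
    by (simp only: mean_mult_left[OF periodic_on_mean[OF perF L_subgroup L_subset_dual]]
      mean_tower[OF perF L_subgroup L_subset_dual])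
  also have "mean dual ?F = er (of_int d * Q v / of_nat c) * mean dual (\<lambda>y. er ((of_nat a * Q y - B y ?z) / of_nat c))"
    unfolding F by (rule mean_mult_left[OF perG])
  also have "mean dual (\<lambda>y. er ((of_nat a * Q y - B y ?z) / of_nat c)) = of_nat (a ^ ?n) * ?g * ?M"
  proof -
    have nz: "of_nat (a ^ ?n) \<noteq> (0 :: complex)" using a by simp
    have "?g * ?M * of_nat (a ^ ?n) = mean dual (\<lambda>y. er ((of_nat a * Q y - B y ?z) / of_nat c))"
      using reciprocity[OF a c z] unfolding nonzero_eq_divide_eq[OF nz] .
    then show ?thesis by (simp only: mult_ac)
  qed
  also have "er (of_int d * Q v / of_nat c) * (of_nat (a ^ ?n) * ?g * ?M) = of_nat (a ^ ?n) * ?g * ?R"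
  proof -
    note perM = periodic_on_shifted[OF a c, of ?z]
    have "er (of_int d * Q v / of_nat c) * ?M = mean L (\<lambda>x. er (of_int d * Q v / of_nat c) * er (- (Q (scl (of_nat c) x + ?z) / of_nat (a * c))))"
      using mean_mult_left[OF perM] by simp
    also have "\<dots> = ?R"
    proof (rule mean_cong[OF periodic_on_compose[OF perM]])
      fix x
      have "of_int (int a * d - b * int c) = (1 :: rat)" unfolding det by simp
      then have det': "of_int d * of_nat a = 1 + of_int b * (of_nat c :: rat)" by (simp add: algebra_simps)
      have "scl (of_nat c) x + ?z = scl (of_nat c) (x + w) + v" by (simp add: scale_right_distrib algebra_simps)
      then have "Q (scl (of_nat c) x + ?z) = (of_nat c)\<^sup>2 * Q (x + w) + Q v + of_nat c * B (x + w) v"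
        by (simp only: Q_add[of "scl _ _" v] Q_scl B_scl_left)
      \<comment> \<open>The determinant enters here: \<open>d / c = b / a + 1 / (a c)\<close>, and
        the second summand cancels the \<open>Q v\<close> contained in
        \<open>Q (c (x + w) + v)\<close>.\<close>
      moreover have "of_int d * Q v / of_nat c = (of_int b / of_nat a + 1 / of_nat (a * c)) * Q v"
      proof -
        have "of_int d / of_nat c = (of_int d * of_nat a) / (of_nat a * of_nat c :: rat)" using a0 by simp
        also have "\<dots> = of_int b / of_nat a + 1 / of_nat (a * c)"
          unfolding det' using a0 c0 by (simp add: add_divide_distrib)
        finally show ?thesis by (simp only: times_divide_eq_left[symmetric])
      qed
      ultimately have "of_int d * Q v / of_nat c + - (Q (scl (of_nat c) x + ?z) / of_nat (a * c))
          = (of_int (- int c) * Q (x + w) - B (x + w) v + of_int b * Q v) / of_nat a"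
        using a0 c0 by (simp add: power2_eq_square field_simps)
      then show "er (of_int d * Q v / of_nat c) * er (- (Q (scl (of_nat c) x + ?z) / of_nat (a * c)))
          = er ((of_int (- int c) * Q (x + w) - B (x + w) v + of_int b * Q v) / of_nat a)"
        by (simp only: er_add[symmetric])
    qed
    finally show ?thesis by (simp add: mult_ac)
  qed
  finally have "?e * of_real (sqrt disc) * mean dual (\<lambda>u. er (- B w u) * weil_entry a c d u v)
      = ?e * (?e * of_real (sqrt c) ^ ?n * of_nat (a ^ ?n) * ?g) * ?R"
    using disc_pos by (simp add: mult_ac)
  \<comment> \<open>Milgram's value of \<open>?g\<close> cancels one phase and the powers of
    \<open>sqrt c\<close>, and leaves \<open>sqrt a\<close> to the power required for an entry with
    lower left coefficient \<open>a\<close>.\<close>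
  also have "?e * of_real (sqrt c) ^ ?n * of_nat (a ^ ?n) * ?g = of_real (sqrt a) ^ ?n / of_real (sqrt disc)"
  proof -
    have r: "sqrt (real (disc * (a * c) ^ ?n)) = sqrt disc * sqrt a ^ ?n * sqrt c ^ ?n"
      by (simp add: real_sqrt_mult real_sqrt_power power_mult_distrib)
    define A C where "A = complex_of_real (sqrt a) ^ ?n" and "C = complex_of_real (sqrt c) ^ ?n"
    have nz: "A \<noteq> 0" "C \<noteq> 0" using a c by (simp_all add: A_def C_def)
    have "A * A = of_nat (a ^ ?n)"
      by (simp add: A_def power_mult_distrib[symmetric] of_real_mult[symmetric] del: of_real_mult)
    then have "?e * C * of_nat (a ^ ?n) * ?g = (?e * er (of_nat ?n / 8)) * (C * (A * A)) / (of_real (sqrt disc) * A * C)"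
      using milgram_rescaled[of "a * c"] a c unfolding r by (simp add: A_def C_def)
    also have "\<dots> = A / of_real (sqrt disc)" unfolding er_minus_mult using nz by simp
    finally show ?thesis unfolding A_def C_def .
  qed
  finally show ?thesis by (simp add: weil_entry_def mult_ac)
qed

end

section \<open>The metaplectic group\<close>

lemma mat22_entries [simp]:
  "mat22 a b c d $ 1 $ 1 = a" "mat22 a b c d $ 1 $ 2 = b"
  "mat22 a b c d $ 2 $ 1 = c" "mat22 a b c d $ 2 $ 2 = d"
  by (simp_all add: mat22_def)

lemma mat22_SL2Z: "mat22 a b c d \<in> SL2Z \<longleftrightarrow> a * d - b * c = 1"
  by (simp add: SL2Z_def det_2)

lemma mat22_mult:
  "mat22 a b c d ** mat22 a' b' c' d' = mat22 (a*a' + b*c') (a*b' + b*d') (c*a' + d*c') (c*b' + d*d')"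
  by (simp add: vec_eq_iff forall_2 mult_22_entries)

lemma mp2_cocycle_T_left:
  assumes "A \<in> SL2Z"
  shows "mp2_cocycle (mat22 1 1 0 1) A \<i> = 1"
proof -
  have "autj (mat22 1 1 0 1 ** A) \<i> = autj A \<i>" by (simp add: autj_def mult_22_entries)
  moreover have "autj (mat22 1 1 0 1) z = 1" for z by (simp add: autj_def)
  ultimately show ?thesis
    using mp2_cocycle_eq[OF assms, of \<i> "mat22 1 1 0 1"] autj_nonzero[OF assms, of \<i>] by simp
qed

lemma mp2_cocycle_T_right:
  assumes "A \<in> SL2Z"
  shows "mp2_cocycle A (mat22 1 1 0 1) \<i> = 1"
proof -
  have T: "mat22 1 1 0 1 \<in> SL2Z" by (simp add: mat22_SL2Z)
  have "autj (mat22 1 1 0 1) \<i> = 1" by (simp add: autj_def)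
  moreover have "autj (A ** mat22 1 1 0 1) \<i> = autj A (moebius (mat22 1 1 0 1) \<i>)"
    by (simp add: autj_def moebius_def mult_22_entries algebra_simps)
  ultimately show ?thesis
    using mp2_cocycle_eq[OF T, of \<i> A] autj_nonzero[OF assms Im_moebius[OF T, of \<i>]] by simp
qed

lemma csqrt_upper: "Im z > 0 \<Longrightarrow> Re (csqrt z) > 0 \<and> Im (csqrt z) > 0"
proof -
  assume z: "Im z > 0"
  have sq: "Im (u\<^sup>2) = 2 * (Re u * Im u)" for u by (simp add: power2_eq_square)
  have "0 < 2 * (Re (csqrt z) * Im (csqrt z))" unfolding sq[symmetric] power2_csqrt by (rule z)
  then have "Re (csqrt z) * Im (csqrt z) > 0" by linarith
  moreover have "Re (csqrt z) \<ge> 0" using csqrt_principal[of z] by linarith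
  ultimately show ?thesis unfolding zero_less_mult_iff by linarith
qed

text \<open>Both roots lie in the open first quadrant, so their product has positive imaginary part;
  this excludes the value \<open>- csqrt (z * w)\<close>.\<close>

lemma csqrt_mult_upper:
  assumes "Im z > 0" "Im w > 0" "Im (z * w) > 0"
  shows "csqrt z * csqrt w = csqrt (z * w)"
proof -
  have "(csqrt z * csqrt w)\<^sup>2 = (csqrt (z * w))\<^sup>2" by (simp add: power_mult_distrib)
  then have "csqrt z * csqrt w = csqrt (z * w) \<or> csqrt z * csqrt w = - csqrt (z * w)"
    by (simp only: power2_eq_iff)
  moreover have "Im (csqrt z * csqrt w) > 0" using csqrt_upper[OF assms(1)] csqrt_upper[OF assms(2)]
    by (simp add: add_pos_pos)
  moreover have "Im (- csqrt (z * w)) < 0" using csqrt_upper[OF assms(3)] by simp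
  ultimately show ?thesis by (metis less_asym)
qed

text \<open>Positivity of \<open>c\<close> and \<open>a\<close> puts \<open>c i + d\<close> and
  \<open>a i + b\<close> in the upper half plane, where \<open>csqrt_mult_upper\<close> shows that
  the principal roots multiply without a sign.\<close>

lemma mp2_cocycle_S_left:
  assumes A: "mat22 a b c d \<in> SL2Z" and "a > 0" "c > 0"
  shows "mp2_cocycle (mat22 0 (-1) 1 0) (mat22 a b c d) \<i> = 1"
proof -
  let ?A = "mat22 a b c d"
  have S: "mat22 0 (-1) 1 0 \<in> SL2Z" by (simp add: mat22_SL2Z)
  have 1: "autj (mat22 0 (-1) 1 0) z = z" for z by (simp add: autj_def)
  have 2: "autj (mat22 0 (-1) 1 0 ** ?A) \<i> = moebius ?A \<i> * autj ?A \<i>"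
    using autj_mult[OF A, of \<i> "mat22 0 (-1) 1 0"] by (simp add: 1)
  have "Im (autj (mat22 0 (-1) 1 0 ** ?A) \<i>) > 0" using assms(2) by (simp add: autj_def mult_22_entries)
  then have im: "Im (moebius ?A \<i> * autj ?A \<i>) > 0" unfolding 2 .
  have "Im (autj ?A \<i>) > 0" using assms(3) by (simp add: autj_def)
  then have "csqrt (moebius ?A \<i>) * csqrt (autj ?A \<i>) = csqrt (moebius ?A \<i> * autj ?A \<i>)"
    using Im_moebius[OF A, of \<i>] im by (intro csqrt_mult_upper) simp_all
  moreover have "csqrt (moebius ?A \<i> * autj ?A \<i>) \<noteq> 0"
    using autj_nonzero[OF SL2Z_mult[OF S A], of \<i>] unfolding 2 by simp
  ultimately show ?thesis using mp2_cocycle_eq[OF A, of \<i> "mat22 0 (-1) 1 0"] by (simp add: 1 2)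
qed

lemma minus_ii_powr: "(- \<i>) powr (of_nat n / 2) = er (- (of_nat n / 8))"
proof -
  have "Ln (- \<i>) = - (\<i> * of_real (pi / 2))" by simp
  then have "(- \<i>) powr (of_nat n / 2) = exp (of_nat n / 2 * - (\<i> * of_real (pi / 2)))"
    by (simp add: powr_def)
  also have "of_nat n / 2 * - (\<i> * of_real (pi / 2)) = \<i> * of_real (2 * pi * of_rat (- (of_nat n / 8)))"
    by (simp add: of_rat_minus of_rat_divide field_simps)
  finally show ?thesis unfolding er_cis cis_conv_exp .
qed

section \<open>Linear maps on free spaces\<close>

lemma basis_fun_free_space: "Y \<in> X \<Longrightarrow> basis_fun Y \<in> free_space X"
  by (auto simp: free_space_def basis_fun_def)

lemma linear_on_free_spaceD:
  assumes "linear_on_free_space X \<phi>" "f \<in> free_space X"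
  shows "g \<in> free_space X \<Longrightarrow> \<phi> (\<lambda>x. f x + g x) = (\<lambda>x. \<phi> f x + \<phi> g x)"
    and "\<phi> (\<lambda>x. r * f x) = (\<lambda>x. r * \<phi> f x)"
  using assms by (simp_all add: linear_on_free_space_def)

lemma linear_on_free_space_sum:
  assumes \<phi>: "linear_on_free_space X \<phi>" and "finite S" "S \<subseteq> X"
  shows "\<phi> (\<lambda>x. \<Sum>Y\<in>S. g Y * basis_fun Y x) = (\<lambda>Z. \<Sum>Y\<in>S. g Y * \<phi> (basis_fun Y) Z)"
  using assms(2,3)
proof (induction S rule: finite_induct)
  case empty
  have "(\<lambda>x. 0) \<in> free_space X" by (simp add: free_space_def)
  from linear_on_free_spaceD(2)[OF \<phi> this, of 0] show ?case by simp
next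
  case (insert Y S)
  have 1: "(\<lambda>x. \<Sum>Y\<in>S. g Y * basis_fun Y x) \<in> free_space X"
    using insert.prems by (auto simp: free_space_def basis_fun_def intro!: sum.neutral)
  have Y: "basis_fun Y \<in> free_space X" using insert.prems basis_fun_free_space[of Y X] by simp
  have 2: "(\<lambda>x. g Y * basis_fun Y x) \<in> free_space X"
    using Y by (simp add: free_space_def)
  have "\<phi> (\<lambda>x. g Y * basis_fun Y x + (\<Sum>Y\<in>S. g Y * basis_fun Y x))
      = (\<lambda>x. \<phi> (\<lambda>x. g Y * basis_fun Y x) x + \<phi> (\<lambda>x. \<Sum>Y\<in>S. g Y * basis_fun Y x) x)"
    by (rule linear_on_free_spaceD(1)[OF \<phi> 2 1])
  moreover have "\<phi> (\<lambda>x. g Y * basis_fun Y x) = (\<lambda>x. g Y * \<phi> (basis_fun Y) x)"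
    by (rule linear_on_free_spaceD(2)[OF \<phi> Y])
  ultimately show ?case using insert by simp
qed

lemma linear_on_free_space_expand:
  assumes "linear_on_free_space X \<phi>" "finite X" "f \<in> free_space X"
  shows "\<phi> f Z = (\<Sum>Y\<in>X. f Y * \<phi> (basis_fun Y) Z)"
proof -
  have "f = (\<lambda>x. \<Sum>Y\<in>X. f Y * basis_fun Y x)"
  proof
    fix x
    have "(\<Sum>Y\<in>X. f Y * basis_fun Y x) = (\<Sum>Y\<in>X. if Y = x then f x else 0)"
      by (intro sum.cong) (auto simp: basis_fun_def)
    then show "f x = (\<Sum>Y\<in>X. f Y * basis_fun Y x)"
      using assms(2,3) by (simp add: free_space_def)
  qed
  then have "\<phi> f = \<phi> (\<lambda>x. \<Sum>Y\<in>X. f Y * basis_fun Y x)" by (rule arg_cong)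
  also have "\<dots> = (\<lambda>Z. \<Sum>Y\<in>X. f Y * \<phi> (basis_fun Y) Z)"
    by (rule linear_on_free_space_sum[OF assms(1,2) subset_refl])
  finally show ?thesis by simp
qed

lemma
  assumes \<rho>: "\<rho> \<in> hom G (GL_free X)" and x: "x \<in> carrier G" and y: "y \<in> carrier G"
    and f: "f \<in> free_space X"
  shows hom_GL_free_linear: "linear_on_free_space X (\<rho> x)"
    and hom_GL_free_closed: "\<rho> x f \<in> free_space X"
    and hom_GL_free_mult: "\<rho> (x \<otimes>\<^bsub>G\<^esub> y) f = \<rho> x (\<rho> y f)"
proof -
  have xy: "\<rho> x \<in> carrier (GL_free X)" "\<rho> y \<in> carrier (GL_free X)"
    using \<rho> x y by (auto simp: hom_def)
  then show "linear_on_free_space X (\<rho> x)" by (simp add: GL_free_def)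
  have b: "\<rho> x \<in> Bij (free_space X)" "\<rho> y \<in> Bij (free_space X)" using xy by (simp_all add: GL_free_def)
  show "\<rho> x f \<in> free_space X" using Bij_imp_funcset[OF b(1)] f by blast
  have "\<rho> (x \<otimes>\<^bsub>G\<^esub> y) = \<rho> x \<otimes>\<^bsub>GL_free X\<^esub> \<rho> y" using \<rho> x y by (simp add: hom_def)
  also have "\<dots> = compose (free_space X) (\<rho> x) (\<rho> y)" using b by (simp add: GL_free_def BijGroup_def)
  finally show "\<rho> (x \<otimes>\<^bsub>G\<^esub> y) f = \<rho> x (\<rho> y f)" using f by (simp add: compose_eq)
qed

section \<open>The Weil representation\<close>

context pos_def_even_lattice
begin

text \<open>The counterpart of \<open>entry_T_left\<close>: the summand changes by
  \<open>er (Q (x + w))\<close>, which on \<open>L\<close> is the constant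
  \<open>er (Q w)\<close>.\<close>

lemma weil_entry_shift_a:
  assumes c: "c > 0" and w: "w \<in> dual"
  shows "weil_entry (a + int c) c d w v = er (Q w) * weil_entry a c d w v"
proof -
  let ?f = "\<lambda>x. er ((of_int a * Q (x + w) - B (x + w) v + of_int d * Q v) / of_nat c)"
  have c0: "of_nat c \<noteq> (0 :: rat)" using c by simp
  have per: "periodic_on L ?f"
    by (rule periodic_on_er'[OF overlattice_L, of _ "of_int a / of_nat c" "scl (1 / of_nat c) (scl (of_int a) w - v)"
        "(of_int a * Q w - B w v + of_int d * Q v) / of_nat c"])
      (use c0 in \<open>simp add: Q_add B_add_left B_diff_right B_scl_right field_simps\<close>)
  have "er (Q w) * mean L ?f = mean L (\<lambda>x. er (Q w) * ?f x)" using mean_mult_left[OF per] by simp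
  also have "\<dots> = mean L (\<lambda>x. er ((of_int (a + int c) * Q (x + w) - B (x + w) v + of_int d * Q v) / of_nat c))"
  proof (rule mean_cong[OF periodic_on_compose[OF per]])
    fix x assume x: "x \<in> L"
    have "(of_int (a + int c) * Q (x + w) - B (x + w) v + of_int d * Q v) / of_nat c
        = Q (x + w) + (of_int a * Q (x + w) - B (x + w) v + of_int d * Q v) / of_nat c"
      using c0 by (simp add: field_simps)
    then have "Q w + (of_int a * Q (x + w) - B (x + w) v + of_int d * Q v) / of_nat c
        - (of_int (a + int c) * Q (x + w) - B (x + w) v + of_int d * Q v) / of_nat c = - Q x - B x w"
      by (simp add: Q_add)
    also have "\<dots> \<in> \<int>" using even[OF x] B_dual(2)[OF x w] by simp
    finally show "er (Q w) * ?f x = er ((of_int (a + int c) * Q (x + w) - B (x + w) v + of_int d * Q v) / of_nat c)"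
      unfolding er_add[symmetric] by (rule er_cong)
  qed
  finally show ?thesis by (simp add: weil_entry_def)
qed

lemma weil_entry_shift_d:
  assumes c: "c > 0"
  shows "weil_entry a c (d + int c) w v = er (Q v) * weil_entry a c d w v"
proof -
  let ?f = "\<lambda>x. er ((of_int a * Q (x + w) - B (x + w) v + of_int d * Q v) / of_nat c)"
  have c0: "of_nat c \<noteq> (0 :: rat)" using c by simp
  have per: "periodic_on L ?f"
    by (rule periodic_on_er'[OF overlattice_L, of _ "of_int a / of_nat c" "scl (1 / of_nat c) (scl (of_int a) w - v)"
        "(of_int a * Q w - B w v + of_int d * Q v) / of_nat c"])
      (use c0 in \<open>simp add: Q_add B_add_left B_diff_right B_scl_right field_simps\<close>)
  have "er ((of_int a * Q (x + w) - B (x + w) v + of_int (d + int c) * Q v) / of_nat c) = er (Q v) * ?f x" for x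
  proof -
    have "(of_int a * Q (x + w) - B (x + w) v + of_int (d + int c) * Q v) / of_nat c
        = Q v + (of_int a * Q (x + w) - B (x + w) v + of_int d * Q v) / of_nat c"
      using c0 by (simp add: field_simps)
    then show ?thesis by (simp only: er_add)
  qed
  then show ?thesis by (simp only: weil_entry_def mean_mult_left[OF per] mult.left_commute)
qed

lemma weil_entry_0:
  assumes w: "w \<in> dual" and v: "v \<in> dual"
  shows "weil_entry 0 1 0 w v = er (- (of_nat (dim L) / 8)) / of_real (sqrt disc) * er (- B v w)"
proof -
  have per: "periodic_on L (\<lambda>x. er ((of_int 0 * Q (x + w) - B (x + w) v + of_int 0 * Q v) / of_nat 1))"
    by (rule periodic_on_er'[OF overlattice_L, of _ 0 "- v" "- B w v"]) (simp add: B_add_left B_minus)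
  have "mean L (\<lambda>x. er ((of_int 0 * Q (x + w) - B (x + w) v + of_int 0 * Q v) / of_nat 1)) = mean L (\<lambda>x. er (- B v w))"
  proof (rule mean_cong[OF per])
    fix x assume x: "x \<in> L"
    show "er ((of_int 0 * Q (x + w) - B (x + w) v + of_int 0 * Q v) / of_nat 1) = er (- B v w)"
      using B_dual(2)[OF x v] by (intro er_cong) (simp add: B_add_left symmetric[of v w])
  qed
  then show ?thesis by (simp add: weil_entry_def mean_const[OF L_subgroup])
qed

lemma disc_module_eq: "disc_module L B = lcoset L ` dual" "card (disc_module L B) = disc"
  by (simp_all add: disc_module_def index_def)

lemma finite_disc_module: "finite (disc_module L B)"
  using overlattice_finite_index_L[OF overlattice_dual] by (simp add: disc_module_eq finite_index_def)

section \<open>Entries of a Weil representation and Euclidean descent\<close>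

context
  fixes \<rho> assumes weil: "is_weil_rep scl L B \<rho>"
begin

abbreviation "X \<equiv> disc_module L B"

abbreviation entry :: "int \<Rightarrow> int \<Rightarrow> int \<Rightarrow> int \<Rightarrow> 'v \<Rightarrow> 'v \<Rightarrow> complex"
  where "entry a b c d w v \<equiv> rep_coeff \<rho> (mat22 a b c d, 1) (lcoset L w) (lcoset L v)"

lemma weil_hom: "\<rho> \<in> hom Mp2Z (GL_free X)"
  using weil by (simp add: is_weil_rep_def)

lemma lcoset_X: "x \<in> dual \<Longrightarrow> lcoset L x \<in> X"
  by (simp add: disc_module_eq)

lemma Mp2Z_carrier: "mat22 a b c d \<in> SL2Z \<Longrightarrow> (mat22 a b c d, 1) \<in> carrier Mp2Z"
  by (simp add: Mp2Z_def)

lemma T_mp_carrier: "T_mp \<in> carrier Mp2Z" and S_mp_carrier: "S_mp \<in> carrier Mp2Z"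
  by (simp_all add: T_mp_def S_mp_def Mp2Z_def mat22_SL2Z)

lemma weil_T: "x \<in> dual \<Longrightarrow> \<rho> T_mp (basis_fun (lcoset L x)) = (\<lambda>Z. er (Q x) * basis_fun (lcoset L x) Z)"
  using weil by (simp add: is_weil_rep_def er_def)

lemma weil_S:
  assumes x: "x \<in> dual" and w: "w \<in> dual"
  shows "\<rho> S_mp (basis_fun (lcoset L x)) (lcoset L w)
    = er (- (of_nat (dim L) / 8)) / of_real (sqrt disc) * er (- B x w)"
proof -
  let ?r = "\<lambda>Y. SOME y. y \<in> Y"
  have "(\<Sum>Y\<in>X. ee (of_rat (- B x (?r Y))) * basis_fun Y (lcoset L w))
      = (\<Sum>Y\<in>X. if Y = lcoset L w then er (- B x (?r (lcoset L w))) else 0)"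
    by (intro sum.cong refl) (auto simp: basis_fun_def er_def)
  also have "\<dots> = er (- B x (?r (lcoset L w)))" using finite_disc_module lcoset_X[OF w] by simp
  also have "\<dots> = er (- B x w)"
  proof (rule er_cong)
    have "- B x (?r (lcoset L w)) - - B x w = - B x (?r (lcoset L w) - w)" by (simp add: B_diff_right)
    also have "\<dots> \<in> \<int>" using B_dual(1)[OF x some_in_lcoset[OF L_subgroup]] by simp
    finally show "- B x (?r (lcoset L w)) - - B x w \<in> \<int>" .
  qed
  finally show ?thesis
    using weil x unfolding is_weil_rep_def disc_module_eq(2) minus_ii_powr by simp
qed

lemma entry_T_left:
  assumes A: "mat22 a b c d \<in> SL2Z" and w: "w \<in> dual" and v: "v \<in> dual"
  shows "entry (a + c) (b + d) c d w v = er (Q w) * entry a b c d w v"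
proof -
  let ?\<delta> = "basis_fun (lcoset L v)"
  have \<delta>: "?\<delta> \<in> free_space X" using basis_fun_free_space[OF lcoset_X[OF v]] .
  have "T_mp \<otimes>\<^bsub>Mp2Z\<^esub> (mat22 a b c d, 1) = (mat22 (a + c) (b + d) c d, 1)"
    using mp2_cocycle_T_left[OF A] by (simp add: Mp2Z_def T_mp_def mat22_mult)
  then have "entry (a + c) (b + d) c d w v = \<rho> T_mp (\<rho> (mat22 a b c d, 1) ?\<delta>) (lcoset L w)"
    using hom_GL_free_mult[OF weil_hom T_mp_carrier Mp2Z_carrier[OF A] \<delta>] by (simp add: rep_coeff_def)
  also have "\<dots> = (\<Sum>Y\<in>X. \<rho> (mat22 a b c d, 1) ?\<delta> Y * \<rho> T_mp (basis_fun Y) (lcoset L w))"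
    by (rule linear_on_free_space_expand[OF hom_GL_free_linear[OF weil_hom T_mp_carrier T_mp_carrier \<delta>]
        finite_disc_module hom_GL_free_closed[OF weil_hom Mp2Z_carrier[OF A] T_mp_carrier \<delta>]])
  also have "\<dots> = (\<Sum>Y\<in>X. if Y = lcoset L w then \<rho> (mat22 a b c d, 1) ?\<delta> (lcoset L w) * er (Q w) else 0)"
  proof (rule sum.cong[OF refl])
    fix Y assume "Y \<in> X"
    then obtain y where y: "y \<in> dual" "Y = lcoset L y" unfolding disc_module_eq by blast
    show "\<rho> (mat22 a b c d, 1) ?\<delta> Y * \<rho> T_mp (basis_fun Y) (lcoset L w)
      = (if Y = lcoset L w then \<rho> (mat22 a b c d, 1) ?\<delta> (lcoset L w) * er (Q w) else 0)"
    proof (cases "Y = lcoset L w")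
      case True
      then show ?thesis using weil_T[OF w] by (simp add: basis_fun_def)
    next
      case False
      then show ?thesis unfolding y(2) weil_T[OF y(1)] by (simp add: basis_fun_def)
    qed
  qed
  also have "\<dots> = er (Q w) * entry a b c d w v"
    using finite_disc_module lcoset_X[OF w] by (simp add: rep_coeff_def)
  finally show ?thesis .
qed

lemma entry_T_right:
  assumes A: "mat22 a b c d \<in> SL2Z" and v: "v \<in> dual"
  shows "entry a (a + b) c (c + d) w v = er (Q v) * entry a b c d w v"
proof -
  let ?\<delta> = "basis_fun (lcoset L v)"
  have \<delta>: "?\<delta> \<in> free_space X" using basis_fun_free_space[OF lcoset_X[OF v]] .
  have "(mat22 a b c d, 1) \<otimes>\<^bsub>Mp2Z\<^esub> T_mp = (mat22 a (a + b) c (c + d), 1)"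
    using mp2_cocycle_T_right[OF A] by (simp add: Mp2Z_def T_mp_def mat22_mult)
  then have "entry a (a + b) c (c + d) w v = \<rho> (mat22 a b c d, 1) (\<rho> T_mp ?\<delta>) (lcoset L w)"
    using hom_GL_free_mult[OF weil_hom Mp2Z_carrier[OF A] T_mp_carrier \<delta>] by (simp add: rep_coeff_def)
  also have "\<rho> T_mp ?\<delta> = (\<lambda>Z. er (Q v) * ?\<delta> Z)" by (rule weil_T[OF v])
  also have "\<rho> (mat22 a b c d, 1) (\<lambda>Z. er (Q v) * ?\<delta> Z) = (\<lambda>Z. er (Q v) * \<rho> (mat22 a b c d, 1) ?\<delta> Z)"
    by (rule linear_on_free_spaceD(2)[OF hom_GL_free_linear[OF weil_hom Mp2Z_carrier[OF A] T_mp_carrier \<delta>] \<delta>])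
  finally show ?thesis by (simp add: rep_coeff_def)
qed

text \<open>The sum over \<open>dual / L\<close> in the action of \<open>S\<close> is rewritten as
  an average over \<open>dual\<close>; this turns \<open>1 / sqrt disc\<close> into
  \<open>disc / sqrt disc = sqrt disc\<close>.\<close>

lemma entry_S_left:
  assumes A: "mat22 a b c d \<in> SL2Z" and "a > 0" "c > 0" and w: "w \<in> dual" and v: "v \<in> dual"
  shows "entry (- c) (- d) a b w v = er (- (of_nat (dim L) / 8)) * of_real (sqrt disc) *
      mean dual (\<lambda>u. er (- B w u) * entry a b c d u v)"
proof -
  let ?\<delta> = "basis_fun (lcoset L v)" and ?r = "\<lambda>Y. SOME y. y \<in> Y"
  let ?g = "\<lambda>u. er (- B w u) * entry a b c d u v"
  let ?k = "er (- (of_nat (dim L) / 8)) / of_real (sqrt disc)"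
  have \<delta>: "?\<delta> \<in> free_space X" using basis_fun_free_space[OF lcoset_X[OF v]] .
  have "S_mp \<otimes>\<^bsub>Mp2Z\<^esub> (mat22 a b c d, 1) = (mat22 (- c) (- d) a b, 1)"
    using mp2_cocycle_S_left[OF A assms(2,3)] by (simp add: Mp2Z_def S_mp_def mat22_mult)
  then have "entry (- c) (- d) a b w v = \<rho> S_mp (\<rho> (mat22 a b c d, 1) ?\<delta>) (lcoset L w)"
    using hom_GL_free_mult[OF weil_hom S_mp_carrier Mp2Z_carrier[OF A] \<delta>] by (simp add: rep_coeff_def)
  also have "\<dots> = (\<Sum>Y\<in>X. \<rho> (mat22 a b c d, 1) ?\<delta> Y * \<rho> S_mp (basis_fun Y) (lcoset L w))"
    by (rule linear_on_free_space_expand[OF hom_GL_free_linear[OF weil_hom S_mp_carrier S_mp_carrier \<delta>]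
        finite_disc_module hom_GL_free_closed[OF weil_hom Mp2Z_carrier[OF A] S_mp_carrier \<delta>]])
  also have "\<dots> = (\<Sum>Y\<in>X. ?k * ?g (?r Y))"
  proof (rule sum.cong[OF refl])
    fix Y assume "Y \<in> X"
    then obtain y where y: "y \<in> dual" "Y = lcoset L y" unfolding disc_module_eq by blast
    have r: "?r Y - y \<in> L" unfolding y(2) by (rule some_in_lcoset[OF L_subgroup])
    then have Y: "lcoset L (?r Y) = Y" unfolding y(2) lcoset_eq_iff[OF L_subgroup] .
    have "(?r Y - y) + y \<in> dual" using r L_subset_dual y(1) by (intro add_subgroup_add[OF dual_subgroup]) blast+
    then have rd: "?r Y \<in> dual" by simp
    show "\<rho> (mat22 a b c d, 1) ?\<delta> Y * \<rho> S_mp (basis_fun Y) (lcoset L w) = ?k * ?g (?r Y)"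
      using weil_S[OF rd w] unfolding rep_coeff_def Y by (simp add: symmetric[of w] mult_ac)
  qed
  also have "\<dots> = ?k * (of_nat disc * mean dual ?g)"
  proof -
    have "periodic_mod L dual ?g"
      unfolding periodic_mod_def
    proof (intro conjI ballI overlattice_finite_index_L[OF overlattice_dual])
      fix x h assume "x \<in> dual" "h \<in> L"
      then have "er (- B w (x + h)) = er (- B w x)"
        using B_dual(1)[OF w] by (intro er_cong) (simp add: B_add_right)
      moreover have "lcoset L (x + h) = lcoset L x"
        unfolding lcoset_eq_iff[OF L_subgroup] using \<open>h \<in> L\<close> by simp
      ultimately show "?g (x + h) = ?g x" by simp
    qed
    from mean_eq[OF this] have "(\<Sum>Y\<in>X. ?g (?r Y)) = of_nat disc * mean dual ?g"
      using disc_pos by (simp add: disc_module_eq)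
    then show ?thesis by (simp only: sum_distrib_left[symmetric])
  qed
  also have "\<dots> = er (- (of_nat (dim L) / 8)) * of_real (sqrt disc) * mean dual ?g"
  proof -
    have "complex_of_real (sqrt disc) * of_real (sqrt disc) = of_nat disc"
      by (simp add: of_real_mult[symmetric] del: of_real_mult)
    moreover have "complex_of_real (sqrt disc) \<noteq> 0" using disc_pos by simp
    ultimately have "of_nat disc / complex_of_real (sqrt disc) = of_real (sqrt disc)"
      by (metis nonzero_mult_div_cancel_right)
    then have "er (- (of_nat (dim L) / 8)) * (of_nat disc / complex_of_real (sqrt disc)) * mean dual ?g
        = er (- (of_nat (dim L) / 8)) * of_real (sqrt disc) * mean dual ?g" by simp
    then show ?thesis by (simp only: times_divide_eq_left times_divide_eq_right mult.assoc)
  qed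
  finally show ?thesis .
qed

text \<open>As an equivalence the claim can be moved along \<open>a\<close> in both directions, so
  that negative \<open>k\<close> needs no formula for the inverse of \<open>T\<close>.\<close>

lemma entry_shift_a:
  assumes c: "c > 0" and A: "mat22 a b c d \<in> SL2Z" and w: "w \<in> dual" and v: "v \<in> dual"
  shows "entry (a + k * c) (b + k * d) c d w v = weil_entry (a + k * c) (nat c) d w v
    \<longleftrightarrow> entry a b c d w v = weil_entry a (nat c) d w v"
proof -
  have step: "entry (a + c) (b + d) c d w v = weil_entry (a + c) (nat c) d w v
    \<longleftrightarrow> entry a b c d w v = weil_entry a (nat c) d w v" if "mat22 a b c d \<in> SL2Z" for a b
    using entry_T_left[OF that w v] weil_entry_shift_a[OF _ w, of "nat c" a d v] c by simp
  have SL: "mat22 (a + k * c) (b + k * d) c d \<in> SL2Z" for k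
    using A by (simp add: mat22_SL2Z algebra_simps)
  show ?thesis
  proof (induction k rule: int_induct[where k = 0])
    case (step1 k)
    then show ?case using step[OF SL[of k]] by (simp add: algebra_simps)
  next
    case (step2 k)
    then show ?case using step[OF SL[of "k - 1"]] by (simp add: algebra_simps)
  qed simp
qed

text \<open>The matrix is \<open>S T^d\<close>, the end point of the descent. It is the only place
  where right multiplication by \<open>T\<close> is used.\<close>

lemma entry_S_shift_d:
  assumes w: "w \<in> dual" and v: "v \<in> dual"
  shows "entry 0 (-1) 1 d w v = weil_entry 0 1 d w v"
proof -
  have step: "entry 0 (-1) 1 (d + 1) w v = weil_entry 0 1 (d + 1) w v
    \<longleftrightarrow> entry 0 (-1) 1 d w v = weil_entry 0 1 d w v" for d
  proof -
    have "mat22 0 (-1) 1 d \<in> SL2Z" by (simp add: mat22_SL2Z)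
    from entry_T_right[OF this v, of w] show ?thesis
      using weil_entry_shift_d[of 1 0 d w v] by (simp add: add.commute)
  qed
  show ?thesis
  proof (induction d rule: int_induct[where k = 0])
    case base
    show ?case using weil_S[OF v w] weil_entry_0[OF w v] by (simp add: rep_coeff_def S_mp_def)
  next
    case (step1 k)
    then show ?case using step by simp
  next
    case (step2 k)
    then show ?case using step[of "k - 1"] by simp
  qed
qed

theorem entry_eq_weil_entry:
  assumes "c > 0" "mat22 a b c d \<in> SL2Z" "w \<in> dual" "v \<in> dual"
  shows "entry a b c d w v = weil_entry a (nat c) d w v"
  using assms
proof (induction "nat c" arbitrary: a b c d w v rule: less_induct)
  case less
  note c = \<open>c > 0\<close> and A = \<open>mat22 a b c d \<in> SL2Z\<close> and w = \<open>w \<in> dual\<close> and v = \<open>v \<in> dual\<close>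
  have det: "a * d - b * c = 1" using A by (simp add: mat22_SL2Z)
  show ?case
  proof (cases "c = 1")
    case True
    have "a + (- a) * c = 0" "b + (- a) * d = -1" using det True by (simp_all add: algebra_simps)
    then show ?thesis
      using entry_shift_a[OF c A w v, of "- a"] entry_S_shift_d[OF w v, of d] True by simp
  next
    case False
    \<comment> \<open>Moves \<open>a\<close> to the residue \<open>a'\<close> strictly between
      \<open>- c\<close> and \<open>0\<close>. Then the matrix is \<open>S\<close> times one with
      first column \<open>(c, - a')\<close>, both positive as \<open>entry_S_left\<close> demands,
      and the new lower left entry \<open>- a'\<close> is smaller than \<open>c\<close>.\<close>
    define k where "k = - (a div c) - 1"
    define a' where "a' = a + k * c"
    define b' where "b' = b + k * d"
    have a': "a' = a mod c - c" unfolding a'_def k_def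
      by (simp add: minus_div_mult_eq_mod[symmetric] algebra_simps)
    have "a mod c \<noteq> 0"
    proof
      assume "a mod c = 0"
      then have "c dvd a" by (simp add: mod_eq_0_iff_dvd)
      then have "c dvd a * d - b * c" by simp
      then show False using det c False by simp
    qed
    then have bounds: "0 < - a'" "- a' < c"
      using c pos_mod_bound[of c a] pos_mod_sign[of c a] unfolding a' by linarith+
    have det': "c * (- b') - d * (- a') = 1" using det by (simp add: a'_def b'_def algebra_simps)
    have A'': "mat22 c d (- a') (- b') \<in> SL2Z" using det' by (simp add: mat22_SL2Z)
    have IH: "entry c d (- a') (- b') u v = weil_entry c (nat (- a')) (- b') u v" if "u \<in> dual" for u
      using less.hyps[OF _ bounds(1) A'' that v] bounds by simp
    have per: "periodic_on dual (\<lambda>u. er (- B w u) * entry c d (- a') (- b') u v)"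
    proof -
      have p1: "periodic_mod L dual (\<lambda>u. entry c d (- a') (- b') u v)"
        unfolding periodic_mod_def
      proof (intro conjI ballI overlattice_finite_index_L[OF overlattice_dual])
        fix x h assume "h \<in> L"
        then have "lcoset L (x + h) = lcoset L x" unfolding lcoset_eq_iff[OF L_subgroup] by simp
        then show "entry c d (- a') (- b') (x + h) v = entry c d (- a') (- b') x v" by simp
      qed
      have p2: "periodic_on dual (\<lambda>u. er (- B w u))"
        by (rule periodic_on_er'[OF overlattice_dual, of _ 0 "- w" 0]) (simp add: B_minus symmetric[of w])
      from p1 have "periodic_on dual (\<lambda>u. entry c d (- a') (- b') u v)" unfolding periodic_on_def by (rule exI)
      from periodic_on_combine[OF p2 this, of "(*)"] show ?thesis .
    qed
    have "entry (- (- a')) (- (- b')) c d w v = er (- (of_nat (dim L) / 8)) * of_real (sqrt disc) *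
        mean dual (\<lambda>u. er (- B w u) * entry c d (- a') (- b') u v)"
      by (rule entry_S_left[OF A'' c bounds(1) w v])
    also have "mean dual (\<lambda>u. er (- B w u) * entry c d (- a') (- b') u v)
        = mean dual (\<lambda>u. er (- B w u) * weil_entry (int (nat c)) (nat (- a')) (- b') u v)"
      using c by (intro mean_cong[OF per]) (simp add: IH)
    also have "er (- (of_nat (dim L) / 8)) * of_real (sqrt disc) * \<dots> = weil_entry (- int (nat (- a'))) (nat c) d w v"
      using det' c bounds by (intro weil_entry_S[OF _ _ w v]) simp_all
    finally have "entry a' b' c d w v = weil_entry a' (nat c) d w v" using bounds by simp
    then show ?thesis using entry_shift_a[OF c A w v, of k] by (simp add: a'_def b'_def)
  qed
qed

end

end

section \<open>Evaluation of the Gauss sums\<close>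

text \<open>One half \<open>P\<close> serves all functions at once; in \<open>gmean_half_sum\<close>
  the same half has to be used for every \<open>t\<close>.\<close>

lemma involution_halves:
  assumes "finite S" "\<And>x. x \<in> S \<Longrightarrow> i x \<in> S \<and> i (i x) = x \<and> i x \<noteq> x"
  shows "\<exists>P\<subseteq>S. \<forall>f :: 'a \<Rightarrow> complex. (\<forall>x\<in>S. f (i x) = f x) \<longrightarrow> sum f S = 2 * sum f P"
  using assms
proof (induction "card S" arbitrary: S rule: less_induct)
  case less
  show ?case
  proof (cases "S = {}")
    case False
    then obtain x where x: "x \<in> S" by blast
    note ix = less.prems(2)[OF x]
    let ?R = "S - {x, i x}"
    have "card ?R < card S" using x less.prems(1) by (intro psubset_card_mono) auto
    moreover have "i y \<in> ?R \<and> i (i y) = y \<and> i y \<noteq> y" if y: "y \<in> ?R" for y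
    proof -
      have iy: "i y \<in> S" "i (i y) = y" "i y \<noteq> y" using less.prems(2)[of y] y by simp_all
      moreover have "i y \<noteq> x" using iy(2) y by auto
      moreover have "i y \<noteq> i x"
      proof
        assume "i y = i x"
        then have "i (i y) = i (i x)" by simp
        then show False using iy(2) ix y by simp
      qed
      ultimately show ?thesis by simp
    qed
    ultimately obtain P where P: "P \<subseteq> ?R"
      "\<forall>f :: 'a \<Rightarrow> complex. (\<forall>x\<in>?R. f (i x) = f x) \<longrightarrow> sum f ?R = 2 * sum f P"
      using less.hyps[of ?R] less.prems(1) by auto
    have "sum f S = 2 * sum f (insert x P)" if f: "\<forall>x\<in>S. f (i x) = f x" for f :: "'a \<Rightarrow> complex"
    proof -
      have "sum f S = sum f ?R + sum f {x, i x}"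
        using less.prems(1) x ix by (intro sum.subset_diff) auto
      also have "sum f ?R = 2 * sum f P" using P(2) f by simp
      also have "sum f {x, i x} = 2 * f x"
      proof -
        have "x \<noteq> i x" using ix by metis
        then have "sum f {x, i x} = f x + f (i x)" by simp
        then show ?thesis using f x by simp
      qed
      also have "2 * sum f P + 2 * f x = 2 * sum f (insert x P)"
        using P(1) finite_subset[OF P(1)] less.prems(1) by (subst sum.insert) auto
      finally show ?thesis .
    qed
    then show ?thesis using P(1) x by (intro exI[of _ "insert x P"]) auto
  qed (intro exI[of _ "{}"], simp)
qed

text \<open>In place of an argument with norms: a fourth root of unity congruent to a sign modulo an
  odd prime is equal to it.\<close>

lemma fourth_root_congruent_sign:
  fixes h \<chi>' :: complex
  assumes M: "M > 0" "4 dvd M" and h: "h ^ 4 = 1" and s: "\<chi>' \<in> {1, -1}" and p: "prime p" "odd p" "\<not> p dvd D"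
    and z: "of_nat D * (h - \<chi>') = of_nat p * z" "z \<in> cyc M"
  shows "h = \<chi>'"
proof (rule ccontr)
  assume ne: "h \<noteq> \<chi>'"
  have i: "\<i> \<in> cyc M"
  proof -
    obtain k where "M = 4 * k" using M(2) by blast
    then have "er (1 / 4) \<in> cyc M" using M(1) by (intro cyc_er) simp_all
    then show ?thesis by (simp add: er_quarter)
  qed
  have "(h\<^sup>2 - 1) * (h\<^sup>2 + 1) = 0" using h by (simp add: algebra_simps flip: power_add power_mult)
  then have "h\<^sup>2 = 1 \<or> h\<^sup>2 = - 1" by (auto simp: eq_neg_iff_add_eq_0)
  then have "h \<in> {1, -1, \<i>, -\<i>}"
  proof
    assume "h\<^sup>2 = 1"
    then show ?thesis unfolding power2_eq_1_iff by blast
  next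
    assume "h\<^sup>2 = - 1"
    then have "h\<^sup>2 = \<i>\<^sup>2" by simp
    then show ?thesis unfolding power2_eq_iff by blast
  qed
  \<comment> \<open>The difference divides 2: if \<open>h = - \<chi>'\<close> it is twice a sign,
    and if \<open>h = i\<close> or \<open>h = - i\<close> its product with
    \<open>- h - \<chi>'\<close> is 2.\<close>
  then have "\<exists>r\<in>cyc M. (h - \<chi>') * r = 2"
  proof (cases "h \<in> {1, -1}")
    case True
    then have "h = - \<chi>'" using ne s by auto
    moreover have "\<chi>' * \<chi>' = 1" using s by auto
    moreover have "- \<chi>' \<in> cyc M" using s cyc_1[of M] cyc_minus[OF cyc_1] by auto
    ultimately show ?thesis by (intro bexI[of _ "- \<chi>'"]) simp_all
  next
    case False
    then have "h = \<i> \<or> h = - \<i>" using \<open>h \<in> {1, -1, \<i>, -\<i>}\<close> by auto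
    then have "(h - \<chi>') * (- h - \<chi>') = 2" "h \<in> cyc M" using s i cyc_minus[OF i] by (auto simp: algebra_simps)
    moreover have "\<chi>' \<in> cyc M" using s cyc_1[of M] cyc_minus[OF cyc_1] by auto
    ultimately show ?thesis using cyc_diff[OF cyc_minus] by blast
  qed
  then obtain r where r: "r \<in> cyc M" "(h - \<chi>') * r = 2" by blast
  have p0: "of_nat p \<noteq> (0 :: complex)" using p(1) by auto
  have "of_nat D * 2 = of_nat p * (z * r)" using z(1) r(2) by (metis mult.assoc)
  \<comment> \<open>A rational element of \<open>cyc M\<close> is an integer, so \<open>p\<close>
    would divide \<open>2 * D\<close>.\<close>
  then have "of_rat (of_nat (2 * D) / of_nat p) = z * r"
    using p0 by (simp add: of_rat_divide of_rat_mult field_simps)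
  then have "(of_nat (2 * D) / of_nat p :: rat) \<in> \<int>"
    using cyc_mult[OF z(2) r(1)] by (intro cyc_rational[OF M(1)]) simp
  then obtain j where "of_nat (2 * D) / of_nat p = (of_int j :: rat)" by (elim Ints_cases)
  then have "(of_int (int (2 * D)) :: rat) = of_int (j * int p)" using p(1) by (simp add: field_simps)
  then have "int (2 * D) = j * int p" by (simp only: of_int_eq_iff)
  then have "int p dvd int (2 * D)" by simp
  then have "p dvd 2 * D" by (simp only: of_nat_dvd_iff)
  then have "p dvd 2" using p prime_dvd_mult_iff by blast
  then have "p = 2" using p(1) by (simp add: primes_dvd_imp_eq)
  then show False using p(2) by simp
qed

section \<open>Gauss sums for multipliers prime to an annihilator of the discriminant group\<close>

context pos_def_even_lattice
begin

lemma annihilator_invertible: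
  assumes N: "\<And>x. x \<in> dual \<Longrightarrow> scl (of_nat N) x \<in> L" and c: "coprime c N" and x: "x \<in> dual"
    and cx: "scl (of_nat c) x \<in> L"
  shows "x \<in> L"
proof -
  obtain \<alpha> \<beta> where "\<alpha> * int c + \<beta> * int N = 1" using c by (metis bezout_int coprime_iff_gcd_eq_1 coprime_int_iff)
  then have "(of_int (\<alpha> * int c + \<beta> * int N) :: rat) = 1" by simp
  then have "x = scl (of_int \<alpha>) (scl (of_nat c) x) + scl (of_int \<beta>) (scl (of_nat N) x)"
    by (simp add: scale_left_distrib[symmetric])
  also have "\<dots> \<in> L" using cx N[OF x] by (intro add_subgroup_add[OF L_subgroup] scl_int_subgroup[OF L_subgroup])
  finally show ?thesis .
qed

text \<open>\<open>L\<close> lies between \<open>dual\<close> and its \<open>N\<close>-fold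
  multiple, so \<open>disc\<close> divides \<open>N ^ dim L\<close>.\<close>

lemma annihilator_disc:
  assumes N: "N > 0" "\<And>x. x \<in> dual \<Longrightarrow> scl (of_nat N) x \<in> L" and p: "prime p" "\<not> p dvd N"
  shows "\<not> p dvd disc"
proof
  assume "p dvd disc"
  have sub: "scl (of_nat N) ` dual \<subseteq> L" using N(2) by blast
  note fi = index_multiples_dual(1)[OF N(1)]
  have "finite_index (scl (of_nat N) ` dual) L" by (rule finite_index_mono(1)[OF fi sub L_subset_dual L_subgroup])
  from index_mult[OF this overlattice_finite_index_L[OF overlattice_dual]]
  have "disc dvd N ^ dim L" using index_multiples_dual(2)[OF N(1)] by simp
  then have "p dvd N ^ dim L" using \<open>p dvd disc\<close> dvd_trans by blast
  then show False using p prime_dvd_power by blast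
qed

text \<open>Since \<open>c\<close> and \<open>N\<close> are coprime, every element of
  \<open>dual\<close> has the form \<open>x + c u\<close> with \<open>x \<in> L\<close> and
  \<open>u \<in> dual\<close>; the cross term of \<open>Q (x + c u) / c\<close> is the integer
  \<open>B x u\<close>. The decomposition is not unique, which averages tolerate.\<close>

lemma mean_split:
  assumes N: "\<And>x. x \<in> dual \<Longrightarrow> scl (of_nat N) x \<in> L" and c: "c > 0" "coprime c N"
  shows "mean dual (\<lambda>s. er (Q s / of_nat c)) = mean L (\<lambda>x. er (Q x / of_nat c)) * mean dual (\<lambda>u. er (of_nat c * Q u))"
proof -
  have c0: "of_nat c \<noteq> (0 :: rat)" using c by simp
  let ?\<phi> = "\<lambda>(x, u). x + scl (of_nat c) u"
  have per: "periodic_on dual (\<lambda>s. er (Q s / of_nat c))"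
    by (rule periodic_on_er'[OF overlattice_dual, of _ "1 / of_nat c" 0 0]) (simp add: B_zero)
  have perL: "periodic_on L (\<lambda>s. er (Q s / of_nat c))"
    by (rule periodic_on_er'[OF overlattice_L, of _ "1 / of_nat c" 0 0]) (simp add: B_zero)
  have perd: "periodic_on dual (\<lambda>u. er (of_nat c * Q u))"
    by (rule periodic_on_er'[OF overlattice_dual, of _ "of_nat c" 0 0]) (simp add: B_zero)
  obtain H where H: "periodic_mod H L (\<lambda>s. er (Q s / of_nat c))" using perL unfolding periodic_on_def by blast
  obtain K where K: "periodic_mod K dual (\<lambda>u. er (of_nat c * Q u))" using perd unfolding periodic_on_def by blast
  have Ld: "x \<in> L \<Longrightarrow> x \<in> dual" for x using L_subset_dual by blast
  have img: "?\<phi> ` (L \<times> dual) = dual"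
  proof (intro equalityI subsetI)
    fix s assume "s \<in> ?\<phi> ` (L \<times> dual)"
    then obtain z where z: "s = ?\<phi> z" "z \<in> L \<times> dual" by blast
    obtain x u where "z = (x, u)" by (cases z)
    with z have "s = x + scl (of_nat c) u" "x \<in> L" "u \<in> dual" by simp_all
    then show "s \<in> dual" using add_subgroup_add[OF dual_subgroup Ld scl_nat_subgroup[OF dual_subgroup]] by simp
  next
    fix s assume s: "s \<in> dual"
    obtain \<alpha> \<beta> where "\<alpha> * int c + \<beta> * int N = 1" using c by (metis bezout_int coprime_iff_gcd_eq_1 coprime_int_iff)
    then have "(of_int (\<alpha> * int c + \<beta> * int N) :: rat) = 1" by simp
    then have "s = ?\<phi> (scl (of_int \<beta>) (scl (of_nat N) s), scl (of_int \<alpha>) s)"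
      by (simp add: scale_left_distrib[symmetric] add.commute mult.commute)
    moreover have "scl (of_int \<beta>) (scl (of_nat N) s) \<in> L" "scl (of_int \<alpha>) s \<in> dual"
      using scl_int_subgroup[OF L_subgroup N[OF s]] scl_int_subgroup[OF dual_subgroup s] .
    ultimately show "s \<in> ?\<phi> ` (L \<times> dual)" by blast
  qed
  have add: "?\<phi> (x + y) = ?\<phi> x + ?\<phi> y" for x y by (cases x; cases y) (simp add: scale_right_distrib algebra_simps)
  note re = mean_reindex_surj[OF add_subgroup_Times[OF L_subgroup dual_subgroup] add img per]
  have "mean dual (\<lambda>s. er (Q s / of_nat c)) = mean (L \<times> dual) (\<lambda>z. er (Q (?\<phi> z) / of_nat c))" using re(2) by simp
  also have "\<dots> = mean (L \<times> dual) (\<lambda>(x, u). er (Q x / of_nat c) * er (of_nat c * Q u))"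
  proof (rule mean_cong[OF re(1)])
    fix z assume "z \<in> L \<times> dual"
    moreover obtain x u where xu: "z = (x, u)" by (cases z)
    ultimately have z: "z = (x, u)" "x \<in> L" "u \<in> dual" by simp_all
    have "Q (x + scl (of_nat c) u) / of_nat c - (Q x / of_nat c + of_nat c * Q u) = B x u"
      using c0 by (simp add: Q_add Q_scl B_scl_right power2_eq_square field_simps)
    then have "er (Q (x + scl (of_nat c) u) / of_nat c) = er (Q x / of_nat c + of_nat c * Q u)"
      using B_dual(2)[OF z(2,3)] by (intro er_cong) simp
    then show "er (Q (?\<phi> z) / of_nat c) = (\<lambda>(x, u). er (Q x / of_nat c) * er (of_nat c * Q u)) z"
      unfolding z(1) by (simp add: er_add)
  qed
  also have "\<dots> = mean L (\<lambda>x. er (Q x / of_nat c)) * mean dual (\<lambda>u. er (of_nat c * Q u))"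
    by (rule mean_Times[OF H K])
  finally show ?thesis .
qed

text \<open>The similitude \<open>(x, y) \<mapsto> (\<alpha> x + \<beta> y, \<alpha> y - \<beta> x)\<close> multiplies \<open>Q x + Q y\<close> by \<open>\<alpha>\<^sup>2 + \<beta>\<^sup>2\<close>.\<close>

lemma mean_square_similitude:
  fixes \<alpha> \<beta> j :: int
  assumes A: "overlattice A" and H: "periodic_mod H A (\<lambda>x. er (r * Q x))"
    and inv: "\<And>x. x \<in> A \<Longrightarrow> scl (of_int (j * (\<alpha>\<^sup>2 + \<beta>\<^sup>2) - 1)) x \<in> H"
  shows "(mean A (\<lambda>x. er (r * of_int (\<alpha>\<^sup>2 + \<beta>\<^sup>2) * Q x)))\<^sup>2 = (mean A (\<lambda>x. er (r * Q x)))\<^sup>2"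
proof -
  let ?\<phi> = "\<lambda>(x, y). (scl (of_int \<alpha>) x + scl (of_int \<beta>) y, scl (of_int \<alpha>) y - scl (of_int \<beta>) x)"
  let ?F = "\<lambda>(x, y). er (r * Q x) * er (r * Q y)"
  have sA: "add_subgroup A" using A by (simp add: overlattice_def)
  have sc: "scl (of_int k) x \<in> A" if "x \<in> A" for k x by (rule scl_int_subgroup[OF sA that])
  have "periodic_on A (\<lambda>x. er (r * of_int (\<alpha>\<^sup>2 + \<beta>\<^sup>2) * Q x))"
    by (rule periodic_on_er'[OF A, of _ "r * of_int (\<alpha>\<^sup>2 + \<beta>\<^sup>2)" 0 0]) (simp add: B_zero)
  then obtain K where K: "periodic_mod K A (\<lambda>x. er (r * of_int (\<alpha>\<^sup>2 + \<beta>\<^sup>2) * Q x))" unfolding periodic_on_def by blast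
  have add: "?\<phi> (x + y) = ?\<phi> x + ?\<phi> y" for x y
    by (cases x; cases y) (simp add: scale_right_distrib algebra_simps)
  have img: "?\<phi> z \<in> A \<times> A" if "z \<in> A \<times> A" for z
    using that by (auto intro!: add_subgroup_add[OF sA] add_subgroup_diff[OF sA] sc)
  have surj: "\<exists>x\<in>A \<times> A. z - ?\<phi> x \<in> H \<times> H" if zA: "z \<in> A \<times> A" for z
  proof -
    obtain s t where st: "z = (s, t)" by (cases z)
    with zA have z: "z = (s, t)" "s \<in> A" "t \<in> A" by simp_all
    have sH: "add_subgroup H" using H by (simp add: periodic_mod_def finite_index_def)
    \<comment> \<open>The adjoint similitude scaled by \<open>j\<close>: its composition with
      \<open>?\<phi>\<close> is multiplication by
      \<open>j * (\<alpha>\<^sup>2 + \<beta>\<^sup>2)\<close>, the identity modulo \<open>H\<close>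
      by \<open>inv\<close>.\<close>
    let ?x = "(scl (of_int j) (scl (of_int \<alpha>) s - scl (of_int \<beta>) t), scl (of_int j) (scl (of_int \<beta>) s + scl (of_int \<alpha>) t))"
    have e: "z - ?\<phi> ?x = (- scl (of_int (j * (\<alpha>\<^sup>2 + \<beta>\<^sup>2) - 1)) s, - scl (of_int (j * (\<alpha>\<^sup>2 + \<beta>\<^sup>2) - 1)) t)"
      unfolding z(1)
      by (simp add: scale_left_distrib scale_left_diff_distrib scale_right_distrib scale_right_diff_distrib
          power2_eq_square algebra_simps)
    have "?x \<in> A \<times> A" using z by (auto intro!: add_subgroup_add[OF sA] add_subgroup_diff[OF sA] sc)
    moreover have "z - ?\<phi> ?x \<in> H \<times> H" unfolding e using z inv add_subgroup_minus[OF sH] by simp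
    ultimately show ?thesis by (rule bexI[rotated])
  qed
  note re = periodic_on_reindex[OF add_subgroup_Times[OF sA sA] add img periodic_mod_Times[OF H H] surj]
    mean_reindex[OF add_subgroup_Times[OF sA sA] add img periodic_mod_Times[OF H H] surj]
  have "(mean A (\<lambda>x. er (r * Q x)))\<^sup>2 = mean (A \<times> A) (\<lambda>z. ?F (?\<phi> z))"
    using re(2) mean_Times[OF H H] by (simp add: power2_eq_square)
  also have "\<dots> = mean (A \<times> A) (\<lambda>(x, y). er (r * of_int (\<alpha>\<^sup>2 + \<beta>\<^sup>2) * Q x) * er (r * of_int (\<alpha>\<^sup>2 + \<beta>\<^sup>2) * Q y))"
  proof (rule mean_cong[OF re(1)])
    fix z :: "'v \<times> 'v"
    obtain x y where z: "z = (x, y)" by (cases z)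
    have "r * Q (scl (of_int \<alpha>) x + scl (of_int \<beta>) y) + r * Q (scl (of_int \<alpha>) y - scl (of_int \<beta>) x)
        = r * of_int (\<alpha>\<^sup>2 + \<beta>\<^sup>2) * Q x + r * of_int (\<alpha>\<^sup>2 + \<beta>\<^sup>2) * Q y"
      unfolding Q_add Q_diff Q_scl B_scl_left B_scl_right symmetric[of y x] by (simp add: algebra_simps)
    then show "?F (?\<phi> z) = (\<lambda>(x, y). er (r * of_int (\<alpha>\<^sup>2 + \<beta>\<^sup>2) * Q x) * er (r * of_int (\<alpha>\<^sup>2 + \<beta>\<^sup>2) * Q y)) z"
      unfolding z by (simp only: prod.case er_add[symmetric])
  qed
  also have "\<dots> = (mean A (\<lambda>x. er (r * of_int (\<alpha>\<^sup>2 + \<beta>\<^sup>2) * Q x)))\<^sup>2"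
    using mean_Times[OF K K] by (simp add: power2_eq_square)
  finally show ?thesis by simp
qed

end

locale annihilated_lattice = pos_def_even_lattice scl L B
  for scl :: "rat \<Rightarrow> 'v::ab_group_add \<Rightarrow> 'v" and L :: "'v set" and B :: "'v \<Rightarrow> 'v \<Rightarrow> rat" +
  fixes N :: nat
  assumes N_pos: "N > 0" and N_dual: "x \<in> dual \<Longrightarrow> scl (of_nat N) x \<in> L"
begin

text \<open>The function \<open>G\<close> of the overview.\<close>

definition gmean :: "nat \<Rightarrow> complex"
  where "gmean t = mean dual (\<lambda>u. er (of_nat t * Q u))"

lemma periodic_er_mult: "periodic_mod L dual (\<lambda>u. er (of_nat t * Q u))"
  using periodic_er_Q_dual unfolding periodic_mod_def er_power[symmetric] by simp

lemma norm_gmean: "coprime t N \<Longrightarrow> gmean t * cnj (gmean t) = 1 / of_nat disc"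
  unfolding gmean_def using annihilator_invertible[OF N_dual] by (intro norm_mean_dual) blast

lemma gmean_1: "gmean 1 = er (of_nat (dim L) / 8) / of_real (sqrt disc)"
  unfolding gmean_def using milgram by simp

text \<open>Milgram's formula for the lattice rescaled by \<open>c\<close> gives the average of
  \<open>Q / c\<close> over \<open>dual\<close>, and \<open>mean_split\<close> factors that average.
  So the Gauss sum on \<open>L\<close> and \<open>gmean c\<close> determine each other.\<close>

lemma mean_L_gmean:
  assumes c: "c > 0" "coprime c N"
  shows "mean L (\<lambda>x. er (Q x / of_nat c)) * gmean c
    = er (of_nat (dim L) / 8) / of_real (sqrt disc * sqrt c ^ dim L)"
proof -
  have "sqrt (real (disc * c ^ dim L)) = sqrt disc * sqrt c ^ dim L"
    by (simp add: real_sqrt_mult real_sqrt_power)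
  then show ?thesis
    using mean_split[OF N_dual c] milgram_rescaled[OF c(1)] unfolding gmean_def by simp
qed

text \<open>A similitude whose multiplier is \<open>- 1\<close> modulo \<open>c\<close> gives
  \<open>(cnj ?G)\<^sup>2 = ?G\<^sup>2\<close> for the Gauss sum \<open>?G\<close> of
  \<open>Q / c\<close> on \<open>L\<close>. Together with \<open>?G * cnj ?G * c ^ n = 1\<close>
  this makes \<open>sqrt c ^ n * ?G\<close> a fourth root of unity, and \<open>mean_L_gmean\<close>
  carries the result over to \<open>gmean c\<close>.\<close>

lemma gmean_fourth_power:
  assumes c: "odd c" "coprime c N"
  shows "(of_nat disc * gmean c) ^ 4 = (of_nat disc)\<^sup>2 * er (of_nat (dim L) / 2)"
proof -
  let ?G = "mean L (\<lambda>x. er (Q x / of_nat c))" and ?n = "dim L"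
  have c0: "c > 0" using c(1) by (cases c) auto
  obtain \<alpha> \<beta> where ab: "int c dvd \<alpha>\<^sup>2 + \<beta>\<^sup>2 + 1" using neg_one_sum_two_squares[OF c(1)] by blast
  then obtain k where k: "\<alpha>\<^sup>2 + \<beta>\<^sup>2 + 1 = int c * k" by blast
  have perc: "periodic_mod (multiples c) L (\<lambda>x. er (1 / of_nat c * Q x))"
    unfolding periodic_mod_def
  proof (intro conjI ballI index_multiples(1)[OF c0])
    fix x h assume x: "x \<in> L" and "h \<in> multiples c"
    then obtain l where l: "l \<in> L" "h = scl (of_nat c) l" by blast
    have "1 / of_nat c * Q (x + h) - 1 / of_nat c * Q x = of_nat c * Q l + B x l"
      using c0 unfolding l(2) by (simp add: Q_add Q_scl B_scl_right power2_eq_square field_simps)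
    then show "er (1 / of_nat c * Q (x + h)) = er (1 / of_nat c * Q x)"
      using even[OF l(1)] B_int[OF x l(1)] by (intro er_cong) simp
  qed
  have "scl (of_int ((- 1) * (\<alpha>\<^sup>2 + \<beta>\<^sup>2) - 1)) x \<in> multiples c" if "x \<in> L" for x
  proof -
    have e: "(- 1) * (\<alpha>\<^sup>2 + \<beta>\<^sup>2) - 1 = int c * (- k)" using k by simp
    have "scl (of_int ((- 1) * (\<alpha>\<^sup>2 + \<beta>\<^sup>2) - 1)) x = scl (of_nat c) (scl (of_int (- k)) x)"
      unfolding e by simp
    then show ?thesis using scl_int_subgroup[OF L_subgroup that] by (rule image_eqI)
  qed
  from mean_square_similitude[OF overlattice_L perc this]
  have "(mean L (\<lambda>x. er (1 / of_nat c * of_int (\<alpha>\<^sup>2 + \<beta>\<^sup>2) * Q x)))\<^sup>2 = ?G\<^sup>2" by simp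
  moreover have "mean L (\<lambda>x. er (1 / of_nat c * of_int (\<alpha>\<^sup>2 + \<beta>\<^sup>2) * Q x)) = cnj ?G"
  proof -
    have perL: "periodic_on L (\<lambda>x. er (Q x / of_nat c))" using perc unfolding periodic_on_def by auto
    have "cnj ?G = mean L (\<lambda>x. cnj (er (Q x / of_nat c)))" using mean_cnj[OF perL] by simp
    also have "\<dots> = mean L (\<lambda>x. er (1 / of_nat c * of_int (\<alpha>\<^sup>2 + \<beta>\<^sup>2) * Q x))"
    proof (rule mean_cong[OF periodic_on_compose[OF perL]])
      fix x assume x: "x \<in> L"
      have "\<alpha>\<^sup>2 + \<beta>\<^sup>2 = int c * k - 1" using k by simp
      then have R: "of_int (\<alpha>\<^sup>2 + \<beta>\<^sup>2) = of_nat c * of_int k - (1 :: rat)" by simp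
      have "- (Q x / of_nat c) - 1 / of_nat c * of_int (\<alpha>\<^sup>2 + \<beta>\<^sup>2) * Q x = - of_int k * Q x"
        unfolding R using c0 by (simp add: field_simps)
      then show "cnj (er (Q x / of_nat c)) = er (1 / of_nat c * of_int (\<alpha>\<^sup>2 + \<beta>\<^sup>2) * Q x)"
        unfolding er_cnj using even[OF x] by (intro er_cong) simp
    qed
    finally show ?thesis by simp
  qed
  ultimately have G2: "(cnj ?G)\<^sup>2 = ?G\<^sup>2" by simp
  define s where "s = complex_of_real (sqrt disc)"
  define t where "t = complex_of_real (sqrt c ^ ?n)"
  have s: "s * s = of_nat disc" "s \<noteq> 0" "cnj s = s" and t: "t \<noteq> 0" "cnj t = t"
    using disc_pos c0 by (simp_all add: s_def t_def of_real_mult[symmetric] del: of_real_mult)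
  have Gg: "?G * gmean c = er (of_nat ?n / 8) / (s * t)"
    using mean_L_gmean[OF c0 c(2)] by (simp add: s_def t_def)
  then have cGg: "cnj (?G * gmean c) = er (- (of_nat ?n / 8)) / (s * t)" using s t by (simp add: er_cnj)
  have "(?G * cnj ?G) * (gmean c * cnj (gmean c)) = cnj (?G * gmean c) * (?G * gmean c)" by simp
  also have "\<dots> = (er (- (of_nat ?n / 8)) * er (of_nat ?n / 8)) / (s * t * (s * t))"
    unfolding cGg unfolding Gg by simp
  finally have "(?G * cnj ?G) * (1 / (s * s)) = 1 / (s * t * (s * t))"
    unfolding norm_gmean[OF c(2)] er_minus_mult s(1) .
  \<comment> \<open>The modulus of \<open>?G\<close>, from those of \<open>gmean c\<close> and of
    their product.\<close>
  then have GG: "(?G * cnj ?G) * (t * t) = 1" using s(2) t(1) by (simp add: field_simps)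
  have "?G ^ 4 = ?G\<^sup>2 * ?G\<^sup>2" by (simp flip: power_add)
  also have "\<dots> = (?G * cnj ?G)\<^sup>2" unfolding power_mult_distrib G2 ..
  finally have "?G ^ 4 = (?G * cnj ?G)\<^sup>2" .
  moreover have "t ^ 4 = (t * t)\<^sup>2" by (simp add: power4_eq_xxxx power2_eq_square)
  ultimately have "?G ^ 4 * t ^ 4 = ((?G * cnj ?G) * (t * t))\<^sup>2" by (simp only: power_mult_distrib)
  then have G4: "?G ^ 4 * t ^ 4 = 1" unfolding GG by simp
  have "(?G * gmean c) ^ 4 = er (of_nat ?n / 2) / (s * t) ^ 4"
    unfolding Gg power_divide er_power by simp
  then have "(?G ^ 4 * t ^ 4) * (s * gmean c) ^ 4 = er (of_nat ?n / 2)"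
    using s(2) t(1) by (simp add: power_mult_distrib field_simps)
  then have "(s * gmean c) ^ 4 = er (of_nat ?n / 2)" unfolding G4 by simp
  then have "s ^ 4 * (s * gmean c) ^ 4 = (of_nat disc)\<^sup>2 * er (of_nat ?n / 2)"
    by (simp add: s(1)[symmetric] power4_eq_xxxx power2_eq_square)
  then show ?thesis by (simp add: s(1)[symmetric] power_mult_distrib[symmetric] mult.assoc)
qed

lemma gmean_sum:
  obtains T where "transversal L dual T" "\<And>t. of_nat disc * gmean t = (\<Sum>u\<in>T. er (of_nat t * Q u))"
proof -
  have fi: "finite_index L dual" by (rule overlattice_finite_index_L[OF overlattice_dual])
  obtain T where T: "transversal L dual T" using finite_index_transversal[OF fi] .
  have "of_nat disc * gmean t = (\<Sum>u\<in>T. er (of_nat t * Q u))" for t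
    unfolding gmean_def mean_transversal[OF periodic_er_mult T] transversal_card[OF fi T]
    using disc_pos by simp
  with that T show thesis by blast
qed

lemma N_square_Q: "x \<in> dual \<Longrightarrow> of_nat (N\<^sup>2) * Q x \<in> \<int>"
  using even[OF N_dual, of x] by (simp add: Q_scl)

text \<open>In the order \<open>8 * N\<^sup>2\<close> the factor \<open>N\<^sup>2\<close> clears the
  denominators of \<open>Q\<close> on \<open>dual\<close>, and 8 accommodates the phases
  \<open>er (n / 8)\<close>.\<close>

lemma er_Q_cyc: "x \<in> dual \<Longrightarrow> er (of_nat t * Q x) \<in> cyc (8 * N\<^sup>2)"
proof (rule cyc_er)
  assume "x \<in> dual"
  then have "of_nat (8 * t) * (of_nat (N\<^sup>2) * Q x) \<in> \<int>" by (intro Ints_mult N_square_Q) simp_all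
  then show "of_nat (8 * N\<^sup>2) * (of_nat t * Q x) \<in> \<int>" by (simp add: mult_ac)
qed (use N_pos in simp)

lemma er_eighth_cyc: "er (of_int k / 8) \<in> cyc (8 * N\<^sup>2)"
  using N_pos by (intro cyc_er) simp_all

lemma disc_gmean_cyc: "of_nat disc * gmean t \<in> cyc (8 * N\<^sup>2)"
proof -
  obtain T where T: "transversal L dual T" "\<And>t. of_nat disc * gmean t = (\<Sum>u\<in>T. er (of_nat t * Q u))"
    by (rule gmean_sum) blast
  then show ?thesis unfolding T(2) by (intro cyc_sum er_Q_cyc) (auto simp: transversal_def)
qed

text \<open>By Milgram's formula \<open>sqrt disc\<close> is itself a Gauss sum times an eighth root
  of unity.\<close>

lemma sqrt_disc_cyc: "of_real (sqrt disc) \<in> cyc (8 * N\<^sup>2)"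
proof -
  have "complex_of_real (sqrt disc) * of_real (sqrt disc) = of_nat disc"
    by (simp add: of_real_mult[symmetric] del: of_real_mult)
  moreover have "complex_of_real (sqrt disc) \<noteq> 0" using disc_pos by simp
  ultimately have "of_nat disc / complex_of_real (sqrt disc) = of_real (sqrt disc)"
    by (metis nonzero_mult_div_cancel_right)
  then have "of_nat disc * gmean 1 * er (of_int (- int (dim L)) / 8) = of_real (sqrt disc)"
    using er_minus_mult[of "of_nat (dim L) / 8"] unfolding gmean_1 by (simp add: mult_ac)
  then show ?thesis using cyc_mult[OF disc_gmean_cyc[of 1] er_eighth_cyc[of "- int (dim L)"]] by simp
qed

lemma disc_gmean_power:
  assumes p: "prime p"
  shows "\<exists>z\<in>cyc (8 * N\<^sup>2). (of_nat disc * gmean t) ^ p = of_nat disc * gmean (p * t) + of_nat p * z"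
proof -
  obtain T where T: "transversal L dual T" "\<And>t. of_nat disc * gmean t = (\<Sum>u\<in>T. er (of_nat t * Q u))"
    by (rule gmean_sum) blast
  have "finite T" "\<And>u. u \<in> T \<Longrightarrow> er (of_nat t * Q u) \<in> cyc (8 * N\<^sup>2)"
    using T(1) by (auto simp: transversal_def intro!: er_Q_cyc)
  from cyc_sum_power_prime[OF p this] show ?thesis
    unfolding T(2) er_power by (simp add: mult.assoc)
qed

text \<open>With \<open>c = p * t\<close> the \<open>p\<close>-th power of the formula for
  \<open>t\<close> is, modulo \<open>p\<close>, the formula for \<open>c\<close>; the Legendre
  symbol arises from \<open>sqrt disc ^ p\<close> by Euler's criterion. That the symbol is a sign
  belongs to the claim, because a sign survives the odd power \<open>p\<close>.\<close>

lemma gmean_odd: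
  assumes "odd c" "coprime c N"
  shows "kronecker (int disc) (int c) \<in> {1, -1} \<and>
    gmean c = of_int (kronecker (int disc) (int c)) * er (of_nat (dim L * c) / 8) / of_real (sqrt disc)"
  using assms
proof (induction c rule: less_induct)
  case (less c)
  let ?n = "dim L" and ?M = "8 * N\<^sup>2"
  show ?case
  proof (cases "c = 1")
    case True
    then show ?thesis using gmean_1 by (simp add: kronecker_1)
  next
    case False
    then obtain p where p: "prime p" "p dvd c" using prime_factor_nat by blast
    then obtain t where c: "c = p * t" by blast
    have odd: "odd p" "odd t" using less.prems(1) c by auto
    then have t0: "t > 0" by (cases t) auto
    have tc: "t < c" using c t0 prime_gt_1_nat[OF p(1)] by simp
    have "coprime t N" "coprime p N" using less.prems(2) c by simp_all
    then have pN: "\<not> p dvd N" using p(1) coprime_common_divisor_nat not_prime_unit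
      by (metis dvd_refl is_unit_gcd nat_dvd_1_iff_1)
    have pD: "\<not> p dvd disc" by (rule annihilator_disc[OF N_pos N_dual p(1) pN])
    have p2: "2 < p" using odd(1) prime_ge_2_nat[OF p(1)] by (cases "p = 2") auto
    let ?k = "kronecker (int disc) (int t)" and ?l = "Legendre (int disc) (int p)"
    have IH: "?k \<in> {1, -1}" "gmean t = of_int ?k * er (of_nat (?n * t) / 8) / of_real (sqrt disc)"
      using less.IH[OF tc odd(2) \<open>coprime t N\<close>] by blast+
    have kc: "kronecker (int disc) (int c) = ?l * ?k"
      using kronecker_prime_times[OF p(1) t0, of "int disc"] c p2 by simp
    have l: "?l \<in> {1, -1}" using pD by (simp add: Legendre_def cong_0_iff)
    define s where "s = complex_of_real (sqrt disc)"
    have s: "s * s = of_nat disc" "s \<noteq> 0"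
      using disc_pos by (simp_all add: s_def of_real_mult[symmetric] del: of_real_mult)
    have s_cyc: "s \<in> cyc ?M" unfolding s_def by (rule sqrt_disc_cyc)
    \<comment> \<open>The factor by which \<open>gmean c\<close> differs from the asserted value
      without its symbol; it has to be shown equal to that symbol.\<close>
    define h where "h = s * gmean c * er (- (of_nat (?n * c) / 8))"
    have h_eq: "of_nat disc * gmean c = h * s * er (of_nat (?n * c) / 8)"
      using er_minus_mult[of "of_nat (?n * c) / 8"] by (simp add: h_def s(1)[symmetric] mult_ac)
    have "h ^ 4 = 1"
    proof -
      have "(of_nat disc)\<^sup>2 * er (of_nat ?n / 2) = (h * s * er (of_nat (?n * c) / 8)) ^ 4"
        using gmean_fourth_power[OF less.prems] unfolding h_eq by simp
      also have "\<dots> = h ^ 4 * (s * s)\<^sup>2 * er (of_nat (?n * c) / 2)"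
      proof -
        have "er (of_nat (?n * c) / 8) ^ 4 = er (of_nat (?n * c) / 2)" by (simp add: er_power mult.commute)
        then show ?thesis unfolding power_mult_distrib by (simp add: power4_eq_xxxx power2_eq_square)
      qed
      finally have "er (of_nat ?n / 2) = h ^ 4 * er (of_nat (?n * c) / 2)"
        unfolding s(1) using disc_pos by (simp add: mult_ac)
      moreover have "er (of_nat (?n * c) / 2) = er (of_nat ?n / 2)"
      proof (rule er_cong)
        obtain j where "c = 2 * j + 1" using less.prems(1) by (auto elim: oddE)
        then have "of_nat (?n * c) / 2 - of_nat ?n / 2 = (of_nat (?n * j) :: rat)" by (simp add: field_simps)
        then show "of_nat (?n * c) / 2 - of_nat ?n / 2 \<in> (\<int> :: rat set)" by (metis Ints_of_nat)
      qed
      ultimately show ?thesis by simp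
    qed
    obtain z where z: "z \<in> cyc ?M" "(of_nat disc * gmean t) ^ p = of_nat disc * gmean c + of_nat p * z"
      using disc_gmean_power[OF p(1), of t] c by auto
    have "of_nat disc * gmean t = of_int ?k * s * er (of_nat (?n * t) / 8)"
      unfolding IH(2) using s by (simp add: s_def[symmetric] s(1)[symmetric])
    then have "(of_nat disc * gmean t) ^ p = of_int (?k ^ p) * s ^ p * er (of_nat (?n * c) / 8)"
      by (simp add: power_mult_distrib er_power c mult_ac)
    also have "?k ^ p = ?k" using IH(1) odd(1) by auto
    also have "s ^ p = s * of_nat disc ^ ((p - 1) div 2)"
    proof -
      have "p = 1 + 2 * ((p - 1) div 2)" using odd(1) by (auto elim: oddE)
      then have "s ^ p = s ^ (1 + 2 * ((p - 1) div 2))" by (rule arg_cong)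
      then show ?thesis by (simp add: power_mult power2_eq_square s(1))
    qed
    finally have 1: "(of_nat disc * gmean t) ^ p
      = of_int ?k * (s * of_nat disc ^ ((p - 1) div 2)) * er (of_nat (?n * c) / 8)" .
    have "[?l = int disc ^ ((p - 1) div 2)] (mod int p)" by (rule euler_criterion[OF p(1) p2])
    then have "int p dvd int disc ^ ((p - 1) div 2) - ?l" by (metis cong_iff_dvd_diff cong_sym)
    then obtain q where "int disc ^ ((p - 1) div 2) - ?l = int p * q" by blast
    then have "int disc ^ ((p - 1) div 2) = ?l + int p * q" by simp
    then have "(of_int (int disc ^ ((p - 1) div 2)) :: complex) = of_int (?l + int p * q)" by (rule arg_cong)
    then have q: "of_nat disc ^ ((p - 1) div 2) = (of_int ?l + of_nat p * of_int q :: complex)" by simp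
    let ?e = "er (of_nat (?n * c) / 8)" and ?e' = "er (- (of_nat (?n * c) / 8))"
    have e_cyc: "?e \<in> cyc ?M" "?e' \<in> cyc ?M"
      using er_eighth_cyc[of "int (?n * c)"] er_eighth_cyc[of "- int (?n * c)"] by simp_all
    let ?x = "of_int ?k * s * of_int q * ?e - z"
    have "h * s * ?e - of_int (?l * ?k) * s * ?e = of_nat p * ?x"
      using 1 z(2) unfolding h_eq q by (simp add: algebra_simps)
    \<comment> \<open>Multiplying by \<open>s * ?e'\<close> removes the phase and replaces
      \<open>s\<close> by the integer \<open>disc\<close>, which is prime to
      \<open>p\<close>.\<close>
    then have a: "(h * s * ?e - of_int (?l * ?k) * s * ?e) * (s * ?e') = of_nat p * (?x * (s * ?e'))"
      by (simp only: mult.assoc)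
    have b: "(h * s * ?e - of_int (?l * ?k) * s * ?e) * (s * ?e') = (s * s) * (h - of_int (?l * ?k)) * (?e' * ?e)"
      by (simp add: algebra_simps)
    have main: "of_nat disc * (h - of_int (?l * ?k)) = of_nat p * (?x * (s * ?e'))"
      using trans[OF sym[OF b] a] unfolding s(1) er_minus_mult mult_1_right .
    have x_cyc: "?x * (s * ?e') \<in> cyc ?M"
      using z(1) s_cyc e_cyc by (intro cyc_mult cyc_diff cyc_of_int)
    have lk: "?l * ?k \<in> {1, -1}" using l IH(1) by auto
    have "h = of_int (?l * ?k)"
    proof (rule fourth_root_congruent_sign[OF _ _ \<open>h ^ 4 = 1\<close> _ p(1) odd(1) pD main x_cyc])
      show "?M > 0" using N_pos by simp
      show "of_int (?l * ?k) \<in> {1, - 1 :: complex}"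
        using lk by (elim insertE emptyE) (simp_all del: of_int_mult)
    qed simp
    then have "of_nat disc * gmean c = of_int (?l * ?k) * s * ?e" using h_eq by simp
    then have "gmean c = of_int (?l * ?k) * ?e / s" using s(2) by (simp add: s(1)[symmetric] field_simps)
    then show ?thesis unfolding kc s_def using lk by simp
  qed
qed

section \<open>The prime 2\<close>

lemma gmean_cosets:
  defines "f \<equiv> \<lambda>t Y. er (of_nat t * Q (SOME y. y \<in> Y))"
  shows "of_nat disc * gmean t = sum (f t) (lcoset L ` dual)"
    and "y \<in> dual \<Longrightarrow> f t (lcoset L y) = er (of_nat t * Q y)"
proof -
  show "of_nat disc * gmean t = sum (f t) (lcoset L ` dual)"
    unfolding gmean_def mean_eq[OF periodic_er_mult] f_def using disc_pos by simp
  assume y: "y \<in> dual"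
  have "er (of_nat t * Q (y + ((SOME z. z \<in> lcoset L y) - y))) = er (of_nat t * Q y)"
    using periodic_er_mult[of t] some_in_lcoset[OF L_subgroup, of y] y unfolding periodic_mod_def by blast
  then show "f t (lcoset L y) = er (of_nat t * Q y)" by (simp add: f_def)
qed

text \<open>For odd \<open>N\<close> the nonzero cosets fall into pairs \<open>{Y, - Y}\<close>.\<close>

lemma gmean_half_sum:
  assumes N: "odd N"
  obtains \<eta> where "\<And>t. of_nat disc * gmean t = 1 + 2 * \<eta> t" "\<And>t. \<eta> t \<in> cyc (8 * N\<^sup>2)"
    "\<And>t. \<exists>z\<in>cyc (8 * N\<^sup>2). (\<eta> t)\<^sup>2 = \<eta> (2 * t) + 2 * z"
proof -
  let ?S = "lcoset L ` dual - {L}" and ?i = "(`) uminus :: 'v set \<Rightarrow> 'v set"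
  define f where "f t Y = er (of_nat t * Q (SOME y. y \<in> Y))" for t :: nat and Y
  have f: "f t (lcoset L y) = er (of_nat t * Q y)" if "y \<in> dual" for t y
    unfolding f_def by (rule gmean_cosets(2)[OF that])
  have L0: "lcoset L 0 = L" by (simp add: lcoset_def)
  have d0: "0 \<in> dual" by (rule add_subgroup_zero[OF dual_subgroup])
  have fin: "finite (lcoset L ` dual)"
    using overlattice_finite_index_L[OF overlattice_dual] by (simp add: finite_index_def)
  have i: "?i (lcoset L y) = lcoset L (- y)" for y
  proof -
    have "- z \<in> L \<longleftrightarrow> z \<in> L" for z
      using add_subgroup_minus[OF L_subgroup, of z] add_subgroup_minus[OF L_subgroup, of "- z"] by auto
    note m = this[of "_ - _"]
    show ?thesis
    proof (intro equalityI subsetI)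
      fix z assume "z \<in> ?i (lcoset L y)"
      then obtain x where "x - y \<in> L" "z = - x" by (auto simp: mem_lcoset_iff)
      then show "z \<in> lcoset L (- y)" using m[of x y] by (simp add: mem_lcoset_iff)
    next
      fix z assume "z \<in> lcoset L (- y)"
      then have "- z \<in> lcoset L y" using m[of "- z" y] by (simp add: mem_lcoset_iff add.commute)
      then have "- (- z) \<in> ?i (lcoset L y)" by (rule imageI)
      then show "z \<in> ?i (lcoset L y)" by simp
    qed
  qed
  have nz: "lcoset L y = L \<longleftrightarrow> y \<in> L" for y using lcoset_eq_iff[OF L_subgroup, of y 0] L0 by simp
  have inv: "?i Y \<in> ?S \<and> ?i (?i Y) = Y \<and> ?i Y \<noteq> Y" if "Y \<in> ?S" for Y
  proof -
    have "Y \<in> lcoset L ` dual" "Y \<noteq> L" using that by simp_all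
    then obtain y where y: "y \<in> dual" "Y = lcoset L y" by blast
    have yL: "y \<notin> L" using \<open>Y \<noteq> L\<close> nz y(2) by simp
    have yd: "- y \<in> dual" by (rule add_subgroup_minus[OF dual_subgroup y(1)])
    have "- y \<notin> L" using yL add_subgroup_minus[OF L_subgroup, of "- y"] by auto
    then have 1: "?i Y \<in> ?S" unfolding y(2) i using nz yd by simp
    have 2: "?i (?i Y) = Y" unfolding y(2) i by simp
    \<comment> \<open>A coset equal to its negative would be killed by 2, which is invertible on
      \<open>dual / L\<close> for odd \<open>N\<close>.\<close>
    have "lcoset L (- y) \<noteq> lcoset L y"
    proof
      assume "lcoset L (- y) = lcoset L y"
      then have "- (- y - y) \<in> L"
        using lcoset_eq_iff[OF L_subgroup] add_subgroup_minus[OF L_subgroup] by blast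
      moreover have "- (- y - y) = scl (of_nat 2) y" using scale_left_distrib[of 1 1 y] by simp
      ultimately have "scl (of_nat 2) y \<in> L" by simp
      moreover have "coprime 2 N" using N by simp
      ultimately show False using annihilator_invertible[OF N_dual _ y(1)] yL by blast
    qed
    with 1 2 show ?thesis unfolding y(2) i by blast
  qed
  from involution_halves[OF _ inv] fin obtain P where P: "P \<subseteq> ?S"
    "\<forall>f :: 'v set \<Rightarrow> complex. (\<forall>x\<in>?S. f (?i x) = f x) \<longrightarrow> sum f ?S = 2 * sum f P" by (metis finite_Diff)
  define \<eta> where "\<eta> t = sum (f t) P" for t
  have finP: "finite P" using fin P(1) finite_subset by blast
  have fc: "f t Y \<in> cyc (8 * N\<^sup>2)" if "Y \<in> P" for t Y
  proof -
    have "Y \<in> lcoset L ` dual" using that P(1) by blast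
    then obtain y where "y \<in> dual" "Y = lcoset L y" by blast
    then show ?thesis using er_Q_cyc f by simp
  qed
  have "of_nat disc * gmean t = 1 + 2 * \<eta> t" for t
  proof -
    have "\<forall>Y\<in>?S. f t (?i Y) = f t Y"
    proof
      fix Y assume "Y \<in> ?S"
      then have "Y \<in> lcoset L ` dual" by simp
      then obtain y where y: "y \<in> dual" "Y = lcoset L y" by blast
      show "f t (?i Y) = f t Y"
        unfolding y(2) i f[OF y(1)] f[OF add_subgroup_minus[OF dual_subgroup y(1)]] Q_minus ..
    qed
    then have "sum (f t) ?S = 2 * \<eta> t" using P(2) unfolding \<eta>_def by blast
    moreover have "L \<in> lcoset L ` dual" using d0 L0 by (intro image_eqI[of _ _ 0]) simp_all
    then have "sum (f t) (lcoset L ` dual) = f t L + sum (f t) ?S" by (rule sum.remove[OF fin])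
    moreover have "f t L = 1" using f[OF d0, of t] by (simp add: L0 Q_zero)
    ultimately show ?thesis unfolding gmean_cosets(1) f_def by simp
  qed
  moreover have "\<eta> t \<in> cyc (8 * N\<^sup>2)" for t unfolding \<eta>_def by (intro cyc_sum fc)
  moreover have "\<exists>z\<in>cyc (8 * N\<^sup>2). (\<eta> t)\<^sup>2 = \<eta> (2 * t) + 2 * z" for t
  proof -
    have "f t Y ^ 2 = f (2 * t) Y" for Y by (simp add: f_def er_power mult.assoc)
    then show ?thesis using cyc_sum_power_prime[OF two_is_prime_nat finP fc[where t = t]] unfolding \<eta>_def by simp
  qed
  ultimately show thesis using that by blast
qed

text \<open>The similitude with \<open>\<alpha> = \<beta> = 1\<close> has multiplier 2, whose
  inverse modulo \<open>N = 2 * j + 1\<close> is \<open>j + 1\<close>.\<close>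

lemma gmean_double_square:
  assumes N: "odd N"
  shows "(gmean (2 * t))\<^sup>2 = (gmean t)\<^sup>2"
proof -
  obtain j where j: "N = 2 * j + 1" using N by (auto elim: oddE)
  have "scl (of_int ((int j + 1) * (1\<^sup>2 + 1\<^sup>2) - 1)) x \<in> L" if "x \<in> dual" for x
  proof -
    have "(int j + 1) * (1\<^sup>2 + 1\<^sup>2) - 1 = int N" by (simp add: j)
    then show ?thesis using N_dual[OF that] by simp
  qed
  from mean_square_similitude[OF overlattice_dual periodic_er_mult this] show ?thesis
    by (simp add: gmean_def mult.commute)
qed

text \<open>\<open>gmean t\<close> depends only on \<open>t\<close> modulo \<open>N\<^sup>2\<close>.
  Comparing \<open>gmean_odd\<close> at 1 and at \<open>1 + 2 * N\<^sup>2\<close>, which is again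
  odd and prime to \<open>N\<close>, and squaring away the sign leaves
  \<open>er (n * N\<^sup>2 / 2) = 1\<close>.\<close>

lemma even_dim:
  assumes N: "odd N"
  shows "even (dim L)"
proof -
  let ?t = "1 + 2 * N\<^sup>2" and ?n = "dim L"
  have "coprime ?t N"
  proof (rule coprimeI)
    fix d assume "d dvd ?t" "d dvd N"
    then have "d dvd 2 * N\<^sup>2" by (simp add: power2_eq_square)
    then show "d dvd 1" using \<open>d dvd ?t\<close> dvd_add_left_iff by blast
  qed
  then obtain k :: int where k: "k \<in> {1, -1}" "gmean ?t = of_int k * er (of_nat (?n * ?t) / 8) / of_real (sqrt disc)"
    using gmean_odd[of ?t] by auto
  have "gmean ?t = gmean 1"
  proof -
    obtain T where T: "transversal L dual T" "\<And>t. of_nat disc * gmean t = (\<Sum>u\<in>T. er (of_nat t * Q u))"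
      by (rule gmean_sum) blast
    have "of_nat disc * gmean ?t = of_nat disc * gmean 1"
      unfolding T(2)
    proof (intro sum.cong refl er_cong)
      fix u assume "u \<in> T"
      then have "u \<in> dual" using T(1) by (auto simp: transversal_def)
      then have "2 * (of_nat (N\<^sup>2) * Q u) \<in> \<int>" by (intro Ints_mult N_square_Q) simp_all
      then show "of_nat ?t * Q u - of_nat 1 * Q u \<in> \<int>" by (simp add: algebra_simps)
    qed
    then show ?thesis using disc_pos by simp
  qed
  then have "of_int k * er (of_nat (?n * ?t) / 8) = er (of_nat ?n / 8)"
    unfolding k(2) gmean_1 using disc_pos by simp
  then have "(of_int k * er (of_nat (?n * ?t) / 8)) ^ 2 = er (of_nat ?n / 8) ^ 2" by simp
  moreover have "(of_int k :: complex) ^ 2 = 1" using k(1) by auto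
  ultimately have "er (of_nat 2 * (of_nat (?n * ?t) / 8)) = er (of_nat 2 * (of_nat ?n / 8))"
    by (simp only: power_mult_distrib er_power mult_1)
  moreover have "of_nat 2 * (of_nat (?n * ?t) / 8) = of_nat 2 * (of_nat ?n / 8) + of_nat (?n * N\<^sup>2) / (2 :: rat)"
    by (simp add: field_simps)
  ultimately have "er (of_nat (?n * N\<^sup>2) / 2) = 1" by (simp only: er_add) simp
  then have "(of_nat (?n * N\<^sup>2) / 2 :: rat) \<in> \<int>" by (simp only: er_eq_1_iff)
  then obtain q where "(of_nat (?n * N\<^sup>2) / 2 :: rat) = of_int q" by (elim Ints_cases)
  then have "(of_int (int (?n * N\<^sup>2)) :: rat) = of_int (2 * q)" by (simp add: field_simps)
  then have "int (?n * N\<^sup>2) = 2 * q" by (simp only: of_int_eq_iff)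
  then have "even (int (?n * N\<^sup>2))" by simp
  then show ?thesis using N by simp
qed

text \<open>Here \<open>\<eta> = (D (G t) - 1) / 2\<close>, and
  \<open>q = \<eta>\<^sup>2 + \<eta> = (\<delta> - 1) / 4\<close> is an integer. The value of
  \<open>\<eta>\<close> at \<open>2 * t\<close> is congruent to \<open>\<eta>\<^sup>2\<close> modulo
  2 and equals \<open>\<eta>\<close> or \<open>- 1 - \<eta>\<close>. In the first case
  \<open>q\<close> is even and \<open>\<delta> \<equiv> 1\<close> modulo 8, in the second
  \<open>q\<close> is odd and \<open>\<delta> \<equiv> 5\<close>. The symbol at 2 takes the same
  value at \<open>\<delta>\<close> and \<open>- \<delta>\<close>, so it can be read off from
  \<open>D\<close>.\<close>

lemma gmean_double:
  assumes N: "odd N" and \<delta>: "(of_nat disc * gmean t)\<^sup>2 = of_int \<delta>" "\<delta> \<in> {int disc, - int disc}"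
  shows "kronecker_two (int disc) \<in> {1, -1} \<and> gmean (2 * t) = of_int (kronecker_two (int disc)) * gmean t"
proof -
  let ?M = "8 * N\<^sup>2"
  have M: "?M > 0" using N_pos by simp
  obtain \<eta> where \<eta>: "\<And>t. of_nat disc * gmean t = 1 + 2 * \<eta> t" "\<And>t. \<eta> t \<in> cyc ?M"
    "\<And>t. \<exists>z\<in>cyc ?M. (\<eta> t)\<^sup>2 = \<eta> (2 * t) + 2 * z" by (rule gmean_half_sum[OF N]) blast
  obtain z where z: "z \<in> cyc ?M" "(\<eta> t)\<^sup>2 = \<eta> (2 * t) + 2 * z" using \<eta>(3) by blast
  have odd: "odd disc" using annihilator_disc[OF N_pos N_dual two_is_prime_nat] N by simp
  have sq: "4 * ((\<eta> t)\<^sup>2 + \<eta> t) = of_int \<delta> - 1"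
    using \<delta>(1) unfolding \<eta>(1) by (simp add: power2_eq_square algebra_simps)
  have integer: "\<exists>q. x = of_int q" if "x \<in> cyc ?M" "of_nat m * x = of_int a" "m > 0" for x m a
  proof -
    have "of_rat (of_int a / of_nat m) = x" using that(2,3) by (simp add: of_rat_divide field_simps)
    then have "(of_int a / of_nat m :: rat) \<in> \<int>" using cyc_rational[OF M] that(1) by simp
    then obtain q where "(of_int a / of_nat m :: rat) = of_int q" by (elim Ints_cases)
    then show ?thesis using \<open>of_rat (of_int a / of_nat m) = x\<close> by (intro exI[of _ q]) simp
  qed
  have "(\<eta> t)\<^sup>2 + \<eta> t \<in> cyc ?M" by (intro cyc_add cyc_power \<eta>(2))
  from integer[OF this, of 4 "\<delta> - 1"] obtain q where q: "(\<eta> t)\<^sup>2 + \<eta> t = of_int q" using sq by auto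
  have "(of_int \<delta> :: complex) = of_int (1 + 4 * q)" using sq unfolding q by simp
  then have \<delta>q: "\<delta> = 1 + 4 * q" by (simp only: of_int_eq_iff)
  have dm: "int disc mod 8 = \<delta> mod 8 \<or> int disc mod 8 = (- \<delta>) mod 8" using \<delta>(2) by auto
  have "gmean (2 * t) = gmean t \<or> gmean (2 * t) = - gmean t"
    using gmean_double_square[OF N, of t] by (simp only: power2_eq_iff)
  then show ?thesis
  proof
    assume eq: "gmean (2 * t) = gmean t"
    have "\<eta> (2 * t) = \<eta> t" using \<eta>(1)[of t] \<eta>(1)[of "2 * t"] eq by simp
    then have "of_nat 2 * (\<eta> t + z) = of_int q" using q unfolding z(2) by simp
    from integer[OF cyc_add[OF \<eta>(2) z(1)] this] obtain r where "\<eta> t + z = of_int r" by auto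
    then have "(of_int (2 * r) :: complex) = of_int q" using \<open>of_nat 2 * (\<eta> t + z) = of_int q\<close> by simp
    then have "q = 2 * r" by (simp only: of_int_eq_iff)
    then have "\<delta> mod 8 = 1" unfolding \<delta>q by presburger
    then have "int disc mod 8 = 1 \<or> int disc mod 8 = 7" using dm by presburger
    then have "kronecker_two (int disc) = 1" using odd by (simp add: kronecker_two_def)
    then show ?thesis using eq by simp
  next
    assume eq: "gmean (2 * t) = - gmean t"
    have "of_nat disc * gmean (2 * t) = - (of_nat disc * gmean t)" using eq by simp
    then have e: "1 + 2 * \<eta> (2 * t) = - (1 + 2 * \<eta> t)" unfolding \<eta>(1) .
    have "\<eta> (2 * t) = ((1 + 2 * \<eta> (2 * t)) - 1) / 2" by simp
    also have "\<dots> = - 1 - \<eta> t" unfolding e by (simp add: field_simps)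
    finally have e2: "\<eta> (2 * t) = - 1 - \<eta> t" .
    have "of_nat 2 * z = (\<eta> t)\<^sup>2 - \<eta> (2 * t)" using z(2) by simp
    also have "\<dots> = ((\<eta> t)\<^sup>2 + \<eta> t) + 1" unfolding e2 by simp
    also have "\<dots> = of_int (q + 1)" unfolding q by simp
    finally have "of_nat 2 * z = of_int (q + 1)" .
    from integer[OF z(1) this] obtain r where "z = of_int r" by auto
    then have "(of_int (2 * r) :: complex) = of_int (q + 1)" using \<open>of_nat 2 * z = of_int (q + 1)\<close> by simp
    then have "q + 1 = 2 * r" by (simp only: of_int_eq_iff)
    then have "\<delta> = 8 * r - 3" using \<delta>q by simp
    then have "\<delta> mod 8 = 5" by presburger
    then have "int disc mod 8 = 5 \<or> int disc mod 8 = 3" using dm by presburger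
    then have "kronecker_two (int disc) = - 1" using odd by (auto simp: kronecker_two_def)
    then show ?thesis using eq by simp
  qed
qed

theorem gmean_eval:
  assumes "odd c0" "coprime (2 ^ k * c0) N"
  shows "kronecker (int disc) (int (2 ^ k * c0)) \<in> {1, -1} \<and>
    gmean (2 ^ k * c0) = of_int (kronecker (int disc) (int (2 ^ k * c0))) * er (of_nat (dim L * c0) / 8) / of_real (sqrt disc)"
  using assms(2)
proof (induction k)
  case 0
  then show ?case using gmean_odd[OF assms(1)] by simp
next
  case (Suc k)
  let ?t = "2 ^ k * c0" and ?s = "complex_of_real (sqrt disc)"
  have t: "coprime ?t N" "coprime 2 N" using Suc.prems by simp_all
  then have N: "odd N" by simp
  let ?k = "kronecker (int disc) (int ?t)"
  have IH: "?k \<in> {1, -1}" "gmean ?t = of_int ?k * er (of_nat (dim L * c0) / 8) / ?s"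
    using Suc.IH[OF t(1)] by blast+
  \<comment> \<open>The even rank makes the square of \<open>er (n * c0 / 8)\<close> a sign, so that
    \<open>(D (G t))\<^sup>2\<close> is \<open>D\<close> or \<open>- D\<close> as
    \<open>gmean_double\<close> requires.\<close>
  obtain m where m: "dim L = 2 * m" using even_dim[OF N] by blast
  have s: "?s * ?s = of_nat disc" "?s \<noteq> 0"
    using disc_pos by (simp_all add: of_real_mult[symmetric] del: of_real_mult)
  have "er (of_nat (dim L * c0) / 8) ^ 2 = er (of_nat (m * c0) * (1 / 2))" by (simp add: er_power m mult.commute)
  also have "\<dots> = (- 1) ^ (m * c0)" unfolding er_power[symmetric] er_half ..
  finally have e: "er (of_nat (dim L * c0) / 8) ^ 2 = (- 1) ^ (m * c0)" .
  have "(of_nat disc * gmean ?t)\<^sup>2 = (?s * of_int ?k * er (of_nat (dim L * c0) / 8))\<^sup>2"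
    unfolding IH(2) using s by (simp add: s(1)[symmetric] mult.assoc)
  also have "\<dots> = (?s * ?s) * (of_int ?k)\<^sup>2 * er (of_nat (dim L * c0) / 8) ^ 2"
    by (simp add: power_mult_distrib power2_eq_square)
  also have "(of_int ?k :: complex)\<^sup>2 = 1" using IH(1) by auto
  finally have "(of_nat disc * gmean ?t)\<^sup>2 = of_int (int disc * (- 1) ^ (m * c0))" unfolding s(1) e by simp
  moreover have "int disc * (- 1) ^ (m * c0) \<in> {int disc, - int disc}" by (cases "even (m * c0)") simp_all
  ultimately have d: "kronecker_two (int disc) \<in> {1, -1}" "gmean (2 * ?t) = of_int (kronecker_two (int disc)) * gmean ?t"
    using gmean_double[OF N] by blast+
  have "?t > 0" using assms(1) by (cases c0) auto
  from kronecker_prime_times[OF two_is_prime_nat this, of "int disc"]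
  have kr: "kronecker (int disc) (int (2 ^ Suc k * c0)) = kronecker_two (int disc) * ?k"
    by (simp add: mult.assoc)
  have "gmean (2 ^ Suc k * c0) = of_int (kronecker_two (int disc)) * (of_int ?k * er (of_nat (dim L * c0) / 8) / ?s)"
    using d(2) unfolding IH(2) by (simp add: mult.assoc)
  then show ?case unfolding kr using d(1) IH(1) by auto
qed

theorem gauss_sum_eval:
  \<comment> \<open>Division of \<open>mean_L_gmean\<close> by the value of \<open>gmean c\<close>;
    the symbol is its own inverse.\<close>
  assumes c: "c = 2 ^ k * c0" "odd c0" "coprime c N"
  shows "mean L (\<lambda>x. er (Q x / of_nat c))
    = of_int (kronecker (int disc) (int c)) * er (of_nat (dim L) * (1 - of_nat c0) / 8) / of_real (sqrt c) ^ dim L"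
proof -
  let ?k = "kronecker (int disc) (int c)" and ?s = "complex_of_real (sqrt disc)"
  let ?e = "er (of_nat (dim L * c0) / 8)" and ?t = "complex_of_real (sqrt c) ^ dim L"
  let ?G = "mean L (\<lambda>x. er (Q x / of_nat c))"
  have c0: "c > 0" using c(1,2) by (cases c0) auto
  have ev: "?k \<in> {1, -1}" "gmean c = of_int ?k * ?e / ?s" using gmean_eval[OF c(2), of k] c(1,3) by blast+
  have s: "?s \<noteq> 0" using disc_pos by simp
  have t: "?t \<noteq> 0" using c0 by simp
  have kk: "of_int ?k * of_int ?k = (1 :: complex)" using ev(1) by auto
  have "?G * gmean c = er (of_nat (dim L) / 8) / (?s * ?t)" using mean_L_gmean[OF c0 c(3)] by simp
  then have "?G * (of_int ?k * ?e) = er (of_nat (dim L) / 8) / ?t" unfolding ev(2) using s t by (simp add: field_simps)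
  then have "(?G * (of_int ?k * ?e)) * (of_int ?k * er (- (of_nat (dim L * c0) / 8)))
      = of_int ?k * (er (of_nat (dim L) / 8) * er (- (of_nat (dim L * c0) / 8))) / ?t" by simp
  moreover have "(?G * (of_int ?k * ?e)) * (of_int ?k * er (- (of_nat (dim L * c0) / 8)))
      = ?G * (of_int ?k * of_int ?k) * (er (- (of_nat (dim L * c0) / 8)) * ?e)" by (simp only: mult_ac)
  ultimately have "?G = of_int ?k * er (of_nat (dim L) / 8 + - (of_nat (dim L * c0) / 8)) / ?t"
    unfolding kk er_minus_mult er_add by simp
  also have "of_nat (dim L) / 8 + - (of_nat (dim L * c0) / 8) = of_nat (dim L) * (1 - of_nat c0) / (8 :: rat)"
    by (simp add: field_simps)
  finally show ?thesis .
qed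

end

section \<open>The coefficients of the Weil representation\<close>

context annihilated_lattice
begin

lemma rescaled_annihilated:
  assumes a: "a > 0"
  shows "annihilated_lattice scl (multiples a) (\<lambda>x y. B x y / of_nat a) (a * N)"
proof (intro annihilated_lattice.intro annihilated_lattice_axioms.intro rescaled[OF a])
  show "a * N > 0" using a N_pos by simp
  fix x assume "x \<in> dual_lattice (multiples a) (\<lambda>x y. B x y / of_nat a)"
  then have "scl (of_nat N) x \<in> L" using N_dual dual_rescaled[OF a] by simp
  then show "scl (of_nat (a * N)) x \<in> multiples a"
    by (intro image_eqI[of _ _ "scl (of_nat N) x"]) (simp_all only: scale_scale of_nat_mult)
qed

text \<open>The map \<open>x \<mapsto> a x\<close> identifies \<open>a * Q\<close> on
  \<open>L\<close> with the form of the lattice rescaled by \<open>a\<close>. Its discriminant is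
  \<open>D * a ^ n\<close>, so the symbol of \<open>a\<close> appears with exponent \<open>n\<close>
  by multiplicativity.\<close>

lemma gauss_sum_multiple:
  assumes a: "a > 0" and c: "c = 2 ^ k * c0" "odd c0" "coprime c N" "coprime c a"
  shows "mean L (\<lambda>x. er (of_nat a * Q x / of_nat c))
    = of_int (kronecker (int disc) (int c)) * of_int (kronecker (int a) (int c)) ^ dim L
      * er (of_nat (dim L) * (1 - of_nat c0) / 8) / of_real (sqrt c) ^ dim L"
proof -
  have c_pos: "c > 0" using c(1,2) by (cases c0) auto
  have per: "periodic_on (multiples a) (\<lambda>x. er (Q x / of_nat a / of_nat c))"
    using pos_def_even_lattice.periodic_on_er'[OF rescaled[OF a] Z_lattice.overlattice_L[OF pos_def_even_lattice.axioms(1)[OF rescaled[OF a]]],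
        of "\<lambda>x. Q x / of_nat a / of_nat c" "1 / of_nat c" 0 0]
    by (simp add: qform_rescaled B_zero)
  have "mean L (\<lambda>x. er (Q (scl (of_nat a) x) / of_nat a / of_nat c)) = mean (multiples a) (\<lambda>x. er (Q x / of_nat a / of_nat c))"
    by (rule mean_reindex_surj(2)[OF L_subgroup scale_right_distrib refl per])
  also have "\<dots> = of_int (kronecker (int (disc * a ^ dim L)) (int c))
      * er (of_nat (dim L) * (1 - of_nat c0) / 8) / of_real (sqrt c) ^ dim L"
    using annihilated_lattice.gauss_sum_eval[OF rescaled_annihilated[OF a] c(1,2)] c(3,4)
    unfolding qform_rescaled dual_rescaled[OF a] index_rescaled[OF a] dim_rescaled[OF a] by simp
  finally have "mean L (\<lambda>x. er (Q (scl (of_nat a) x) / of_nat a / of_nat c))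
    = of_int (kronecker (int (disc * a ^ dim L)) (int c))
      * er (of_nat (dim L) * (1 - of_nat c0) / 8) / of_real (sqrt c) ^ dim L" .
  moreover have "kronecker (int (disc * a ^ dim L)) (int c) = kronecker (int disc) (int c) * kronecker (int a) (int c) ^ dim L"
    by (simp only: of_nat_mult of_nat_power kronecker_mult[OF c_pos] kronecker_power[OF c_pos])
  moreover have "Q (scl (of_nat a) x) / of_nat a / of_nat c = of_nat a * Q x / of_nat c" for x
    using a by (simp add: Q_scl power2_eq_square)
  ultimately show ?thesis by simp
qed

text \<open>Negative \<open>a\<close> is reduced to \<open>\<bar>a\<bar>\<close> by complex
  conjugation, which fixes the symbols and negates the phase; hence the factor
  \<open>sgn a\<close>.\<close>

lemma gauss_sum_int_multiple:
  fixes a :: int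
  assumes a: "a \<noteq> 0" and c: "c = 2 ^ k * c0" "odd c0" "coprime c N" "coprime (int c) a"
  shows "mean L (\<lambda>x. er (of_int a * Q x / of_nat c))
    = of_int (kronecker (int disc) (int c)) * of_int (kronecker \<bar>a\<bar> (int c)) ^ dim L
      * er (of_nat (dim L) * of_int (sgn a) * (1 - of_nat c0) / 8) / of_real (sqrt c) ^ dim L"
proof -
  let ?m = "nat \<bar>a\<bar>" and ?q = "of_nat (dim L) * (1 - of_nat c0) / 8 :: rat"
  have m: "?m > 0" "int ?m = \<bar>a\<bar>" using a by simp_all
  have "coprime (int c) (int ?m)" unfolding m(2) using c(4) by simp
  then have cm: "coprime c ?m" unfolding coprime_int_iff .
  have of_m: "of_nat ?m = (of_int \<bar>a\<bar> :: rat)" by (simp only: of_nat_nat abs_ge_zero)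
  have ev: "mean L (\<lambda>x. er (of_int \<bar>a\<bar> * Q x / of_nat c))
      = of_int (kronecker (int disc) (int c)) * of_int (kronecker \<bar>a\<bar> (int c)) ^ dim L * er ?q / of_real (sqrt c) ^ dim L"
    using gauss_sum_multiple[OF m(1) c(1-3) cm] unfolding m(2) of_m .
  show ?thesis
  proof (cases "a > 0")
    case True
    then show ?thesis using ev by simp
  next
    case False
    have per: "periodic_on L (\<lambda>x. er (of_int \<bar>a\<bar> * Q x / of_nat c))"
      by (rule periodic_on_er'[OF overlattice_L, of _ "of_int \<bar>a\<bar> / of_nat c" 0 0]) (simp add: B_zero)
    have "mean L (\<lambda>x. er (of_int a * Q x / of_nat c)) = cnj (mean L (\<lambda>x. er (of_int \<bar>a\<bar> * Q x / of_nat c)))"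
      unfolding mean_cnj[OF per, symmetric] er_cnj using False by simp
    also have "\<dots> = of_int (kronecker (int disc) (int c)) * of_int (kronecker \<bar>a\<bar> (int c)) ^ dim L * er (- ?q) / of_real (sqrt c) ^ dim L"
      unfolding ev by (simp add: er_cnj)
    also have "- ?q = of_nat (dim L) * of_int (sgn a) * (1 - of_nat c0) / 8"
      using a False by (simp add: field_simps)
    finally show ?thesis .
  qed
qed

text \<open>Modulo \<open>L\<close> the vector \<open>w - d v\<close> is divisible by \<open>c\<close>, being equal to \<open>c c' (w - d v)\<close>; this
  allows one to complete the square.\<close>

lemma weil_mean_complete_square:
  fixes a b d :: int and c :: nat
  assumes N_Q: "\<And>x. x \<in> dual \<Longrightarrow> of_nat N * Q x \<in> \<int>"
    and a: "a \<noteq> 0" and c: "c > 0" and det: "a * d - b * int c = 1"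
    and c': "[int c * c' = 1] (mod (a * int N))"
    and w: "w \<in> dual" and v: "v \<in> dual"
  shows "mean L (\<lambda>x. er ((of_int a * Q (x + w) - B (x + w) v + of_int d * Q v) / of_nat c))
    = er (of_int (b + c') / of_int a * Q v - of_int c' * B w v + of_int a * of_int c' * Q w)
      * mean L (\<lambda>x. er (of_int a * Q x / of_nat c))"
proof -
  let ?f = "\<lambda>x. (of_int a * Q (x + w) - B (x + w) v + of_int d * Q v) / of_nat c"
  let ?E = "of_int (b + c') / of_int a * Q v - of_int c' * B w v + of_int a * of_int c' * Q w"
  have "a * int N dvd int c * c' - 1" using c' by (simp add: cong_iff_dvd_diff)
  then obtain j where "int c * c' - 1 = a * int N * j" by (rule dvdE)
  then have j: "int c * c' = 1 + a * int N * j" by simp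
  define u where "u = w - scl (of_int d) v"
  have u: "u \<in> dual" unfolding u_def
    using add_subgroup_diff[OF dual_subgroup w scl_int_subgroup[OF dual_subgroup v]] .
  \<comment> \<open>The difference \<open>c c' u - u\<close>. Translating by \<open>l\<close>
    replaces \<open>w\<close> by \<open>c c' u + d v\<close>, in which \<open>u\<close> occurs with
    a coefficient divisible by \<open>c\<close>.\<close>
  define l where "l = scl (of_int (a * j)) (scl (of_nat N) u)"
  have l: "l \<in> L" unfolding l_def by (intro scl_int_subgroup L_subgroup N_dual u)
  have t: "of_nat c * of_int c' = (1 + of_int a * of_nat N * of_int j :: rat)"
    using arg_cong[OF j, of "of_int :: int \<Rightarrow> rat"] by simp
  have det': "of_int a * of_int d = (1 + of_int b * of_nat c :: rat)"
    using arg_cong[OF det, of "of_int :: int \<Rightarrow> rat"] by (simp add: algebra_simps)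
  have a0: "of_int a \<noteq> (0 :: rat)" and c0: "of_nat c \<noteq> (0 :: rat)" using a c by simp_all
  define K where "K = of_int a * of_int c' * (of_nat c * of_int c') * Q u + of_int b * (of_nat c * of_int c') * B u v
    + of_int b * of_int d * Q v"
  have f: "?f (x + l) = of_int a * Q x / of_nat c + K + (of_int a * of_int c' * B x u + of_int b * B x v)" for x
  proof -
    let ?t = "of_nat c * of_int c' :: rat"
    have "l + w = scl ?t u + scl (of_int d) v"
      unfolding t l_def u_def by (simp add: scale_left_distrib mult_ac)
    then have arg: "x + l + w = (x + scl ?t u) + scl (of_int d) v" by (simp add: add.assoc)
    have "of_int a * Q (x + l + w) - B (x + l + w) v + of_int d * Q v
        = of_int a * (Q x + ?t\<^sup>2 * Q u + ?t * B x u + (of_int d)\<^sup>2 * Q v + of_int d * (B x v + ?t * B u v))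
          - (B x v + ?t * B u v + of_int d * (2 * Q v)) + of_int d * Q v"
      unfolding arg by (simp only: Q_add Q_scl B_add_left B_scl_left B_scl_right) (simp add: qform_def)
    also have "\<dots> = of_int a * Q x + of_int a * ?t\<^sup>2 * Q u + of_int a * ?t * B x u
        + (of_int a * of_int d - 1) * (of_int d * Q v + B x v + ?t * B u v)"
      by (simp add: algebra_simps power2_eq_square)
    also have "of_int a * of_int d - 1 = (of_int b * of_nat c :: rat)" using det' by simp
    finally show ?thesis using c0 unfolding K_def by (simp add: field_simps power2_eq_square)
  qed
  have K: "K - ?E = of_int (a * c' * a * j) * (of_nat N * Q u) + of_int (a * j * b) * (of_nat N * B u v)
      + (of_int (b * j + a * d * b * j) * (of_nat N * Q v) - of_int (a * j * b) * (of_nat N * B w v))" (is "_ = ?K")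
  proof -
    have Qu: "Q u = Q w + (of_int d)\<^sup>2 * Q v - of_int d * B w v" and Bu: "B u v = B w v - of_int d * (2 * Q v)"
      unfolding u_def by (simp_all add: Q_diff Q_scl B_scl_right B_diff_left B_scl_left) (simp add: qform_def)
    have e1: "of_int a * of_int c' * of_int d = of_int c' + of_int b * (1 + of_int a * of_nat N * of_int j :: rat)"
    proof -
      have "of_int a * of_int c' * of_int d = of_int c' * (of_int a * of_int d :: rat)" by (simp only: mult_ac)
      also have "\<dots> = of_int c' + of_int b * (of_nat c * of_int c')" unfolding det' by (simp add: algebra_simps)
      finally show ?thesis unfolding t .
    qed
    \<comment> \<open>Removes the division by \<open>a\<close>. Afterwards \<open>K - ?E\<close> is
      an integral combination of values of \<open>N * Q\<close> and \<open>N * B\<close>; here the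
      congruence for \<open>c'\<close> modulo \<open>a * N\<close> is used.\<close>
    have e2: "of_int (b + c') / of_int a = of_int c' * of_int d - of_int b * (of_nat N * of_int j :: rat)"
      using a0 e1 by (simp add: field_simps)
    have "K - ?E = of_int a * of_int c' * (of_int a * of_nat N * of_int j) * Q u
        + of_int b * (of_int a * of_nat N * of_int j) * B u v
        + (of_int b - of_int a * of_int c' * of_int d + of_int c') * B w v
        + ((of_int a * of_int c' * of_int d) * of_int d - of_int b * of_int d - of_int (b + c') / of_int a) * Q v"
      unfolding K_def t distrib_left[of _ 1] distrib_right[of _ _ "Q u"] distrib_right[of _ _ "B u v"]
      by (simp add: Qu Bu algebra_simps power2_eq_square)
    also have "\<dots> = ?K" unfolding e1 e2 by (simp add: algebra_simps)
    finally show ?thesis .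
  qed
  have per: "periodic_on L (\<lambda>x. er (?f x))"
    by (rule periodic_on_er'[OF overlattice_L, of _ "of_int a / of_nat c" "scl (1 / of_nat c) (scl (of_int a) w - v)" "?f 0"])
      (use c0 in \<open>simp add: Q_add B_add_left B_diff_right B_scl_right field_simps\<close>)
  have perQ: "periodic_on L (\<lambda>x. er (of_int a * Q x / of_nat c))"
    by (rule periodic_on_er'[OF overlattice_L, of _ "of_int a / of_nat c" 0 0]) (simp add: B_zero)
  have N_B: "of_nat N * B x y \<in> \<int>" if "x \<in> dual" "y \<in> dual" for x y
    using B_dual(2)[OF N_dual[OF that(1)] that(2)] by (simp add: B_scl_left)
  have KE: "er K = er ?E"
  proof (rule er_cong)
    have "of_int (a * c' * a * j) * (of_nat N * Q u) + of_int (a * j * b) * (of_nat N * B u v)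
      + (of_int (b * j + a * d * b * j) * (of_nat N * Q v) - of_int (a * j * b) * (of_nat N * B w v)) \<in> \<int>"
      by (intro Ints_add Ints_diff Ints_mult[OF Ints_of_int] N_Q N_B u v w)
    then show "K - ?E \<in> \<int>" unfolding K .
  qed
  have "mean L (\<lambda>x. er (?f x)) = mean L (\<lambda>x. er (?f (x + l)))"
    by (rule mean_shift(2)[OF per l, symmetric])
  also have "\<dots> = mean L (\<lambda>x. er ?E * er (of_int a * Q x / of_nat c))"
  proof (rule mean_cong[OF mean_shift(1)[OF per l]])
    fix x assume x: "x \<in> L"
    have "of_int a * of_int c' * B x u + of_int b * B x v \<in> \<int>"
      by (intro Ints_add Ints_mult Ints_of_int B_dual(2)[OF x] u v)
    then have "er (of_int a * of_int c' * B x u + of_int b * B x v) = 1" by (rule er_int)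
    then show "er (?f (x + l)) = er ?E * er (of_int a * Q x / of_nat c)"
      unfolding f er_add[of "_ + K"] er_add[of _ K] KE by simp
  qed
  also have "\<dots> = er ?E * mean L (\<lambda>x. er (of_int a * Q x / of_nat c))" by (rule mean_mult_left[OF perQ])
  finally show ?thesis .
qed

end

section \<open>The level\<close>

context pos_def_even_lattice
begin

text \<open>The least \<open>N\<close> exists because a \<open>d\<close> with
  \<open>d x \<in> L\<close> for all \<open>x \<in> dual\<close> makes \<open>d\<^sup>2 * Q\<close>
  integral on \<open>dual\<close>.\<close>

lemma
  shows lattice_level_pos: "lattice_level L B > 0"
    and lattice_level_Q: "x \<in> dual \<Longrightarrow> of_nat (lattice_level L B) * Q x \<in> \<int>"
proof -
  obtain d where d: "d > 0" "\<And>x. x \<in> dual \<Longrightarrow> scl (of_nat d) x \<in> L"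
    using overlattice_dual unfolding overlattice_def by blast
  have "of_nat (d ^ 2) * Q x \<in> \<int>" if "x \<in> dual" for x
    using even[OF d(2)[OF that]] by (simp add: Q_scl)
  then have "\<exists>N>0. \<forall>x\<in>dual. of_nat N * Q x \<in> \<int>" using d(1) by (intro exI[of _ "d ^ 2"]) simp
  from LeastI_ex[OF this] show "lattice_level L B > 0" "x \<in> dual \<Longrightarrow> of_nat (lattice_level L B) * Q x \<in> \<int>"
    unfolding lattice_level_def by blast+
qed

text \<open>Polarisation makes \<open>N * B\<close> integral on \<open>dual\<close>, and
  \<open>dual_dual\<close> turns this into \<open>N x \<in> L\<close>.\<close>

lemma annihilated_by_level: "annihilated_lattice scl L B (lattice_level L B)"
proof (intro annihilated_lattice.intro annihilated_lattice_axioms.intro pos_def_even_lattice_axioms lattice_level_pos)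
  fix x assume x: "x \<in> dual"
  let ?N = "of_nat (lattice_level L B) :: rat"
  show "scl ?N x \<in> L"
  proof (rule dual_dual)
    fix y assume y: "y \<in> dual"
    have "?N * Q (x + y) - ?N * Q x - ?N * Q y \<in> \<int>"
      by (intro Ints_diff lattice_level_Q x y add_subgroup_add[OF dual_subgroup])
    then show "B (scl ?N x) y \<in> \<int>" by (simp add: Q_add B_scl_left algebra_simps)
  qed
qed

end

theorem theorem1p4:
  fixes scl :: "rat \<Rightarrow> 'v::ab_group_add \<Rightarrow> 'v"
    and L :: "'v set"
    and B :: "'v \<Rightarrow> 'v \<Rightarrow> rat"
    and \<rho> :: "(int^2^2) \<times> complex \<Rightarrow> ('v set \<Rightarrow> complex) \<Rightarrow> ('v set \<Rightarrow> complex)"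
    and n N D k :: nat
    and a b c d c0 c' :: int
    and w v :: 'v
  assumes "pos_def_even_lattice scl L B"
    and "n = vector_space.dim scl L" and "n \<ge> 1"
    and "N = lattice_level L B"
    and "D = card (disc_module L B)"
    and "is_weil_rep scl L B \<rho>"
    and "mat22 a b c d \<in> SL2Z"
    and "c > 0" and "a \<noteq> 0" and "gcd (int N) c = 1"
    and "c = 2 ^ k * c0" and "odd c0"
    and "[c * c' = 1] (mod (a * int N))"
    and "w \<in> dual_lattice L B" and "v \<in> dual_lattice L B"
  shows "rep_coeff \<rho> (mat22 a b c d, 1) (lcoset L w) (lcoset L v) =
    1 / of_real (sqrt (real D)) * (- \<i>) powr (of_nat n / 2)
    * of_int (kronecker \<bar>a\<bar> c) ^ n * of_int (kronecker (int D) c)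
    * ee (of_nat n * of_int (sgn a) * (1 - of_int c0) / 8)
    * ee (of_rat (of_int (b + c') / of_int a * qform B v
                  - of_int c' * B w v
                  + of_int a * of_int c' * qform B w))"
proof -
  interpret pos_def_even_lattice scl L B by (rule assms(1))
  interpret annihilated_lattice scl L B N unfolding assms(4) by (rule annihilated_by_level)
  obtain m :: nat where m: "c = int m" "m > 0"
    using \<open>c > 0\<close> by (metis pos_int_cases)
  have "0 < c0" using \<open>c > 0\<close> unfolding assms(11) by (simp add: zero_less_mult_iff)
  then obtain m0 :: nat where m0: "c0 = int m0" by (metis pos_int_cases)
  have m_eq: "m = 2 ^ k * m0"
    using assms(11) unfolding m(1) m0 by (metis of_nat_eq_iff of_nat_mult of_nat_numeral of_nat_power)
  have odd: "odd m0" using \<open>odd c0\<close> unfolding m0 by simp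
  have coN: "coprime m N"
    using gcd_eq_1_imp_coprime[OF assms(10)] unfolding m(1) coprime_int_iff by (rule coprime_commute[THEN iffD1])
  have det: "a * d - b * int m = 1" using assms(7) unfolding mat22_SL2Z m(1) .
  have coa: "coprime (int m) a"
  proof (rule coprimeI)
    fix g assume "g dvd int m" "g dvd a"
    then have "g dvd a * d - b * int m" by simp
    then show "is_unit g" unfolding det .
  qed
  have D: "D = disc" unfolding assms(5) by (rule disc_module_eq(2))
  have NQ: "of_nat N * Q x \<in> \<int>" if "x \<in> dual" for x
    unfolding assms(4) by (rule lattice_level_Q[OF that])
  have cong: "[int m * c' = 1] (mod (a * int N))" using assms(13) unfolding m(1) .
  let ?E = "of_int (b + c') / of_int a * Q v - of_int c' * B w v + of_int a * of_int c' * Q w"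
  have mean: "mean L (\<lambda>x. er ((of_int a * Q (x + w) - B (x + w) v + of_int d * Q v) / of_nat m))
      = er ?E * mean L (\<lambda>x. er (of_int a * Q x / of_nat m))"
    using weil_mean_complete_square[OF _ \<open>a \<noteq> 0\<close> m(2) det cong assms(14,15)] NQ by blast
  note gauss = gauss_sum_int_multiple[OF \<open>a \<noteq> 0\<close> m_eq odd coN coa]
  have "rep_coeff \<rho> (mat22 a b c d, 1) (lcoset L w) (lcoset L v) = weil_entry a m d w v"
    using entry_eq_weil_entry[OF assms(6,8,7,14,15)] unfolding m(1) by simp
  also have "\<dots> = er (- (of_nat n / 8)) * of_real (sqrt m) ^ n / of_real (sqrt disc) *
      (er ?E * (of_int (kronecker (int disc) c) * of_int (kronecker \<bar>a\<bar> c) ^ n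
        * er (of_nat n * of_int (sgn a) * (1 - of_nat m0) / 8) / of_real (sqrt m) ^ n))"
    unfolding weil_entry_def mean gauss assms(2) m(1) ..
  \<comment> \<open>The powers of \<open>sqrt m\<close> in the entry and in the Gauss sum
    cancel.\<close>
  also have "\<dots> = 1 / of_real (sqrt disc) * er (- (of_nat n / 8)) * of_int (kronecker \<bar>a\<bar> c) ^ n
      * of_int (kronecker (int disc) c) * er (of_nat n * of_int (sgn a) * (1 - of_nat m0) / 8) * er ?E"
    using m(2) by (simp add: mult_ac)
  also have "er (- (of_nat n / 8)) = (- \<i>) powr (of_nat n / 2)" by (rule minus_ii_powr[symmetric])
  also have "er (of_nat n * of_int (sgn a) * (1 - of_nat m0) / 8) = ee (of_nat n * of_int (sgn a) * (1 - of_int c0) / 8)"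
    unfolding er_def m0 by (simp add: of_rat_mult of_rat_divide of_rat_diff)
  also have "er ?E = ee (of_rat ?E)" by (rule er_def)
  finally show ?thesis unfolding D .
qed
end
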